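(* Suppose that $W:[0,\infty)\to[0,\infty]$ satisfies: (1) $W(0)=1$, $W$ is non-decreasing, $W$ is lower-semicontinuous, and $\lim_{t\to\infty}W(t)=\infty$; (2) the mapping $\log r\mapsto \log W(r)$ is convex on $[1,\infty)$ (that is, $s\mapsto \log W(e^s)$ is a convex function of $s\in[0,\infty)$; this permits an interval $(t_0,\infty)$ on which $W=+\infty$). Then $W$ satisfies the PLS property if and only if $$\int_0^{\infty}\frac{\log W(t)}{1+t^2}\,dm_1(t)=\infty.$$
   Context: $m_d$ denotes Lebesgue measure on $\mathbb{R}^d$. The Fourier transform on $L^2(\mathbb{R}^d)$ is the extension of $\widehat f(\xi)=\int_{\mathbb{R}^d}f(t)e^{-2\pi i\xi\cdot t}\,dm_d(t)$. A Borel set $E\subset\mathbb{R}^d$ is $(\gamma,\ell)$-relatively dense if $m_d(E\cap Q)\ge\gamma$ for any cube $Q\subset\mathbb{R}^d$ of side-length $\ell$. A weight $W:[0,\infty)\to[0,\infty]$ has the Paneah-Logvinenko-Sereda (PLS) property if, for every $d\in\mathbb{N}$ ($d\ge1$), $\gamma\in(0,1)$, $\ell>0$, and $C_W>0$, there exists a finite constant $C=C(d,W,C_W,\gamma,\ell)>0$ such that if $f\in L^2(\mathbb{R}^d)$ satisfies $$\int_{\mathbb{R}^d}|\widehat f(\xi)W(|\xi|)|^2\,dm_d(\xi)\le C_W^2\|f\|_{L^2(\mathbb{R}^d)}^2,$$ and $E\subset\mathbb{R}^d$ is a $(\gamma,\ell)$-relatively dense set, then $\|f\|_{L^2(\mathbb{R}^d)}\le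 C\|f\|_{L^2(E)}$. *)

theory Defs
  imports "HOL-Analysis.Analysis"
begin

section \<open>Lebesgue measure on R^d, with d an object-level number\<close>

text \<open>
  The dimension is quantified inside the PLS property, so points of R^d are modelled as extensional
  functions on \<open>{..<d}\<close>. The \<open>\<sigma>\<close>-algebra of \<open>leb d\<close> is the Borel one; every
  class in L^2 has a Borel representative.
\<close>

abbreviation leb :: "nat \<Rightarrow> (nat \<Rightarrow> real) measure" where
  "leb d \<equiv> PiM {..<d} (\<lambda>_. lborel)"

definition cube :: "nat \<Rightarrow> (nat \<Rightarrow> real) \<Rightarrow> real \<Rightarrow> (nat \<Rightarrow> real) set" where
  "cube d a l = PiE {..<d} (\<lambda>i. {a i .. a i + l})"

definition relatively_dense :: "nat \<Rightarrow> real \<Rightarrow> real \<Rightarrow> (nat \<Rightarrow> real) set \<Rightarrow> bool" where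
  "relatively_dense d \<gamma> l E \<longleftrightarrow>
     E \<in> sets (leb d) \<and> (\<forall>a. emeasure (leb d) (E \<inter> cube d a l) \<ge> ennreal \<gamma>)"


section \<open>Square-integrable functions and the Fourier transform\<close>

definition square_integrable :: "'a measure \<Rightarrow> ('a \<Rightarrow> complex) \<Rightarrow> bool" where
  "square_integrable M f \<longleftrightarrow> f \<in> borel_measurable M \<and> integrable M (\<lambda>x. (cmod (f x))\<^sup>2)"

definition L2_norm :: "'a measure \<Rightarrow> ('a \<Rightarrow> complex) \<Rightarrow> real" where
  "L2_norm M f = sqrt (\<integral>x. (cmod (f x))\<^sup>2 \<partial>M)"

text \<open>Stated with the nonnegative integral, so that divergent integrals are not read as 0.\<close>

definition L2_tendsto :: "'a measure \<Rightarrow> (nat \<Rightarrow> 'a \<Rightarrow> complex) \<Rightarrow> ('a \<Rightarrow> complex) \<Rightarrow> bool" where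
  "L2_tendsto M F f \<longleftrightarrow>
     (\<lambda>n. \<integral>\<^sup>+x. ennreal ((cmod (F n x - f x))\<^sup>2) \<partial>M) \<longlonglongrightarrow> 0"

definition fourier_integral ::
    "nat \<Rightarrow> ((nat \<Rightarrow> real) \<Rightarrow> complex) \<Rightarrow> (nat \<Rightarrow> real) \<Rightarrow> complex" where
  "fourier_integral d f \<xi> =
     (\<integral>t. f t * exp (- 2 * complex_of_real pi * \<i> * complex_of_real (\<Sum>i<d. \<xi> i * t i)) \<partial>leb d)"

text \<open>
  \<open>g\<close> is (a representative of) the L^2 Fourier transform of \<open>f\<close>: the continuous extension
  to L^2 of \<open>fourier_integral\<close> on the dense subspace of functions that are both integrable and
  square-integrable. By Plancherel's theorem such a \<open>g\<close> exists for every square-integrable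
  \<open>f\<close> and is unique almost everywhere.
\<close>

definition is_fourier_transform ::
    "nat \<Rightarrow> ((nat \<Rightarrow> real) \<Rightarrow> complex) \<Rightarrow> ((nat \<Rightarrow> real) \<Rightarrow> complex) \<Rightarrow> bool" where
  "is_fourier_transform d f g \<longleftrightarrow>
     square_integrable (leb d) f \<and> square_integrable (leb d) g \<and>
     (\<exists>F. (\<forall>n. integrable (leb d) (F n) \<and> square_integrable (leb d) (F n)) \<and>
          L2_tendsto (leb d) F f \<and>
          L2_tendsto (leb d) (\<lambda>n. fourier_integral d (F n)) g)"


section \<open>Weights\<close>

text \<open>
  A weight is a function into \<open>[0,\<infinity>]\<close> of which only the values on \<open>[0,\<infinity>)\<close>
  matter. The product \<open>0 * \<infinity>\<close> is 0 in \<^typ>\<open>ennreal\<close>: where \<open>W\<close> is infinite,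
  \<open>g\<close> has to vanish almost everywhere.
  \<open>L2_set \<xi> {..<d}\<close> is the Euclidean norm of \<open>\<xi>\<close>.
\<close>

definition PLS_property :: "(real \<Rightarrow> ennreal) \<Rightarrow> bool" where
  "PLS_property W \<longleftrightarrow>
     (\<forall>d\<ge>1. \<forall>\<gamma>\<in>{0<..<1}. \<forall>l>0. \<forall>CW>0. \<exists>C>0. \<forall>f g E.
        square_integrable (leb d) f \<longrightarrow>
        is_fourier_transform d f g \<longrightarrow>
        (\<integral>\<^sup>+\<xi>. (ennreal (cmod (g \<xi>)) * W (L2_set \<xi> {..<d}))\<^sup>2 \<partial>leb d)
          \<le> ennreal (CW\<^sup>2 * (L2_norm (leb d) f)\<^sup>2) \<longrightarrow>
        relatively_dense d \<gamma> l E \<longrightarrow>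
        L2_norm (leb d) f \<le> C * L2_norm (restrict_space (leb d) E) f)"

definition lower_semicontinuous_on ::
    "'a::topological_space set \<Rightarrow> ('a \<Rightarrow> 'b::complete_lattice) \<Rightarrow> bool" where
  "lower_semicontinuous_on S f \<longleftrightarrow> (\<forall>x\<in>S. f x \<le> Liminf (at x within S) f)"

definition ext_ln :: "ennreal \<Rightarrow> ereal" where
  "ext_ln x = (if x = \<infinity> then \<infinity> else if x = 0 then - \<infinity> else ereal (ln (enn2real x)))"

text \<open>
  The library's \<^const>\<open>convex_on\<close>, for extended-real values. Here too \<open>0 * \<infinity> = 0\<close>,
  and \<open>\<infinity> + - \<infinity> = \<infinity>\<close>.
\<close>

definition ext_convex_on :: "'a::real_vector set \<Rightarrow> ('a \<Rightarrow> ereal) \<Rightarrow> bool" where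
  "ext_convex_on S f \<longleftrightarrow> convex S \<and>
     (\<forall>x\<in>S. \<forall>y\<in>S. \<forall>u\<ge>0. \<forall>v\<ge>0. u + v = 1 \<longrightarrow>
        f (u *\<^sub>R x + v *\<^sub>R y) \<le> ereal u * f x + ereal v * f y)"

end

theory Submission
  imports Defs "HOL-Probability.Probability"
begin

text \<open>
  Divergence of the integral. Convexity turns \<open>W\<close> into a non-decreasing sequence \<open>\<rho>\<close> with
  \<open>t ^ n \<le> W t * (\<Prod>k<n. \<rho> k)\<close> and \<open>(\<Sum>k. 1 / \<rho> k) = \<infinity>\<close>, so that the hypothesis on \<open>f\<close> bounds
  the \<open>n\<close>-th derivatives of \<open>f\<close> in \<open>L\<^sup>2\<close> by a quasi-analytic sequence. On all cubes of a tiling but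
  those carrying at most half of the mass, these bounds hold locally, relative to the mass of the
  cube, and a Sobolev inequality makes them uniform. Bang's proof of the Denjoy--Carleman theorem is
  quantitative: if all derivatives up to a high order are small at one point, the function is small
  on the whole interval. Smallness on a set of positive measure gives such a point by the mean value
  theorem applied to many separated points of a short subinterval. Slicing the cube in the coordinate
  directions extends this to several variables.

  Convergence of the integral. A tent function is convolved with infinitely many normalised
  indicators of intervals, the number at scale \<open>1 / 2 ^ k\<close> being about \<open>ln (W (2 ^ (k + 1)))\<close>. The sum of
  their lengths converges, so that the result has small support, and its Fourier transform decays
  faster than \<open>1 / W\<close>. It vanishes on a relatively dense set.
\<close>

section \<open>Propagation of smallness in one variable\<close>

text \<open>Quasi-analyticity by itself is qualitative, whereas the constant may depend only on
  \<open>d\<close>, \<open>W\<close>, \<open>CW\<close>, \<open>\<gamma>\<close> and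
  \<open>l\<close>. Bang's argument is quantitative because finitely many derivatives matter:
  divergence of \<open>(\<Sum>k. 1 / \<rho> k)\<close> lets finitely many steps of length
  \<open>1 / (exp 1 * \<rho> k)\<close> cross a cube, and smallness of the derivatives up to that
  order follows from smallness on a set of given measure. For finite \<open>W\<close> the sequence
  \<open>\<rho>\<close> comes from a discrete Legendre transform: by convexity the increments of
  \<open>s \<mapsto> ln (W (exp s))\<close> over unit steps increase, and
  \<open>ln (\<rho> k)\<close> is, up to rounding, the place where they reach \<open>k + 1\<close>.
  The obstacle to localisation is that all orders of differentiation must be good on the same cube.
  Order \<open>m\<close> therefore enters with a weight containing \<open>1 / 2 ^ m\<close>; its
  cost is a constant factor in \<open>\<rho>\<close>, harmless for the divergence of the sum. As the
  transform is only an L^2 limit, \<open>f\<close> has to be identified almost everywhere with a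
  smooth function: Gaussian averages tie \<open>f\<close> to its transform, and the moments of the
  transform make it integrable.\<close>

text \<open>One step of Bang's descent. The reserve \<open>exp (n - Suc N)\<close> makes derivatives
  of low order tiny and asks nothing new at order \<open>Suc N\<close>, where the global bound
  controls the Taylor remainder. A move of length \<open>1 / (exp 1 * \<rho> N)\<close> multiplies
  the bounds by at most \<open>exp 1\<close>, that is, it costs one unit of the level.\<close>

lemma bang_step:
  fixes h :: "nat \<Rightarrow> real \<Rightarrow> real" and \<rho> :: "nat \<Rightarrow> real"
  assumes der: "\<And>n x. DERIV (h n) x :> h (Suc n) x"
    and bound: "\<And>n x. x \<in> {a..b} \<Longrightarrow> \<bar>h n x\<bar> \<le> S * (\<Prod>k<n. \<rho> k)"
    and \<rho>: "\<And>k. 0 < \<rho> k" "mono \<rho>" and S: "0 \<le> S"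
    and x0: "x0 \<in> {a..b}" and x: "x \<in> {a..b}"
    and small: "\<And>n. n \<le> Suc N \<Longrightarrow> \<bar>h n x0\<bar> \<le> S * (\<Prod>k<n. \<rho> k) * exp (real n - real (Suc N))"
    and close: "\<bar>x - x0\<bar> * (exp 1 * \<rho> N) \<le> 1"
    and n: "n \<le> N"
  shows "\<bar>h n x\<bar> \<le> S * (\<Prod>k<n. \<rho> k) * exp (real n - real N)"
proof (cases "x = x0")
  case True
  have "\<bar>h n x\<bar> \<le> S * (\<Prod>k<n. \<rho> k) * exp (real n - real (Suc N))"
    using small[of n] n True by auto
  also have "\<dots> \<le> S * (\<Prod>k<n. \<rho> k) * exp (real n - real N)"
    using S \<rho>(1) by (intro mult_left_mono mult_nonneg_nonneg prod_nonneg) (auto intro: less_imp_le)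
  finally show ?thesis .
next
  case False
  define m where "m = Suc N - n"
  have m: "m > 0" "n + m = Suc N" using n by (auto simp: m_def)
  define P where "P = (\<lambda>n. \<Prod>k<n. \<rho> k)"
  have Pn: "P j \<ge> 0" for j unfolding P_def using \<rho>(1) by (intro prod_nonneg) (auto intro: less_imp_le)
  \<comment> \<open>Monotonicity of \<open>\<rho>\<close> enters here: the \<open>j\<close>
    additional factors all have index at most \<open>N\<close>.\<close>
  have P_ratio: "P (n + j) \<le> P n * \<rho> N ^ j" if "n + j \<le> Suc N" for j
    using that
  proof (induction j)
    case (Suc j)
    have "P (n + Suc j) = P (n + j) * \<rho> (n + j)" by (simp add: P_def)
    also have "\<dots> \<le> (P n * \<rho> N ^ j) * \<rho> N"
      using Suc \<rho> Pn[of n] less_imp_le[OF \<rho>(1)] by (intro mult_mono Suc.IH) (auto simp: mono_def)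
    finally show ?case by (simp add: mult_ac)
  qed simp
  have "\<exists>t. (if x < x0 then x < t \<and> t < x0 else x0 < t \<and> t < x) \<and>
     h n x = (\<Sum>j<m. h (n + j) x0 / fact j * (x - x0) ^ j) + h (n + m) t / fact m * (x - x0) ^ m"
    using False x0 x der by (intro Taylor[OF m(1), where a = a and b = b]) auto
  then obtain t where t: "if x < x0 then x < t \<and> t < x0 else x0 < t \<and> t < x"
    and eq: "h n x = (\<Sum>j<m. h (n + j) x0 / fact j * (x - x0) ^ j) + h (n + m) t / fact m * (x - x0) ^ m"
    by blast
  have tab: "t \<in> {a..b}" using t x x0 by (auto split: if_splits)
  \<comment> \<open>The Taylor terms are majorised by those of the exponential series of
    \<open>z\<close>, scaled by \<open>c\<close>; the assumption \<open>close\<close> says that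
    \<open>z \<le> 1\<close>.\<close>
  define z where "z = exp 1 * \<rho> N * \<bar>x - x0\<bar>"
  define c where "c = S * P n * exp (real n - real (Suc N))"
  have c: "c \<ge> 0" using S Pn by (auto simp: c_def)
  have trm: "\<bar>y / fact j * (x - x0) ^ j\<bar> \<le> c * (z ^ j /\<^sub>R fact j)"
    if "\<bar>y\<bar> \<le> S * P (n + j) * exp (real (n + j) - real (Suc N))" "n + j \<le> Suc N" for y j
  proof -
    have "\<bar>y\<bar> \<le> S * P (n + j) * exp (real (n + j) - real (Suc N))" by (rule that)
    also have "\<dots> \<le> S * (P n * \<rho> N ^ j) * exp (real (n + j) - real (Suc N))"
      using P_ratio[OF that(2)] S by (intro mult_right_mono mult_left_mono) auto
    also have "exp (real (n + j) - real (Suc N)) = exp (real n - real (Suc N)) * exp 1 ^ j"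
      by (simp add: exp_of_nat_mult[symmetric] exp_add[symmetric] algebra_simps)
    finally have "\<bar>y\<bar> \<le> c * (exp 1 * \<rho> N) ^ j" by (simp add: c_def power_mult_distrib mult_ac)
    then have "\<bar>y\<bar> * \<bar>x - x0\<bar> ^ j / fact j \<le> c * (exp 1 * \<rho> N) ^ j * \<bar>x - x0\<bar> ^ j / fact j"
      by (intro divide_right_mono mult_right_mono) auto
    then show ?thesis
      by (simp add: abs_mult power_abs z_def power_mult_distrib field_simps)
  qed
  have "\<bar>h n x\<bar> \<le> (\<Sum>j<m. \<bar>h (n + j) x0 / fact j * (x - x0) ^ j\<bar>) + \<bar>h (n + m) t / fact m * (x - x0) ^ m\<bar>"
    unfolding eq by (intro order.trans[OF abs_triangle_ineq] add_mono sum_abs order_refl)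
  also have "\<dots> \<le> (\<Sum>j<m. c * (z ^ j /\<^sub>R fact j)) + c * (z ^ m /\<^sub>R fact m)"
  proof (intro add_mono sum_mono trm)
    fix j assume "j \<in> {..<m}"
    then show "n + j \<le> Suc N" using m by auto
    then show "\<bar>h (n + j) x0\<bar> \<le> S * P (n + j) * exp (real (n + j) - real (Suc N))"
      using small[of "n + j"] by (simp add: P_def)
  next
    show "\<bar>h (n + m) t\<bar> \<le> S * P (n + m) * exp (real (n + m) - real (Suc N))"
      using bound[OF tab, of "n + m"] m(2) by (simp add: P_def)
  qed (use m in auto)
  also have "\<dots> = c * (\<Sum>j<Suc m. z ^ j /\<^sub>R fact j)" by (simp add: sum_distrib_left algebra_simps)
  also have "\<dots> \<le> c * exp z"
  proof (intro mult_left_mono c)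
    have z0: "z \<ge> 0" using less_imp_le[OF \<rho>(1)] by (auto simp: z_def)
    show "(\<Sum>j<Suc m. z ^ j /\<^sub>R fact j) \<le> exp z"
      unfolding exp_def using z0 by (intro sum_le_suminf summable_exp_generic) auto
  qed
  also have "\<dots> \<le> c * exp 1"
    using close c by (intro mult_left_mono) (auto simp: z_def mult_ac)
  also have "\<dots> = S * P n * exp (real n - real N)"
    by (simp add: c_def exp_add[symmetric] mult.assoc)
  finally show ?thesis by (simp add: P_def)
qed

text \<open>Steps of \<open>bang_step\<close> are chained from level \<open>N\<close> down to level
  \<open>m\<close>, and the distance that can be covered is the sum of the step lengths. Stopping at
  \<open>m\<close> rather than at \<open>0\<close> leaves a gain of \<open>exp (- m)\<close> for the
  function itself.\<close>

lemma bang_iterate: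
  fixes h :: "nat \<Rightarrow> real \<Rightarrow> real" and \<rho> :: "nat \<Rightarrow> real"
  assumes der: "\<And>n x. DERIV (h n) x :> h (Suc n) x"
    and bound: "\<And>n x. x \<in> {a..b} \<Longrightarrow> \<bar>h n x\<bar> \<le> S * (\<Prod>k<n. \<rho> k)"
    and \<rho>: "\<And>k. 0 < \<rho> k" "mono \<rho>" and S: "0 \<le> S"
    and x: "x \<in> {a..b}"
    and "m \<le> N" "x0 \<in> {a..b}"
    and "\<And>n. n \<le> N \<Longrightarrow> \<bar>h n x0\<bar> \<le> S * (\<Prod>k<n. \<rho> k) * exp (real n - real N)"
    and "\<bar>x - x0\<bar> \<le> (\<Sum>k=m..<N. 1 / (exp 1 * \<rho> k))"
    and "n \<le> m"
  shows "\<bar>h n x\<bar> \<le> S * (\<Prod>k<n. \<rho> k) * exp (real n - real m)"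
  using assms(7-)
proof (induction N arbitrary: x0 n rule: dec_induct)
  case base
  then have "x = x0" by auto
  then show ?case using base by auto
next
  case (step N)
  define \<tau> where "\<tau> = 1 / (exp 1 * \<rho> N)"
  have \<tau>: "\<tau> > 0" using \<rho>(1) by (auto simp: \<tau>_def)
  have sum: "(\<Sum>k=m..<Suc N. 1 / (exp 1 * \<rho> k)) = (\<Sum>k=m..<N. 1 / (exp 1 * \<rho> k)) + \<tau>"
    using step by (simp add: \<tau>_def)
  have sum0: "(\<Sum>k=m..<N. 1 / (exp 1 * \<rho> k)) \<ge> 0"
    using less_imp_le[OF \<rho>(1)] by (intro sum_nonneg) auto
  \<comment> \<open>One maximal step towards \<open>x\<close>, or all the way if \<open>x\<close> is
    near. As \<open>x1\<close> lies between \<open>x0\<close> and \<open>x\<close>, it stays where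
    the bounds hold.\<close>
  define x1 where "x1 = (if \<bar>x - x0\<bar> \<le> \<tau> then x else if x0 \<le> x then x0 + \<tau> else x0 - \<tau>)"
  have x1: "x1 \<in> {a..b}" using x step(4) \<tau> by (auto simp: x1_def)
  have "\<bar>x1 - x0\<bar> \<le> \<tau>" using \<tau> by (auto simp: x1_def)
  then have c: "\<bar>x1 - x0\<bar> * (exp 1 * \<rho> N) \<le> 1"
    using \<rho>(1)[of N] by (simp add: \<tau>_def field_simps)
  have d: "\<bar>x - x1\<bar> \<le> (\<Sum>k=m..<N. 1 / (exp 1 * \<rho> k))"
    using step(6) \<tau> sum0 unfolding sum by (auto simp: x1_def)
  have "\<bar>h n x1\<bar> \<le> S * (\<Prod>k<n. \<rho> k) * exp (real n - real N)" if "n \<le> N" for n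
    by (rule bang_step[OF der bound \<rho> S step(4) x1 step(5) c that])
  from step.IH[OF x1 this d step(7)] show ?case .
qed

section \<open>From small values on a set to small derivatives at a point\<close>

text \<open>Consecutive points are paired; the mean value theorem in each pair gives half as many
  points for the derivative, at the cost of a factor \<open>2 / s\<close>. The gaps between
  neighbouring pairs keep the new points \<open>s\<close> apart, so that the argument can be
  repeated \<open>n\<close> times.\<close>

lemma iterated_mvt:
  fixes h :: "nat \<Rightarrow> real \<Rightarrow> real"
  assumes "\<And>n x. DERIV (h n) x :> h (Suc n) x"
    and "s > 0" "\<And>i. Suc i < 2 ^ n \<Longrightarrow> p i + s \<le> p (Suc i)"
    and "\<And>i. i < 2 ^ n \<Longrightarrow> p i \<in> {a..b}"
    and "\<And>i. i < 2 ^ n \<Longrightarrow> \<bar>h 0 (p i)\<bar> \<le> \<epsilon>"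
  shows "\<exists>\<xi>\<in>{a..b}. \<bar>h n \<xi>\<bar> \<le> (2 / s) ^ n * \<epsilon>"
  using assms
proof (induction n arbitrary: h p \<epsilon>)
  case 0
  then show ?case by auto
next
  case (Suc n)
  have "\<exists>\<xi>. p (2*i) < \<xi> \<and> \<xi> < p (2*i+1) \<and> h 0 (p (2*i+1)) - h 0 (p (2*i)) = (p (2*i+1) - p (2*i)) * h (Suc 0) \<xi>"
    if "i < 2 ^ n" for i
    using Suc.prems(1)[of 0] Suc.prems(2) Suc.prems(3)[of "2*i"] that by (intro MVT2) auto
  then obtain q where q: "\<And>i. i < 2 ^ n \<Longrightarrow> p (2*i) < q i \<and> q i < p (2*i+1) \<and>
      h 0 (p (2*i+1)) - h 0 (p (2*i)) = (p (2*i+1) - p (2*i)) * h (Suc 0) (q i)"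
    by metis
  have "\<exists>\<xi>\<in>{a..b}. \<bar>h (Suc n) \<xi>\<bar> \<le> (2 / s) ^ n * (2 / s * \<epsilon>)"
  proof (rule Suc.IH[where h = "\<lambda>n. h (Suc n)" and p = q])
    show "q i + s \<le> q (Suc i)" if "Suc i < 2 ^ n" for i
      using q[of i] q[of "Suc i"] Suc.prems(3)[of "2*i+1"] that by auto
    show "q i \<in> {a..b}" if "i < 2 ^ n" for i
      using q[of i] that Suc.prems(4)[of "2*i"] Suc.prems(4)[of "2*i+1"] by auto
    show "\<bar>h (Suc 0) (q i)\<bar> \<le> 2 / s * \<epsilon>" if i: "i < 2 ^ n" for i
    proof -
      have "p (2*i) + s \<le> p (2*i+1)" using Suc.prems(3)[of "2*i"] i by auto
      then have "s * \<bar>h (Suc 0) (q i)\<bar> \<le> (p (2*i+1) - p (2*i)) * \<bar>h (Suc 0) (q i)\<bar>"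
        by (intro mult_right_mono) auto
      also have "\<dots> = \<bar>h 0 (p (2*i+1)) - h 0 (p (2*i))\<bar>"
        using q[OF i] Suc.prems(2) by (simp add: abs_mult)
      also have "\<dots> \<le> 2 * \<epsilon>"
        using Suc.prems(5)[of "2*i"] Suc.prems(5)[of "2*i+1"] i by auto
      finally show ?thesis using Suc.prems(2) by (simp add: field_simps)
    qed
  qed (use Suc.prems in auto)
  then show ?case by (simp add: mult_ac)
qed

text \<open>Greedy choice from the left: an almost leftmost point \<open>x\<close> is taken and
  \<open>E\<close> is cut down to \<open>{x + s..}\<close>, which costs little more than
  \<open>s\<close> in measure. The infimum of \<open>E\<close> need not be attained; the strict
  inequality in the hypothesis pays for the excess.\<close>

lemma exists_separated_points:
  fixes E :: "real set"
  assumes "E \<in> sets lborel" "E \<subseteq> {a..b}" "s > 0" "measure lborel E > real K * s"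
  shows "\<exists>p. (\<forall>i<K. p i \<in> E) \<and> (\<forall>i. Suc i < K \<longrightarrow> p i + s \<le> p (Suc i))"
  using assms
proof (induction K arbitrary: E)
  case (Suc K)
  have fin: "A \<in> fmeasurable lborel" if "A \<in> sets lborel" "A \<subseteq> {a..b}" for A
    using that by (intro fmeasurableI2[OF _ that(2) that(1)]) (simp add: fmeasurable_def emeasure_lborel_Icc_eq)
  define \<eta> where "\<eta> = (measure lborel E - real (Suc K) * s) / 2"
  have \<eta>: "\<eta> > 0" using Suc.prems by (auto simp: \<eta>_def)
  have "0 \<le> real (Suc K) * s" using Suc.prems(3) by simp
  then have ne: "E \<noteq> {}" using Suc.prems(4) by (metis less_le_not_le measure_empty)
  have bdd: "bdd_below E" using Suc.prems(2) by (meson bdd_below.I atLeastAtMost_iff subsetD)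
  obtain x where x: "x \<in> E" "x < Inf E + \<eta>" using cInf_lessD[OF ne, of "Inf E + \<eta>"] \<eta> by auto
  define E' where "E' = E \<inter> {x + s..}"
  have low: "Inf E \<le> y" if "y \<in> E" for y using bdd that by (rule cInf_lower[rotated])
  have "E \<subseteq> E' \<union> {Inf E..x + s}" using low by (auto simp: E'_def)
  moreover have E': "E' \<in> sets lborel" "E' \<subseteq> {a..b}" using Suc.prems by (auto simp: E'_def)
  ultimately have "measure lborel E \<le> measure lborel (E' \<union> {Inf E..x + s})"
    using Suc.prems fin[OF E'] by (intro measure_mono_fmeasurable fmeasurable.Un)
      (auto simp: fmeasurable_def emeasure_lborel_Icc_eq)
  also have "\<dots> \<le> measure lborel E' + measure lborel {Inf E..x + s}"
    using E' by (intro measure_Un_le) auto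
  also have "measure lborel {Inf E..x + s} = x + s - Inf E"
    using low[OF x(1)] Suc.prems by simp
  finally have "measure lborel E' > real K * s"
    using x(2) Suc.prems by (auto simp: \<eta>_def field_simps)
  from Suc.IH[OF E' Suc.prems(3) this] obtain p where
    p: "\<And>i. i < K \<Longrightarrow> p i \<in> E'" "\<And>i. Suc i < K \<Longrightarrow> p i + s \<le> p (Suc i)" by blast
  define q where "q = (\<lambda>i. case i of 0 \<Rightarrow> x | Suc j \<Rightarrow> p j)"
  show ?case
  proof (intro exI[of _ q] conjI allI impI)
    fix i assume "i < Suc K" then show "q i \<in> E"
      using p(1) x by (auto simp: q_def E'_def split: nat.split)
  next
    fix i assume "Suc i < Suc K" then show "q i + s \<le> q (Suc i)"
      using p(1)[of 0] p(2) by (auto simp: q_def E'_def split: nat.split)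
  qed
qed simp

text \<open>All parameters are fixed before the function is known, which makes
  \<open>\<epsilon>\<close> uniform. The mean value argument yields a different point for every
  order \<open>n \<le> N\<close>, while Bang's descent starts from a single one; on a sufficiently
  short subinterval the bound on the next derivative carries the smallness from all these points to
  the common left endpoint.\<close>

lemma propagation_1d:
  fixes \<rho> :: "nat \<Rightarrow> real"
  assumes \<rho>: "\<And>k. 0 < \<rho> k" "mono \<rho>" "\<not> summable (\<lambda>k. 1 / \<rho> k)"
    and pos: "S > 0" "l > 0" "\<gamma> > 0" "\<delta> > 0"
  shows "\<exists>\<epsilon>>0. \<forall>h a E. (\<forall>n x. DERIV (h n) x :> h (Suc n) x) \<longrightarrow>
    (\<forall>n. \<forall>x\<in>{a..a+l}. \<bar>h n x\<bar> \<le> S * (\<Prod>k<n. \<rho> k)) \<longrightarrow>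
    E \<in> sets lborel \<longrightarrow> E \<subseteq> {a..a+l} \<longrightarrow> ennreal \<gamma> \<le> emeasure lborel E \<longrightarrow>
    (\<forall>x\<in>E. \<bar>h 0 x\<bar> \<le> \<epsilon>) \<longrightarrow> (\<forall>x\<in>{a..a+l}. \<bar>h 0 x\<bar> \<le> \<delta>)"
proof -
  define P where "P = (\<lambda>n. \<Prod>k<n. \<rho> k)"
  have P: "P n > 0" for n unfolding P_def using \<rho>(1) by (intro prod_pos) auto
  \<comment> \<open>The level at which the descent may stop.\<close>
  obtain m :: nat where m0: "real m > ln (S / \<delta>)" using reals_Archimedean2 by blast
  have m: "S * exp (- real m) \<le> \<delta>"
  proof -
    have "S / \<delta> \<le> exp (real m)"
      using m0 pos by (metis divide_pos_pos exp_le_cancel_iff exp_ln less_imp_le)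
    then show ?thesis using pos by (simp add: exp_minus field_simps)
  qed
  define r where "r = (\<lambda>k. 1 / (exp 1 * \<rho> k))"
  have r: "r k \<ge> 0" for k using less_imp_le[OF \<rho>(1)] by (simp add: r_def)
  have "\<not> summable r"
  proof
    assume "summable r"
    then have "summable (\<lambda>k. exp 1 * r k)" by (rule summable_mult)
    then show False using \<rho>(3) by (simp add: r_def)
  qed
  \<comment> \<open>Divergence of the sum is used here: the steps between the levels
    \<open>m\<close> and \<open>N\<close> together cover the length \<open>l\<close>.\<close>
  then have "\<exists>N. \<not> sum r {..<N} \<le> l + sum r {..<m}"
    using summableI_nonneg_bounded[of r, OF r] by blast
  then obtain N where N: "sum r {..<N} > l + sum r {..<m}" by (auto simp: not_le)
  have mN: "m \<le> N"
  proof (rule ccontr)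
    assume "\<not> m \<le> N"
    then have "sum r {..<N} \<le> sum r {..<m}" using r by (intro sum_mono2) auto
    then show False using N pos by simp
  qed
  have lN: "l \<le> (\<Sum>k=m..<N. r k)"
    using N sum.atLeastLessThan_concat[of 0 m N r] mN by (simp add: lessThan_atLeast0)
  define T where "T = (\<lambda>n. S * P n * exp (real n - real N))"
  \<comment> \<open>A common threshold for the orders up to \<open>N\<close> at the starting point.
    One half of it is spent on the mean value argument (\<open>\<epsilon>le\<close>), the other on
    the transfer across a subinterval (\<open>w\<Lambda>\<close>).\<close>
  define \<tau> where "\<tau> = Min (T ` {..N})"
  have T: "T n > 0" for n using P pos by (simp add: T_def)
  have \<tau>: "\<tau> > 0" using T by (auto simp: \<tau>_def)
  have \<tau>le: "\<tau> \<le> T n" if "n \<le> N" for n using that by (auto simp: \<tau>_def intro!: Min_le)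
  define \<Lambda> where "\<Lambda> = Max ((\<lambda>n. S * P (Suc n)) ` {..N})"
  have \<Lambda>le: "S * P (Suc n) \<le> \<Lambda>" if "n \<le> N" for n using that by (auto simp: \<Lambda>_def intro!: Max_ge)
  have \<Lambda>: "\<Lambda> > 0" using \<Lambda>le[of 0] P[of "Suc 0"] pos by (smt (verit) mult_pos_pos le0)
  obtain q0 :: nat where q0: "real q0 > 2 * l * \<Lambda> / \<tau>" using reals_Archimedean2 by blast
  define q where "q = Suc q0"
  define w where "w = l / real q"
  have w: "w > 0" using pos by (simp add: w_def q_def)
  have "2 * l * \<Lambda> / \<tau> \<le> real q" using q0 by (simp add: q_def)
  then have w\<Lambda>: "w * \<Lambda> \<le> \<tau> / 2" using \<tau> pos by (simp add: w_def field_simps q_def)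
  \<comment> \<open>Each of the \<open>2 ^ N\<close> points gets half of its share of the measure
    \<open>\<gamma> / q\<close>; \<open>exists_separated_points\<close> asks for a strict
    inequality.\<close>
  define s where "s = \<gamma> / (real q * 2 ^ Suc N)"
  have s: "s > 0" using pos by (simp add: s_def q_def)
  \<comment> \<open>The base \<open>1 + 2 / s\<close>, unlike \<open>2 / s\<close>, is certainly at
    least \<open>1\<close>, so that its power \<open>N\<close> dominates all lower powers.\<close>
  define \<epsilon> where "\<epsilon> = \<tau> / 2 / (1 + 2 / s) ^ N"
  have \<epsilon>: "\<epsilon> > 0" using \<tau> s by (simp add: \<epsilon>_def add_pos_pos)
  have \<epsilon>le: "(2 / s) ^ n * \<epsilon> \<le> \<tau> / 2" if "n \<le> N" for n
  proof -
    have "(2 / s) ^ n \<le> (1 + 2 / s) ^ n" using s by (intro power_mono) auto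
    also have "\<dots> \<le> (1 + 2 / s) ^ N" using s that by (intro power_increasing) auto
    finally have "(2 / s) ^ n * \<epsilon> \<le> (1 + 2 / s) ^ N * \<epsilon>" using \<epsilon> by (intro mult_right_mono) auto
    moreover have "1 + 2 / s > 0" using s by (intro add_pos_pos) auto
    then have "(1 + 2 / s) ^ N * \<epsilon> = \<tau> / 2" by (simp add: \<epsilon>_def)
    ultimately show ?thesis by linarith
  qed
  show ?thesis
  proof (intro exI[of _ \<epsilon>] conjI \<epsilon> allI impI)
    fix h :: "nat \<Rightarrow> real \<Rightarrow> real" and a E
    assume der: "\<forall>n x. DERIV (h n) x :> h (Suc n) x"
      and bound: "\<forall>n. \<forall>x\<in>{a..a+l}. \<bar>h n x\<bar> \<le> S * (\<Prod>k<n. \<rho> k)"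
      and E: "E \<in> sets lborel" "E \<subseteq> {a..a+l}" "ennreal \<gamma> \<le> emeasure lborel E"
      and small: "\<forall>x\<in>E. \<bar>h 0 x\<bar> \<le> \<epsilon>"
    define J where "J = (\<lambda>i::nat. {a + real i * w..a + real i * w + w})"
    have wq: "real q * w = l" by (simp add: w_def q_def)
    have cover: "E \<subseteq> (\<Union>i<q. E \<inter> J i)"
    proof
      fix x assume x: "x \<in> E"
      then have xa: "a \<le> x" "x \<le> a + l" using E by auto
      show "x \<in> (\<Union>i<q. E \<inter> J i)"
      proof (cases "x = a + l")
        case True
        have "real q0 * w + w = l" using wq by (simp add: q_def algebra_simps)
        then have "x \<in> J q0" using True w by (auto simp: J_def)
        then show ?thesis using x by (auto simp: q_def)
      next
        case False
        define i where "i = nat \<lfloor>(x - a) / w\<rfloor>"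
        have nn: "(x - a) / w \<ge> 0" using xa w by simp
        have i: "real i \<le> (x - a) / w" "(x - a) / w < real i + 1" using nn by (auto simp: i_def)
        have "(x - a) / w < real q" using False xa w wq by (simp add: field_simps)
        then have "i < q" using i by linarith
        moreover have "x \<in> J i" using i w by (auto simp: J_def field_simps)
        ultimately show ?thesis using x by auto
      qed
    qed
    have finE: "emeasure lborel E < \<infinity>"
      using emeasure_mono[OF E(2), of lborel] by (auto simp: emeasure_lborel_Icc_eq less_top[symmetric] top_unique)
    have gE: "\<gamma> \<le> measure lborel E"
      using E(3) finE pos by (simp add: measure_def enn2real_leI le_ennreal_iff flip: ennreal_le_iff)
    have fm: "E \<inter> J i \<in> fmeasurable lborel" for i
      using finE E(1) by (intro fmeasurable.Int fmeasurableI) (auto simp: J_def emeasure_lborel_Icc_eq intro: fmeasurableI)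
    have "measure lborel E \<le> measure lborel (\<Union>i<q. E \<inter> J i)"
      using cover fm E by (intro measure_mono_fmeasurable fmeasurable.finite_UN) auto
    also have "\<dots> \<le> (\<Sum>i<q. measure lborel (E \<inter> J i))"
      by (intro measure_UNION_le fmeasurableD fm) simp
    finally have sumge: "\<gamma> \<le> (\<Sum>i<q. measure lborel (E \<inter> J i))" using gE by simp
    \<comment> \<open>Pigeonhole: the subintervals cover \<open>E\<close>, so one of them contains
      at least the average share.\<close>
    have "\<exists>i<q. measure lborel (E \<inter> J i) \<ge> \<gamma> / real q"
    proof (rule ccontr)
      assume "\<not> ?thesis"
      then have "(\<Sum>i<q. measure lborel (E \<inter> J i)) < (\<Sum>i<q. \<gamma> / real q)"
        by (intro sum_strict_mono) (auto simp: q_def not_le)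
      then show False using sumge by (simp add: q_def)
    qed
    then obtain i where i: "i < q" "measure lborel (E \<inter> J i) \<ge> \<gamma> / real q" by blast
    define x0 where "x0 = a + real i * w"
    have iw: "real i * w + w \<le> l"
    proof -
      have "(real i + 1) * w \<le> real q * w" using i w by (intro mult_right_mono) auto
      then show ?thesis using wq by (simp add: algebra_simps)
    qed
    have J: "J i = {x0..x0+w}" "J i \<subseteq> {a..a+l}" "x0 \<in> {a..a+l}"
      using iw w by (auto simp: J_def x0_def)
    have "real (2 ^ N) * s < \<gamma> / real q" 
    proof -
      have "real (2 ^ N) * s = \<gamma> / real q / 2" by (simp add: s_def)
      also have "\<dots> < \<gamma> / real q"
      proof -
        have half: "y / 2 < y" if "y > 0" for y :: real using that by simp
        show ?thesis using pos by (intro half) (simp add: q_def)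
      qed
      finally show ?thesis .
    qed
    then have "real (2 ^ N) * s < measure lborel (E \<inter> J i)" using i by simp
    moreover have "E \<inter> J i \<in> sets lborel" by (rule fmeasurableD[OF fm])
    moreover have "E \<inter> J i \<subseteq> {x0..x0+w}" using J(1) by auto
    ultimately obtain p where p: "\<And>j. j < 2 ^ N \<Longrightarrow> p j \<in> E \<inter> J i"
        "\<And>j. Suc j < 2 ^ N \<Longrightarrow> p j + s \<le> p (Suc j)"
      using exists_separated_points[OF _ _ s, of "E \<inter> J i" x0 "x0 + w" "2 ^ N"] by blast
    have x0small: "\<bar>h n x0\<bar> \<le> S * (\<Prod>k<n. \<rho> k) * exp (real n - real N)" if n: "n \<le> N" for n
    proof -
      have 2: "(2::nat) ^ n \<le> 2 ^ N" using n by (intro power_increasing) auto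
      have "\<exists>\<xi>\<in>{x0..x0+w}. \<bar>h n \<xi>\<bar> \<le> (2 / s) ^ n * \<epsilon>"
        using der s p 2 small J(1) by (intro iterated_mvt[where p = p]) (auto dest: less_le_trans[OF _ 2])
      then obtain \<xi> where \<xi>: "\<xi> \<in> {x0..x0+w}" "\<bar>h n \<xi>\<bar> \<le> (2 / s) ^ n * \<epsilon>" by blast
      have "\<bar>h n \<xi> - h n x0\<bar> \<le> w * \<Lambda>"
      proof (cases "\<xi> = x0")
        case True then show ?thesis using w \<Lambda> by simp
      next
        case False
        then have "x0 < \<xi>" using \<xi> by auto
        from MVT2[OF this, of "h n" "h (Suc n)"] der obtain z where
          z: "x0 < z" "z < \<xi>" "h n \<xi> - h n x0 = (\<xi> - x0) * h (Suc n) z" by blast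
        have "z \<in> {a..a+l}" using z \<xi> J by auto
        then have "\<bar>h (Suc n) z\<bar> \<le> S * P (Suc n)" using bound unfolding P_def by blast
        then have "\<bar>h (Suc n) z\<bar> \<le> \<Lambda>" using \<Lambda>le[OF n] by linarith
        then show ?thesis using z \<xi> w by (auto simp: abs_mult intro!: mult_mono)
      qed
      then have "\<bar>h n x0\<bar> \<le> \<tau>" using \<xi>(2) \<epsilon>le[OF n] w\<Lambda> by linarith
      then show ?thesis using \<tau>le[OF n] by (simp add: T_def P_def)
    qed
    show "\<forall>x\<in>{a..a+l}. \<bar>h 0 x\<bar> \<le> \<delta>"
    proof
      fix x assume x: "x \<in> {a..a+l}"
      have "\<bar>x - x0\<bar> \<le> (\<Sum>k=m..<N. 1 / (exp 1 * \<rho> k))"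
        using x J(3) lN by (auto simp: r_def)
      then have "\<bar>h 0 x\<bar> \<le> S * (\<Prod>k<0. \<rho> k) * exp (real 0 - real m)"
        using bang_iterate[of h a "a + l" S \<rho> x m N x0 0] der bound \<rho> pos x mN J(3) x0small by auto
      then show "\<bar>h 0 x\<bar> \<le> \<delta>" using m by simp
    qed
  qed
qed

section \<open>Propagation of smallness on cubes\<close>

interpretation lebesgue_product: product_sigma_finite "\<lambda>_::nat. lborel :: real measure"
  by standard

lemma cube_in_sets [measurable]: "cube d a l \<in> sets (leb d)"
  unfolding cube_def by (intro sets_PiM_I_finite) auto

lemma emeasure_cube:
  assumes "l \<ge> 0"
  shows "emeasure (leb d) (cube d a l) = ennreal (l ^ d)"
proof -
  have "emeasure (leb d) (cube d a l) = (\<Prod>i<d. emeasure lborel {a i..a i + l})"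
    unfolding cube_def by (intro lebesgue_product.emeasure_PiM) auto
  also have "\<dots> = ennreal (l ^ d)" using assms by (simp add: ennreal_power)
  finally show ?thesis .
qed

lemma fun_upd_in_cube:
  "y \<in> cube d a l \<Longrightarrow> t \<in> {a d..a d + l} \<Longrightarrow> y(d := t) \<in> cube (Suc d) a l"
  by (auto simp: cube_def PiE_iff extensional_def less_Suc_eq)

lemma restrict_in_cube:
  assumes "x \<in> cube (Suc d) a l"
  obtains y t where "x = y(d := t)" "y \<in> cube d a l" "t \<in> {a d..a d + l}"
proof
  show "x = (x(d := undefined))(d := x d)" by simp
  show "x(d := undefined) \<in> cube d a l" "x d \<in> {a d..a d + l}"
    using assms by (auto simp: cube_def PiE_iff extensional_def)
qed

lemma fun_upd_in_cubeD:
  assumes "y \<in> space (leb d)" "y(d := t) \<in> cube (Suc d) a l"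
  shows "y \<in> cube d a l \<and> t \<in> {a d..a d + l}"
proof -
  have *: "(y(d := t)) i \<in> {a i..a i + l}" if "i < Suc d" for i
    using assms(2) that by (auto simp: cube_def PiE_iff)
  have "y i \<in> {a i..a i + l}" if "i < d" for i using *[of i] that by simp
  then show ?thesis using *[of d] assms(1) by (simp add: cube_def PiE_iff space_PiM)
qed

lemma cube_subset_space: "cube d a l \<subseteq> space (leb d)"
  by (auto simp: cube_def space_PiM)

lemma slice_measurable:
  assumes "E \<in> sets (leb (Suc d))" "y \<in> space (leb d)"
  shows "{t. y(d := t) \<in> E} \<in> sets lborel"
proof -
  have "(\<lambda>t. y(d := t)) \<in> measurable lborel (PiM (insert d {..<d}) (\<lambda>_. lborel))"
    using assms by (intro measurable_component_update) auto
  from measurable_sets[OF this, of E] assms show ?thesis by (simp add: vimage_def lessThan_Suc)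
qed

lemma measurable_add_coordinate [measurable]:
  "(\<lambda>(y, t). y(d := t)) \<in> measurable (leb d \<Otimes>\<^sub>M lborel) (leb (Suc d))"
  unfolding lessThan_Suc by (rule measurable_add_dim)

lemma nn_integral_leb_Suc:
  assumes "f \<in> borel_measurable (leb (Suc d))"
  shows "(\<integral>\<^sup>+x. f x \<partial>leb (Suc d)) = (\<integral>\<^sup>+y. (\<integral>\<^sup>+t. f (y(d := t)) \<partial>lborel) \<partial>leb d)"
  using assms unfolding lessThan_Suc by (intro lebesgue_product.product_nn_integral_insert) auto

lemma slice_emeasure_measurable [measurable]:
  assumes [measurable]: "E \<in> sets (leb (Suc d))"
  shows "(\<lambda>y. emeasure lborel {t. y(d := t) \<in> E}) \<in> borel_measurable (leb d)"
proof -
  have "(\<lambda>y. \<integral>\<^sup>+t. indicator E (y(d := t)) \<partial>lborel) \<in> borel_measurable (leb d)"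
    by (intro lborel.borel_measurable_nn_integral) measurable
  also have "?this \<longleftrightarrow> ?thesis"
  proof (intro measurable_cong)
    fix y assume y: "y \<in> space (leb d)"
    have "(\<integral>\<^sup>+t. indicator E (y(d := t)) \<partial>lborel) = (\<integral>\<^sup>+t. indicator {t. y(d := t) \<in> E} t \<partial>lborel)"
      by (auto intro!: nn_integral_cong simp: indicator_def)
    also have "\<dots> = emeasure lborel {t. y(d := t) \<in> E}"
      using slice_measurable[OF assms y] by simp
    finally show "(\<integral>\<^sup>+t. indicator E (y(d := t)) \<partial>lborel) = emeasure lborel {t. y(d := t) \<in> E}" .
  qed
  finally show ?thesis .
qed

lemma emeasure_leb_Suc:
  assumes [measurable]: "E \<in> sets (leb (Suc d))"
  shows "emeasure (leb (Suc d)) E = (\<integral>\<^sup>+y. emeasure lborel {t. y(d := t) \<in> E} \<partial>leb d)"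
proof -
  have "emeasure (leb (Suc d)) E = (\<integral>\<^sup>+x. indicator E x \<partial>leb (Suc d))" using assms by simp
  also have "\<dots> = (\<integral>\<^sup>+y. (\<integral>\<^sup>+t. indicator E (y(d := t)) \<partial>lborel) \<partial>leb d)"
    by (intro nn_integral_leb_Suc) simp
  also have "\<dots> = (\<integral>\<^sup>+y. emeasure lborel {t. y(d := t) \<in> E} \<partial>leb d)"
  proof (intro nn_integral_cong)
    fix y assume y: "y \<in> space (leb d)"
    have "(\<integral>\<^sup>+t. indicator E (y(d := t)) \<partial>lborel) = (\<integral>\<^sup>+t. indicator {t. y(d := t) \<in> E} t \<partial>lborel)"
      by (auto intro!: nn_integral_cong simp: indicator_def)
    also have "\<dots> = emeasure lborel {t. y(d := t) \<in> E}"
      using slice_measurable[OF assms y] by simp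
    finally show "(\<integral>\<^sup>+t. indicator E (y(d := t)) \<partial>lborel) = emeasure lborel {t. y(d := t) \<in> E}" .
  qed
  finally show ?thesis .
qed

text \<open>Fubini: the slices below the threshold contribute at most
  \<open>\<gamma> / (2 * l ^ d) * l ^ d\<close>, one half of \<open>\<gamma>\<close>, and every
  other slice has length at most \<open>l\<close>, so the latter must occupy measure at least
  \<open>\<gamma> / (2 * l)\<close>.\<close>

lemma emeasure_many_big_slices:
  assumes E: "E \<in> sets (leb (Suc d))" "E \<subseteq> cube (Suc d) a l" "ennreal \<gamma> \<le> emeasure (leb (Suc d)) E"
    and pos: "\<gamma> > 0" "l > 0"
  shows "ennreal (\<gamma> / (2 * l)) \<le> emeasure (leb d)
    {y \<in> cube d a l. ennreal (\<gamma> / (2 * l ^ d)) \<le> emeasure lborel {t. y(d := t) \<in> E}}"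
    (is "_ \<le> emeasure _ ?G")
proof -
  note [measurable] = E(1)
  have G [measurable]: "?G \<in> sets (leb d)"
  proof -
    have "?G = cube d a l \<inter> {y \<in> space (leb d). ennreal (\<gamma> / (2 * l ^ d)) \<le> emeasure lborel {t. y(d := t) \<in> E}}"
      using cube_subset_space by auto
    also have "\<dots> \<in> sets (leb d)" by measurable
    finally show ?thesis .
  qed
  have "ennreal \<gamma> \<le> (\<integral>\<^sup>+y. emeasure lborel {t. y(d := t) \<in> E} \<partial>leb d)"
    using E by (simp add: emeasure_leb_Suc)
  also have "\<dots> \<le> (\<integral>\<^sup>+y. ennreal (\<gamma> / (2 * l ^ d)) * indicator (cube d a l) y + ennreal l * indicator ?G y \<partial>leb d)"
  proof (intro nn_integral_mono)
    fix y assume y: "y \<in> space (leb d)"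
    show "emeasure lborel {t. y(d := t) \<in> E}
      \<le> ennreal (\<gamma> / (2 * l ^ d)) * indicator (cube d a l) y + ennreal l * indicator ?G y"
    proof (cases "y \<in> cube d a l")
      case False
      then have "{t. y(d := t) \<in> E} = {}" using E(2) fun_upd_in_cubeD[OF y] by blast
      then show ?thesis by simp
    next
      case True
      have "{t. y(d := t) \<in> E} \<subseteq> {a d..a d + l}" using E(2) fun_upd_in_cubeD[OF y] by blast
      from emeasure_mono[OF this, of lborel] have "emeasure lborel {t. y(d := t) \<in> E} \<le> ennreal l"
        using pos by simp
      then show ?thesis using True
        by (cases "y \<in> ?G") (simp_all add: not_le less_imp_le add_increasing)
    qed
  qed
  also have "\<dots> = ennreal (\<gamma> / (2 * l ^ d)) * ennreal (l ^ d) + ennreal l * emeasure (leb d) ?G"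
    using pos by (simp add: nn_integral_add nn_integral_cmult emeasure_cube)
  also have "ennreal (\<gamma> / (2 * l ^ d)) * ennreal (l ^ d) = ennreal (\<gamma> / 2)"
    using pos by (simp add: ennreal_mult[symmetric])
  finally have *: "ennreal \<gamma> \<le> ennreal (\<gamma> / 2) + ennreal l * emeasure (leb d) ?G" .
  show ?thesis
  proof (cases "emeasure (leb d) ?G")
    case (real r)
    then have "ennreal \<gamma> \<le> ennreal (\<gamma> / 2 + l * r)"
      using * pos by (simp add: ennreal_mult[symmetric])
    then have "\<gamma> \<le> \<gamma> / 2 + l * r" using pos real(1) by (subst (asm) ennreal_le_iff) auto
    then have "\<gamma> / (2 * l) \<le> r" using pos by (simp add: field_simps)
    then show ?thesis using real by (simp add: ennreal_leI)
  qed simp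
qed

text \<open>Induction on the dimension in two passes. Along the last coordinate, smallness spreads
  over the whole of each slice that meets \<open>E\<close> substantially. For every fixed last
  coordinate, the base points of these slices then form a set of measure at least
  \<open>\<gamma> / (2 * l)\<close>, to which the induction hypothesis applies. Only derivatives
  along coordinate lines occur, so \<open>D i n\<close> stands for the \<open>n\<close>-th
  derivative in direction \<open>i\<close>. The constants are chosen backwards:
  \<open>\<delta>1\<close> is what the second pass requires and the first has to deliver.\<close>

lemma propagation_cube:
  fixes \<rho> :: "nat \<Rightarrow> real"
  assumes \<rho>: "\<And>k. 0 < \<rho> k" "mono \<rho>" "\<not> summable (\<lambda>k. 1 / \<rho> k)"
    and pos: "S > 0" "l > 0" and "\<gamma> > 0" "\<delta> > 0"
  shows "\<exists>\<epsilon>>0. \<forall>a E D v. (\<forall>i<d. D i 0 = v) \<longrightarrow>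
    (\<forall>i<d. \<forall>n. \<forall>x\<in>extensional {..<d}. \<forall>t. DERIV (\<lambda>t. D i n (x(i := t))) t :> D i (Suc n) (x(i := t))) \<longrightarrow>
    (\<forall>i<d. \<forall>n. \<forall>x\<in>cube d a l. \<bar>D i n x\<bar> \<le> S * (\<Prod>k<n. \<rho> k)) \<longrightarrow>
    E \<in> sets (leb d) \<longrightarrow> E \<subseteq> cube d a l \<longrightarrow> ennreal \<gamma> \<le> emeasure (leb d) E \<longrightarrow>
    (\<forall>x\<in>E. \<bar>v x\<bar> \<le> \<epsilon>) \<longrightarrow> (\<forall>x\<in>cube d a l. \<bar>v x\<bar> \<le> (\<delta>::real))"
  using assms(6,7)
proof (induction d arbitrary: \<gamma> \<delta>)
  case 0
  show ?case
  proof (intro exI[of _ \<delta>] conjI 0 allI impI ballI)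
    fix a E and v :: "(nat \<Rightarrow> real) \<Rightarrow> real" and x
    assume *: "E \<subseteq> cube 0 a l" "ennreal \<gamma> \<le> emeasure (leb 0) E" "\<forall>x\<in>E. \<bar>v x\<bar> \<le> \<delta>" "x \<in> cube 0 a l"
    \<comment> \<open>In dimension \<open>0\<close> the cube is a single point, and positive measure
      makes \<open>E\<close> equal to it.\<close>
    have "E \<noteq> {}" using *(2) 0 by auto
    then have "x \<in> E" using *(1,4) by (auto simp: cube_def)
    then show "\<bar>v x\<bar> \<le> \<delta>" using *(3) by auto
  qed
next
  case (Suc d)
  have "\<gamma> / (2 * l) > 0" using Suc.prems pos by simp
  from Suc.IH[OF this Suc.prems(2)] obtain \<delta>1 where
    \<delta>1: "\<delta>1 > 0 \<and> (\<forall>a E D v. (\<forall>i<d. D i 0 = v) \<longrightarrow>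
    (\<forall>i<d. \<forall>n. \<forall>x\<in>extensional {..<d}. \<forall>t. DERIV (\<lambda>t. D i n (x(i := t))) t :> D i (Suc n) (x(i := t))) \<longrightarrow>
    (\<forall>i<d. \<forall>n. \<forall>x\<in>cube d a l. \<bar>D i n x\<bar> \<le> S * (\<Prod>k<n. \<rho> k)) \<longrightarrow>
    E \<in> sets (leb d) \<longrightarrow> E \<subseteq> cube d a l \<longrightarrow> ennreal (\<gamma> / (2 * l)) \<le> emeasure (leb d) E \<longrightarrow>
    (\<forall>x\<in>E. \<bar>v x\<bar> \<le> \<delta>1) \<longrightarrow> (\<forall>x\<in>cube d a l. \<bar>v x\<bar> \<le> \<delta>))"
    by (rule exE)
  note IH = conjunct2[OF \<delta>1]
  have "\<gamma> / (2 * l ^ d) > 0" using Suc.prems pos by simp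
  from propagation_1d[OF \<rho> pos this conjunct1[OF \<delta>1]] obtain \<epsilon> where
    \<epsilon>1: "\<epsilon> > 0 \<and> (\<forall>h a E. (\<forall>n x. DERIV (h n) x :> h (Suc n) x) \<longrightarrow>
    (\<forall>n. \<forall>x\<in>{a..a+l}. \<bar>h n x\<bar> \<le> S * (\<Prod>k<n. \<rho> k)) \<longrightarrow>
    E \<in> sets lborel \<longrightarrow> E \<subseteq> {a..a+l} \<longrightarrow> ennreal (\<gamma> / (2 * l ^ d)) \<le> emeasure lborel E \<longrightarrow>
    (\<forall>x\<in>E. \<bar>h 0 x\<bar> \<le> \<epsilon>) \<longrightarrow> (\<forall>x\<in>{a..a+l}. \<bar>h 0 x\<bar> \<le> \<delta>1))"
    by (rule exE)
  note \<epsilon> = conjunct1[OF \<epsilon>1] and one = conjunct2[OF \<epsilon>1]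
  show ?case
  proof (intro exI[of _ \<epsilon>] conjI \<epsilon> allI impI ballI)
    fix a E and D :: "nat \<Rightarrow> nat \<Rightarrow> (nat \<Rightarrow> real) \<Rightarrow> real" and v x
    assume v: "\<forall>i<Suc d. D i 0 = v"
      and der: "\<forall>i<Suc d. \<forall>n. \<forall>x\<in>extensional {..<Suc d}. \<forall>t.
        DERIV (\<lambda>t. D i n (x(i := t))) t :> D i (Suc n) (x(i := t))"
      and bound: "\<forall>i<Suc d. \<forall>n. \<forall>x\<in>cube (Suc d) a l. \<bar>D i n x\<bar> \<le> S * (\<Prod>k<n. \<rho> k)"
      and E: "E \<in> sets (leb (Suc d))" "E \<subseteq> cube (Suc d) a l" "ennreal \<gamma> \<le> emeasure (leb (Suc d)) E"
      and small: "\<forall>x\<in>E. \<bar>v x\<bar> \<le> \<epsilon>"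
      and x: "x \<in> cube (Suc d) a l"
    define G where "G = {y \<in> cube d a l. ennreal (\<gamma> / (2 * l ^ d)) \<le> emeasure lborel {t. y(d := t) \<in> E}}"
    note [measurable] = E(1)
    have G: "G \<in> sets (leb d)" "G \<subseteq> cube d a l"
    proof -
      have "G = cube d a l \<inter> {y \<in> space (leb d). ennreal (\<gamma> / (2 * l ^ d)) \<le> emeasure lborel {t. y(d := t) \<in> E}}"
        using cube_subset_space by (auto simp: G_def)
      also have "\<dots> \<in> sets (leb d)" by measurable
      finally show "G \<in> sets (leb d)" .
    qed (auto simp: G_def)
    have Gbig: "ennreal (\<gamma> / (2 * l)) \<le> emeasure (leb d) G"
      unfolding G_def using E Suc.prems pos by (intro emeasure_many_big_slices) auto
    have Gsmall: "\<bar>v (y(d := t))\<bar> \<le> \<delta>1" if y: "y \<in> G" and t: "t \<in> {a d..a d + l}" for y t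
    proof -
      have yc: "y \<in> cube d a l" and ys: "y \<in> space (leb d)"
        using y cube_subset_space by (auto simp: G_def)
      have ext: "y(d := s) \<in> extensional {..<Suc d}" for s
        using yc by (auto simp: cube_def PiE_iff extensional_def)
      have "\<bar>D d 0 (y(d := t))\<bar> \<le> \<delta>1"
      proof (rule one[THEN spec[of _ "\<lambda>n t. D d n (y(d := t))"], THEN spec[of _ "a d"], THEN spec[of _ "{t. y(d := t) \<in> E}"],
          THEN mp, THEN mp, THEN mp, THEN mp, THEN mp, THEN mp, THEN bspec[of _ _ t]])
        show "\<forall>n x. DERIV (\<lambda>t. D d n (y(d := t))) x :> D d (Suc n) (y(d := x))"
          using der ext[of 0] by (fastforce dest: spec[of _ d])
        show "{t. y(d := t) \<in> E} \<subseteq> {a d..a d + l}" using E(2) fun_upd_in_cubeD[OF ys] by blast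
        show "ennreal (\<gamma> / (2 * l ^ d)) \<le> emeasure lborel {t. y(d := t) \<in> E}" using y by (simp add: G_def)
      qed (use bound fun_upd_in_cube[OF yc] slice_measurable[OF E(1) ys] small v t in auto)
      then show ?thesis using v by simp
    qed
    obtain y t where xy: "x = y(d := t)" "y \<in> cube d a l" "t \<in> {a d..a d + l}"
      using restrict_in_cube[OF x] by blast
    have "\<bar>v (y(d := t))\<bar> \<le> \<delta>"
    proof (rule IH[THEN spec[of _ a], THEN spec[of _ G], THEN spec[of _ "\<lambda>i n y. D i n (y(d := t))"],
          THEN spec[of _ "\<lambda>y. v (y(d := t))"], THEN mp, THEN mp, THEN mp, THEN mp, THEN mp, THEN mp, THEN mp,
          THEN bspec, OF _ _ _ G Gbig _ xy(2)])
      show "\<forall>i<d. \<forall>n. \<forall>x\<in>extensional {..<d}. \<forall>s. DERIV (\<lambda>s. D i n (x(i := s, d := t))) s :> D i (Suc n) (x(i := s, d := t))"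
      proof (intro allI impI ballI)
        fix i n and z :: "nat \<Rightarrow> real" and s assume i: "i < d" and z: "z \<in> extensional {..<d}"
        have "z(d := t) \<in> extensional {..<Suc d}" using z by (auto simp: extensional_def)
        then have "DERIV (\<lambda>s. D i n (z(d := t, i := s))) s :> D i (Suc n) (z(d := t, i := s))"
          using der i by auto
        moreover have "z(d := t, i := r) = z(i := r, d := t)" for r using i by (auto simp: fun_eq_iff)
        ultimately show "DERIV (\<lambda>s. D i n (z(i := s, d := t))) s :> D i (Suc n) (z(i := s, d := t))" by simp
      qed
    qed (use v bound fun_upd_in_cube xy(3) Gsmall in auto)
    then show "\<bar>v x\<bar> \<le> \<delta>" using xy by simp
  qed
qed

section \<open>From the weight to a Denjoy--Carleman sequence\<close>

lemma geometric_tail_le: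
  fixes c :: real
  assumes "0 \<le> c" "c \<le> 1 / 2" "j \<le> J"
  shows "(\<Sum>i=j..<J. c ^ i) \<le> 2 * c ^ j"
proof -
  have "(\<Sum>i=j..<J. c ^ i) \<le> 2 * c ^ j - 2 * c ^ J"
    using assms(3)
  proof (induction J rule: dec_induct)
    case (step J)
    have "c ^ J * (2 * c) \<le> c ^ J * 1" using assms by (intro mult_left_mono) auto
    then have "2 * c ^ Suc J \<le> c ^ J" by (simp add: mult_ac)
    then show ?case using step(3) sum.atLeastLessThan_Suc[OF step(1), of "\<lambda>i. c ^ i"] by linarith
  qed simp
  also have "\<dots> \<le> 2 * c ^ j" using assms by simp
  finally show ?thesis .
qed

text \<open>Shifting the index bounds a partial sum \<open>s\<close> by \<open>a 0 + c * s\<close>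
  plus a sum over the increments, and \<open>c \<le> 1 / 2\<close> absorbs \<open>c * s\<close>. Its
  contrapositive passes from divergence for the values of \<open>ln W\<close> to divergence for its
  increments.\<close>

lemma weighted_sum_bounded:
  fixes a :: "nat \<Rightarrow> real" and c :: real
  assumes "0 \<le> c" "c \<le> 1 / 2" "\<And>j. 0 \<le> a j"
    and B: "\<And>J. (\<Sum>i<J. (a (Suc i) - a i) * c ^ i) \<le> B"
  shows "summable (\<lambda>j. a j * c ^ j)"
proof (rule summableI_nonneg_bounded)
  fix J
  define s where "s = (\<Sum>j<J. a j * c ^ j)"
  have s0: "s \<ge> 0" using assms by (auto simp: s_def intro!: sum_nonneg)
  have "s \<le> (\<Sum>j<Suc J. a j * c ^ j)" using assms by (simp add: s_def)
  also have "\<dots> = a 0 + (\<Sum>j<J. a (Suc j) * c ^ Suc j)" by (subst sum.lessThan_Suc_shift) simp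
  also have "(\<Sum>j<J. a (Suc j) * c ^ Suc j) = c * (s + (\<Sum>i<J. (a (Suc i) - a i) * c ^ i))"
    unfolding s_def sum.distrib[symmetric] sum_distrib_left by (intro sum.cong) (auto simp: algebra_simps)
  also have "\<dots> \<le> c * s + c * B"
    using assms(1) B[of J] by (simp add: distrib_left mult_left_mono)
  also have "c * s \<le> s / 2" using mult_right_mono[OF assms(2) s0] by simp
  finally show "(\<Sum>j<J. a j * c ^ j) \<le> 2 * (a 0 + c * B)" by (simp add: s_def)
qed (use assms in auto)

lemma ennreal_finite_weight:
  fixes W :: "real \<Rightarrow> ennreal"
  assumes "\<not> (\<exists>t\<ge>0. W t = \<infinity>)" "t \<ge> 0"
  shows "W t = ennreal (enn2real (W t))"
  using assms by (simp add: less_top)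

text \<open>Comparison on \<open>{exp j..exp (Suc j)}\<close>: there \<open>ln W\<close> is at most
  its value at the right end, and the length divided by \<open>1 + t\<^sup>2\<close> is of order
  \<open>exp (- j)\<close>. The exponential nodes match the logarithmic variable in which
  \<open>W\<close> is convex.\<close>

lemma divergent_weight_sum:
  fixes W :: "real \<Rightarrow> ennreal"
  assumes W0: "W 0 = 1" and mono: "mono_on {0..} W"
    and fin: "\<not> (\<exists>t\<ge>0. W t = \<infinity>)"
    and inf: "(\<integral>\<^sup>+t\<in>{0..}. e2ennreal (ext_ln (W t) / ereal (1 + t\<^sup>2)) \<partial>lborel) = \<infinity>"
  shows "\<not> summable (\<lambda>j. ln (enn2real (W (exp (real j)))) * exp (- 1) ^ j)"
proof
  define w where "w = (\<lambda>t. enn2real (W t))"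
  assume "summable (\<lambda>j. ln (enn2real (W (exp (real j)))) * exp (- 1) ^ j)"
  then have sum: "summable (\<lambda>j. ln (w (exp (real j))) * exp (- 1) ^ j)" by (simp add: w_def)
  have Ww: "W t = ennreal (w t)" if "t \<ge> 0" for t
    using ennreal_finite_weight[OF fin that] by (simp add: w_def)
  have wmono: "w s \<le> w t" if "0 \<le> s" "s \<le> t" for s t
    using mono that fin by (auto simp: w_def mono_on_def less_top intro!: enn2real_mono)
  have w1: "1 \<le> w t" if "0 \<le> t" for t
    using wmono[of 0 t] that W0 by (simp add: w_def)
  define a where "a = (\<lambda>j::nat. ln (w (exp (real j))))"
  have a0: "a j \<ge> 0" for j using w1 by (simp add: a_def)
  define b where "b = (\<lambda>j. a (Suc j) * exp (- 2 * real j))"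
  have b0: "b j \<ge> 0" for j using a0 by (simp add: b_def)
  define I where "I = (\<lambda>j::nat. {exp (real j)..exp (real (Suc j))})"
  \<comment> \<open>The interval \<open>{0..1}\<close> lies below all nodes and is estimated
    separately by the constant \<open>a 0 = ln (w 1)\<close>.\<close>
  have int: "e2ennreal (ext_ln (W t) / ereal (1 + t\<^sup>2)) * indicator {0..} t
    \<le> ennreal (a 0) * indicator {0..1} t + (\<Sum>j. ennreal (b j) * indicator (I j) t)" for t
  proof (cases "t \<ge> 0")
    case t: True
    have "1 + t\<^sup>2 > 0" by (simp add: add_pos_nonneg)
    then have eq: "e2ennreal (ext_ln (W t) / ereal (1 + t\<^sup>2)) = ennreal (ln (w t) / (1 + t\<^sup>2))"
      using Ww[OF t] w1[OF t] by (simp add: ext_ln_def e2ennreal_ereal)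
    show ?thesis
    proof (cases "t \<le> 1")
      case True
      have "ln (w t) / (1 + t\<^sup>2) \<le> ln (w t) / 1"
        using w1[OF t] by (intro divide_left_mono) (auto simp: add_pos_nonneg)
      also have "\<dots> \<le> a 0" using wmono[OF t True] w1[OF t] by (simp add: a_def)
      finally show ?thesis using t True by (auto simp: eq intro!: add_increasing2 ennreal_leI)
    next
      case False
      define j where "j = nat \<lfloor>ln t\<rfloor>"
      have lnt: "ln t \<ge> 0" using False by simp
      have j: "real j \<le> ln t" "ln t \<le> real (Suc j)" using lnt by (auto simp: j_def) linarith
      have e1: "exp (real j) \<le> t" using exp_le_cancel_iff[of "real j" "ln t"] j(1) False by simp
      have e2: "t \<le> exp (real (Suc j))" using exp_le_cancel_iff[of "ln t" "real (Suc j)"] j(2) False by (simp del: of_nat_Suc)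
      have tI: "t \<in> I j" using e1 e2 by (simp add: I_def)
      have "ln (w t) \<le> a (Suc j)" using wmono[OF t e2] w1[OF t] by (simp add: a_def)
      moreover have "1 / (1 + t\<^sup>2) \<le> exp (- 2 * real j)"
      proof -
        have "exp (2 * real j) = (exp (real j))\<^sup>2" by (simp add: exp_of_nat_mult[symmetric] power2_eq_square exp_add[symmetric])
        also have "\<dots> \<le> t\<^sup>2" using e1 by (intro power_mono) auto
        also have "\<dots> \<le> 1 + t\<^sup>2" by simp
        finally have "1 / (1 + t\<^sup>2) \<le> 1 / exp (2 * real j)" by (intro divide_left_mono) (auto simp: add_pos_nonneg)
        then show ?thesis by (simp add: exp_minus field_simps)
      qed
      ultimately have "ln (w t) * (1 / (1 + t\<^sup>2)) \<le> b j"
        unfolding b_def using a0 w1[OF t] by (intro mult_mono) auto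
      then have "ennreal (ln (w t) / (1 + t\<^sup>2)) \<le> ennreal (b j) * indicator (I j) t"
        using tI by (simp add: ennreal_leI)
      also have "\<dots> \<le> (\<Sum>j. ennreal (b j) * indicator (I j) t)"
      proof -
        define F :: "nat \<Rightarrow> ennreal" where "F = (\<lambda>j. ennreal (b j) * indicator (I j) t)"
        have "sum F {j} \<le> suminf F" by (intro sum_le_suminf) auto
        then show ?thesis by (simp add: F_def[symmetric] fun_cong[OF F_def, symmetric])
      qed
      finally show ?thesis using False t by (simp add: eq)
    qed
  qed simp
  have "(\<integral>\<^sup>+t\<in>{0..}. e2ennreal (ext_ln (W t) / ereal (1 + t\<^sup>2)) \<partial>lborel)
    \<le> (\<integral>\<^sup>+t. ennreal (a 0) * indicator {0..1} t + (\<Sum>j. ennreal (b j) * indicator (I j) t) \<partial>lborel)"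
    by (intro nn_integral_mono int)
  also have "\<dots> = (\<integral>\<^sup>+t. ennreal (a 0) * indicator {0..1::real} t \<partial>lborel) + (\<Sum>j. \<integral>\<^sup>+t. ennreal (b j) * indicator (I j) t \<partial>lborel)"
    by (subst nn_integral_add) (auto simp: I_def nn_integral_suminf)
  also have "\<dots> = ennreal (a 0) + (\<Sum>j. ennreal (b j * (exp (real (Suc j)) - exp (real j))))"
    using b0 by (simp add: nn_integral_cmult_indicator I_def ennreal_mult)
  also have "\<dots> < \<infinity>"
  proof -
    have le: "b j * (exp (real (Suc j)) - exp (real j)) \<le> exp 2 * (a (Suc j) * exp (-1) ^ Suc j)" for j
    proof -
      have "b j * (exp (real (Suc j)) - exp (real j)) \<le> b j * exp (real (Suc j))"
        using b0 by (intro mult_left_mono) auto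
      also have "\<dots> = exp 2 * (a (Suc j) * exp (-1) ^ Suc j)"
        by (simp add: b_def exp_of_nat_mult[symmetric] exp_add[symmetric] algebra_simps)
      finally show ?thesis .
    qed
    have nn: "0 \<le> b j * (exp (real (Suc j)) - exp (real j))" for j using b0 by (intro mult_nonneg_nonneg) auto
    have "summable (\<lambda>j. exp 2 * (a (Suc j) * exp (-1) ^ Suc j))"
      using sum summable_Suc_iff[of "\<lambda>j. a j * exp (-1) ^ j"] by (intro summable_mult) (simp add: a_def)
    then have "summable (\<lambda>j. b j * (exp (real (Suc j)) - exp (real j)))"
      by (rule summable_comparison_test'[where N = 0]) (use le nn in \<open>simp only: real_norm_def abs_of_nonneg\<close>)
    then have "(\<Sum>j. ennreal (b j * (exp (real (Suc j)) - exp (real j)))) < \<infinity>"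
      using suminf_ennreal2[OF nn] by simp
    then show ?thesis by (simp del: of_nat_Suc)
  qed
  finally show False using inf by simp
qed

text \<open>For finite \<open>W\<close>, \<open>j\<close> is the generalised inverse of the
  increasing sequence \<open>d\<close> of increments: about \<open>d i\<close> of the numbers
  \<open>k\<close> satisfy \<open>j k \<le> i\<close>. Counting the pairs \<open>(i, k)\<close> with
  \<open>j k \<le> i\<close> in two ways, with the weight \<open>c ^ i\<close>, turns divergence of
  \<open>(\<Sum>i. d i * c ^ i)\<close> into divergence of \<open>(\<Sum>k. c ^ j k)\<close>.
  Counting them without weight gives the bound for \<open>t ^ n\<close>, a discrete form of Young's
  inequality.\<close>

lemma weight_sequence:
  fixes W :: "real \<Rightarrow> ennreal"
  assumes W0: "W 0 = 1" and mono: "mono_on {0..} W"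
    and conv: "ext_convex_on {0..} (\<lambda>s. ext_ln (W (exp s)))"
    and inf: "(\<integral>\<^sup>+t\<in>{0..}. e2ennreal (ext_ln (W t) / ereal (1 + t\<^sup>2)) \<partial>lborel) = \<infinity>"
  obtains \<rho> :: "nat \<Rightarrow> real" where "\<And>k. 1 \<le> \<rho> k" "mono \<rho>" "\<not> summable (\<lambda>k. 1 / \<rho> k)"
    "\<And>n t. 0 \<le> t \<Longrightarrow> ennreal (t ^ n) \<le> W t * ennreal (\<Prod>k<n. \<rho> k)"
proof (cases "\<exists>t\<ge>0. W t = \<infinity>")
  case True
  then obtain t0 where t0: "t0 \<ge> 0" "W t0 = \<infinity>" by blast
  \<comment> \<open>Where the weight is infinite the transform has to vanish, so that its support is
    bounded and derivatives grow geometrically; a constant sequence describes this.\<close>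
  define r where "r = max 1 t0"
  have r: "r \<ge> 1" by (simp add: r_def)
  show ?thesis
  proof (rule that[of "\<lambda>_. r"])
    show "\<not> summable (\<lambda>k::nat. 1 / r)" using r by (simp only: summable_const_iff) simp
    fix n and t :: real assume t: "0 \<le> t"
    show "ennreal (t ^ n) \<le> W t * ennreal (\<Prod>k<n. r)"
    proof (cases "t \<le> t0")
      case False
      then have "W t0 \<le> W t" using t0(1) t by (intro mono_onD[OF mono]) auto
      then have "W t = \<top>" using t0 by (simp add: top_unique)
      then show ?thesis using r by (simp add: ennreal_top_mult)
    next
      case True
      have "W 0 \<le> W t" using t mono by (auto simp: mono_on_def)
      then have "1 * ennreal (r ^ n) \<le> W t * ennreal (r ^ n)" using W0 by (intro mult_right_mono) auto
      moreover have "t ^ n \<le> r ^ n" using t True by (intro power_mono) (auto simp: r_def)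
      ultimately show ?thesis by (simp add: order.trans[OF ennreal_leI])
    qed
  qed (use r in \<open>auto simp: mono_def\<close>)
next
  case fin: False
  define w where "w = (\<lambda>t. enn2real (W t))"
  have Ww: "W t = ennreal (w t)" if "t \<ge> 0" for t
    using ennreal_finite_weight[OF fin that] by (simp add: w_def)
  have wmono: "w s \<le> w t" if "0 \<le> s" "s \<le> t" for s t
    using mono that fin by (auto simp: w_def mono_on_def less_top intro!: enn2real_mono)
  have w1: "1 \<le> w t" if "0 \<le> t" for t
    using wmono[of 0 t] that W0 by (simp add: w_def)
  define a where "a = (\<lambda>j::nat. ln (w (exp (real j))))"
  define d where "d = (\<lambda>j. a (Suc j) - a j)"
  define c where "c = exp (-1::real)"
  have c: "0 < c" "c \<le> 1 / 2"
    using exp_ge_add_one_self[of 1] by (auto simp: c_def exp_minus field_simps)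
  have a0: "a j \<ge> 0" for j using w1 by (simp add: a_def)
  have amono: "a j \<le> a (Suc j)" for j
    unfolding a_def using w1[of "exp (real j)"] w1[of "exp (real (Suc j))"]
    by (subst ln_le_cancel_iff) (auto intro!: wmono)
  have d0: "d j \<ge> 0" for j using amono by (simp add: d_def)
  \<comment> \<open>Convexity at the midpoint of three consecutive integers.\<close>
  have dmono1: "d j \<le> d (Suc j)" for j
  proof -
    let ?f = "\<lambda>s. ext_ln (W (exp s))"
    have cv: "?f (u *\<^sub>R x + v *\<^sub>R y) \<le> ereal u * ?f x + ereal v * ?f y"
      if "x \<ge> 0" "y \<ge> 0" "u \<ge> 0" "v \<ge> 0" "u + v = 1" for x y u v :: real
      using conv that unfolding ext_convex_on_def by blast
    have fa: "?f (real i) = ereal (a i)" for i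
      using Ww[of "exp (real i)"] w1[of "exp (real i)"] by (simp add: ext_ln_def a_def)
    have mid: "(1/2) *\<^sub>R real j + (1/2) *\<^sub>R real (j + 2) = real (Suc j)" by (simp add: field_simps)
    have "?f ((1/2) *\<^sub>R real j + (1/2) *\<^sub>R real (j + 2)) \<le> ereal (1/2) * ?f (real j) + ereal (1/2) * ?f (real (j + 2))"
      by (rule cv) auto
    then have "ereal (a (Suc j)) \<le> ereal (1/2) * ereal (a j) + ereal (1/2) * ereal (a (j + 2))"
      unfolding mid fa .
    then show ?thesis by (simp add: d_def)
  qed
  then have dmono: "mono d" by (rule mono_iff_le_Suc[THEN iffD2, rule_format])
  have not_bdd: "\<not> (\<forall>J. (\<Sum>i<J. d i * c ^ i) \<le> B)" for B
    using weighted_sum_bounded[of c a B] c a0 divergent_weight_sum[OF W0 mono fin inf]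
    by (auto simp: d_def a_def w_def c_def)
  \<comment> \<open>Bounded increments would bound the partial sums in \<open>not_bdd\<close>. This
    makes the \<open>LEAST\<close> in the definition of \<open>j\<close> meaningful for every
    \<open>k\<close>.\<close>
  have unbdd: "\<exists>j. d j \<ge> B" for B
  proof (rule ccontr)
    assume "\<not> ?thesis"
    then have B: "d j \<le> B" for j by (simp add: not_le less_imp_le)
    have "(\<Sum>i<J. d i * c ^ i) \<le> B * 2" for J
    proof -
      have "(\<Sum>i<J. d i * c ^ i) \<le> (\<Sum>i=0..<J. B * c ^ i)"
        using c B unfolding lessThan_atLeast0 by (intro sum_mono mult_right_mono) auto
      also have "\<dots> \<le> B * 2"
        unfolding sum_distrib_left[symmetric]
        using geometric_tail_le[of c 0 J] c B[of 0] d0[of 0] by (intro mult_left_mono) auto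
      finally show ?thesis .
    qed
    then show False using not_bdd by blast
  qed
  define j where "j = (\<lambda>k. LEAST i. real (Suc k) \<le> d i)"
  have j_le: "j k \<le> i \<longleftrightarrow> real (Suc k) \<le> d i" for k i
  proof
    assume "j k \<le> i"
    moreover have "real (Suc k) \<le> d (j k)" unfolding j_def using unbdd by (rule LeastI_ex)
    ultimately show "real (Suc k) \<le> d i" using dmono by (meson monoD order.trans)
  qed (auto simp: j_def intro: Least_le)
  \<comment> \<open>The successor in the exponent is for rounding: \<open>t\<close> between
    \<open>exp m\<close> and \<open>exp (Suc m)\<close> is going to be replaced by the upper
    end.\<close>
  define \<rho> where "\<rho> = (\<lambda>k. exp (real (Suc (j k))))"
  show ?thesis
  proof (rule that[of \<rho>])
    show "1 \<le> \<rho> k" for k by (simp add: \<rho>_def)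
    have "j k \<le> j k'" if "k \<le> k'" for k k'
    proof -
      have "real (Suc k') \<le> d (j k')" using j_le[of k' "j k'"] by simp
      then show ?thesis using that by (simp add: j_le)
    qed
    then show "mono \<rho>" by (auto simp: mono_def \<rho>_def)
    show "\<not> summable (\<lambda>k. 1 / \<rho> k)"
    proof
      assume "summable (\<lambda>k. 1 / \<rho> k)"
      then have "summable (\<lambda>k. exp 1 * (1 / \<rho> k))" by (rule summable_mult)
      moreover have "exp 1 * (1 / \<rho> k) = c ^ j k" for k
        by (simp add: \<rho>_def c_def exp_of_nat_mult[symmetric] exp_add exp_minus field_simps)
      ultimately have sum: "summable (\<lambda>k. c ^ j k)" by simp
      have "(\<Sum>i<J. d i * c ^ i) \<le> 2 + 2 * (\<Sum>k. c ^ j k)" for J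
      proof -
        define K where "K = nat \<lfloor>d J\<rfloor>"
        \<comment> \<open>The integer part of \<open>d i\<close> counts the \<open>k\<close> with
          \<open>j k \<le> i\<close>, and \<open>K\<close> is large enough to include all of them
          for \<open>i < J\<close>. The fractional parts add at most a geometric series, the
          constant \<open>2\<close> above.\<close>
        have di: "d i \<le> 1 + (\<Sum>k<K. if j k \<le> i then 1 else 0)" if i: "i < J" for i
        proof -
          have "d i \<le> d J" using dmono i by (simp add: monoD)
          then have "nat \<lfloor>d i\<rfloor> \<le> K" by (simp add: K_def floor_mono nat_mono)
          then have "{..<nat \<lfloor>d i\<rfloor>} \<subseteq> {k \<in> {..<K}. j k \<le> i}"
            by (auto simp: j_le) linarith
          then have "card {..<nat \<lfloor>d i\<rfloor>} \<le> card {k \<in> {..<K}. j k \<le> i}" by (intro card_mono) auto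
          also have "real (card {k \<in> {..<K}. j k \<le> i}) = (\<Sum>k<K. if j k \<le> i then 1 else 0)"
            by (simp add: sum.If_cases Int_def)
          finally show ?thesis using d0[of i] by simp linarith
        qed
        have "(\<Sum>i<J. d i * c ^ i) \<le> (\<Sum>i<J. (1 + (\<Sum>k<K. if j k \<le> i then 1 else 0)) * c ^ i)"
          using c di by (intro sum_mono mult_right_mono) auto
        also have "\<dots> = (\<Sum>i=0..<J. c ^ i) + (\<Sum>i<J. \<Sum>k<K. if j k \<le> i then c ^ i else 0)"
          by (simp add: distrib_right sum.distrib sum_distrib_right lessThan_atLeast0 if_distrib[of "\<lambda>x. x * _"] cong: if_cong)
        also have "(\<Sum>i<J. \<Sum>k<K. if j k \<le> i then c ^ i else 0) = (\<Sum>k<K. \<Sum>i<J. if j k \<le> i then c ^ i else 0)"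
          by (rule sum.swap)
        also have "\<dots> \<le> (\<Sum>k<K. 2 * c ^ j k)"
        proof (intro sum_mono)
          fix k
          have "(\<Sum>i<J. if j k \<le> i then c ^ i else 0) = (\<Sum>i\<in>{i\<in>{..<J}. j k \<le> i}. c ^ i)"
            by (rule sum.inter_filter[symmetric]) simp
          also have "{i\<in>{..<J}. j k \<le> i} = {j k..<J}" by auto
          also have "(\<Sum>i=j k..<J. c ^ i) \<le> 2 * c ^ j k"
            using geometric_tail_le[of c "j k" J] c by (cases "j k \<le> J") auto
          finally show "(\<Sum>i<J. if j k \<le> i then c ^ i else 0) \<le> 2 * c ^ j k" .
        qed
        also have "\<dots> \<le> 2 * (\<Sum>k. c ^ j k)"
          unfolding sum_distrib_left[symmetric] using sum c by (intro mult_left_mono sum_le_suminf) auto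
        also have "(\<Sum>i=0..<J. c ^ i) \<le> 2" using geometric_tail_le[of c 0 J] c by simp
        finally show ?thesis by simp
      qed
      then show False using not_bdd by blast
    qed
    fix n and t :: real assume t: "0 \<le> t"
    have P1: "1 \<le> (\<Prod>k<n. \<rho> k)" by (intro prod_ge_1) (simp add: \<rho>_def)
    have "t ^ n \<le> w t * (\<Prod>k<n. \<rho> k)"
    proof (cases "t \<le> 1")
      case True
      have "t ^ n \<le> 1 * 1" using t True by (simp add: power_le_one)
      also have "\<dots> \<le> w t * (\<Prod>k<n. \<rho> k)" using P1 w1[OF t] by (intro mult_mono) auto
      finally show ?thesis .
    next
      case False
      define m where "m = nat \<lfloor>ln t\<rfloor>"
      have lnt: "ln t \<ge> 0" using False by simp
      have m: "real m \<le> ln t" "ln t \<le> real (Suc m)" using lnt by (auto simp: m_def) linarith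
      have e1: "exp (real m) \<le> t" using exp_le_cancel_iff[of "real m" "ln t"] m(1) False by simp
      have e2: "t \<le> exp (real (Suc m))" using exp_le_cancel_iff[of "ln t" "real (Suc m)"] m(2) False by (simp del: of_nat_Suc)
      \<comment> \<open>On the left \<open>m - j k\<close> may be negative, on the right only the
        pairs with \<open>j k \<le> i < m\<close> are counted. Interchanged, the count is bounded by
        the sum of the increments, which telescopes to at most \<open>a m\<close>.\<close>
      have "(\<Sum>k<n. real m - real (j k)) \<le> (\<Sum>k<n. \<Sum>i<m. if j k \<le> i then 1 else 0)"
      proof (intro sum_mono)
        fix k
        have "{i\<in>{..<m}. j k \<le> i} = {j k..<m}" by auto
        then have "(\<Sum>i<m. if j k \<le> i then 1 else 0) = real (m - j k)"
          by (simp add: sum.inter_filter[symmetric])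
        then show "real m - real (j k) \<le> (\<Sum>i<m. if j k \<le> i then 1 else 0)" by simp
      qed
      also have "\<dots> = (\<Sum>i<m. \<Sum>k<n. if j k \<le> i then 1 else 0)" by (rule sum.swap)
      also have "\<dots> \<le> (\<Sum>i<m. d i)"
      proof (intro sum_mono)
        fix i
        have "{k\<in>{..<n}. j k \<le> i} \<subseteq> {..<nat \<lfloor>d i\<rfloor>}" by (auto simp: j_le) linarith
        then have "card {k\<in>{..<n}. j k \<le> i} \<le> nat \<lfloor>d i\<rfloor>" using card_mono[of "{..<nat \<lfloor>d i\<rfloor>}"] by fastforce
        then show "(\<Sum>k<n. if j k \<le> i then 1 else 0) \<le> d i"
          using d0[of i] by (simp add: sum.inter_filter[symmetric]) linarith
      qed
      also have "\<dots> \<le> a m" using a0[of 0] by (simp add: d_def sum_lessThan_telescope)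
      finally have key: "real n * real (Suc m) \<le> a m + (\<Sum>k<n. real (Suc (j k)))"
        by (simp add: sum_subtractf sum.distrib algebra_simps)
      have "t ^ n \<le> exp (real (Suc m)) ^ n" using t e2 by (intro power_mono) auto
      also have "\<dots> = exp (real n * real (Suc m))" by (simp add: exp_of_nat_mult)
      also have "\<dots> \<le> exp (a m + (\<Sum>k<n. real (Suc (j k))))" using key by simp
      also have "\<dots> = w (exp (real m)) * (\<Prod>k<n. \<rho> k)"
        using w1[of "exp (real m)"] by (simp add: exp_add exp_sum a_def \<rho>_def)
      also have "\<dots> \<le> w t * (\<Prod>k<n. \<rho> k)" using P1 wmono[OF _ e1] by (intro mult_right_mono) auto
      finally show ?thesis .
    qed
    then have "ennreal (t ^ n) \<le> ennreal (w t * (\<Prod>k<n. \<rho> k))" by (rule ennreal_leI)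
    also have "\<dots> = W t * ennreal (\<Prod>k<n. \<rho> k)" using Ww[OF t] w1[OF t] P1 by (simp add: ennreal_mult)
    finally show "ennreal (t ^ n) \<le> W t * ennreal (\<Prod>k<n. \<rho> k)" .
  qed
qed

section \<open>The Fourier transform\<close>

interpretation leb: sigma_finite_measure "leb d" for d
  by (intro lebesgue_product.sigma_finite) simp

interpretation leb_pair: pair_sigma_finite "leb d" "leb d" for d ..

lemma coordinate_measurable: "i < d \<Longrightarrow> (\<lambda>x. x i) \<in> borel_measurable (leb d)"
  using measurable_component_singleton[of i "{..<d}" "\<lambda>_. lborel"] by simp

lemma fst_coordinate_measurable [measurable]:
  "i < d \<Longrightarrow> (\<lambda>p. fst p i) \<in> borel_measurable (leb d \<Otimes>\<^sub>M N)"
  by (rule measurable_compose[OF measurable_fst coordinate_measurable])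

lemma snd_coordinate_measurable [measurable]:
  "i < d \<Longrightarrow> (\<lambda>p. snd p i) \<in> borel_measurable (N \<Otimes>\<^sub>M leb d)"
  by (rule measurable_compose[OF measurable_snd coordinate_measurable])

lemma cis_measurable [measurable]: "cis \<in> borel_measurable borel"
  by (intro borel_measurable_continuous_onI continuous_intros)

lemma cnj_measurable [measurable]: "cnj \<in> borel_measurable borel"
  by (intro borel_measurable_continuous_onI continuous_intros)

section \<open>Waves and the inversion integral\<close>

definition dot :: "nat \<Rightarrow> (nat \<Rightarrow> real) \<Rightarrow> (nat \<Rightarrow> real) \<Rightarrow> real" where
  "dot d \<xi> x = (\<Sum>i<d. \<xi> i * x i)"

definition wave :: "nat \<Rightarrow> (nat \<Rightarrow> real) \<Rightarrow> (nat \<Rightarrow> real) \<Rightarrow> complex" where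
  "wave d \<xi> x = cis (2 * pi * dot d \<xi> x)"

definition inverse_fourier_integral ::
    "nat \<Rightarrow> ((nat \<Rightarrow> real) \<Rightarrow> complex) \<Rightarrow> (nat \<Rightarrow> real) \<Rightarrow> complex" where
  "inverse_fourier_integral d g x = (\<integral>\<xi>. g \<xi> * wave d \<xi> x \<partial>leb d)"

lemma dot_commute: "dot d \<xi> x = dot d x \<xi>"
  by (simp add: dot_def mult.commute)

lemma wave_commute: "wave d \<xi> x = wave d x \<xi>"
  by (simp add: wave_def dot_commute)

lemma norm_wave [simp]: "norm (wave d \<xi> x) = 1"
  by (simp add: wave_def)

lemma dot_measurable [measurable (raw)]:
  assumes [measurable]: "\<And>i. i < d \<Longrightarrow> (\<lambda>p. f p i) \<in> borel_measurable M"
    "\<And>i. i < d \<Longrightarrow> (\<lambda>p. g p i) \<in> borel_measurable M"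
  shows "(\<lambda>p. dot d (f p) (g p)) \<in> borel_measurable M"
  unfolding dot_def by measurable

lemma wave_measurable [measurable (raw)]:
  assumes [measurable]: "\<And>i. i < d \<Longrightarrow> (\<lambda>p. f p i) \<in> borel_measurable M"
    "\<And>i. i < d \<Longrightarrow> (\<lambda>p. g p i) \<in> borel_measurable M"
  shows "(\<lambda>p. wave d (f p) (g p)) \<in> borel_measurable M"
  unfolding wave_def by measurable

text \<open>Conjugation reduces the forward transform to the inversion integral, so that one set of
  estimates serves both.\<close>

lemma fourier_integral_eq:
  "fourier_integral d f \<xi> = cnj (inverse_fourier_integral d (\<lambda>x. cnj (f x)) \<xi>)"
proof -
  have "exp (- 2 * complex_of_real pi * \<i> * complex_of_real (\<Sum>i<d. \<xi> i * t i)) = cnj (wave d t \<xi>)" for t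
    by (simp add: wave_def dot_commute[of d t] dot_def cis_cnj cis_conv_exp exp_cnj mult_ac)
  then have "fourier_integral d f \<xi> = (\<integral>t. cnj (cnj (f t) * wave d t \<xi>) \<partial>leb d)"
    unfolding fourier_integral_def by (simp only: complex_cnj_mult complex_cnj_cnj)
  also have "\<dots> = cnj (inverse_fourier_integral d (\<lambda>x. cnj (f x)) \<xi>)"
    unfolding inverse_fourier_integral_def by (rule Bochner_Integration.integral_cnj)
  finally show ?thesis .
qed

lemma integrable_mult_wave:
  assumes "integrable (leb d) g"
  shows "integrable (leb d) (\<lambda>\<xi>. g \<xi> * wave d \<xi> x)"
  using assms by (rule Bochner_Integration.integrable_bound) (use assms in \<open>auto simp: norm_mult\<close>)

lemma inverse_fourier_measurable [measurable]:
  assumes [measurable]: "g \<in> borel_measurable (leb d)"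
  shows "inverse_fourier_integral d g \<in> borel_measurable (leb d)"
  unfolding inverse_fourier_integral_def[abs_def]
  by (rule leb.borel_measurable_lebesgue_integral) measurable

lemma inverse_fourier_bound:
  assumes "integrable (leb d) g"
  shows "norm (inverse_fourier_integral d g x) \<le> (\<integral>\<xi>. norm (g \<xi>) \<partial>leb d)"
proof -
  have "norm (inverse_fourier_integral d g x) \<le> (\<integral>\<xi>. norm (g \<xi> * wave d \<xi> x) \<partial>leb d)"
    unfolding inverse_fourier_integral_def by (rule integral_norm_bound)
  then show ?thesis by (simp add: norm_mult)
qed

text \<open>The hypothesis of Fubini's theorem in the shape in which it recurs below: two integrable
  functions coupled by a bounded kernel.\<close>

lemma integrable_pair_mult:
  fixes f g :: "_ \<Rightarrow> complex"
  assumes f: "integrable (leb d) f" and g: "integrable (leb d) g"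
    and k [measurable]: "(\<lambda>p. k (fst p) (snd p)) \<in> borel_measurable (leb d \<Otimes>\<^sub>M leb d)"
    and B: "\<And>x y. norm (k x y) \<le> B"
  shows "integrable (leb d \<Otimes>\<^sub>M leb d) (\<lambda>(x, y). f x * g y * k x y)"
proof -
  have [measurable]: "f \<in> borel_measurable (leb d)" "g \<in> borel_measurable (leb d)" using f g by auto
  have "integrable (leb d \<Otimes>\<^sub>M leb d) (\<lambda>(x, y). f x * g y)"
  proof (rule leb_pair.Fubini_integrable)
    show "(\<lambda>(x, y). f x * g y) \<in> borel_measurable (leb d \<Otimes>\<^sub>M leb d)" by measurable
    show "AE x in leb d. integrable (leb d) (\<lambda>y. case (x, y) of (x, y) \<Rightarrow> f x * g y)" using g by simp
    show "integrable (leb d) (\<lambda>x. \<integral>y. norm (case (x, y) of (x, y) \<Rightarrow> f x * g y) \<partial>leb d)"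
      using f g by (simp add: norm_mult)
  qed
  then have "integrable (leb d \<Otimes>\<^sub>M leb d) (\<lambda>p. B *\<^sub>R (f (fst p) * g (snd p)))"
    by (intro integrable_scaleR_right) (simp add: split_beta')
  then show ?thesis
  proof (rule Bochner_Integration.integrable_bound)
    show "(\<lambda>(x, y). f x * g y * k x y) \<in> borel_measurable (leb d \<Otimes>\<^sub>M leb d)"
      unfolding split_beta' by measurable
    have "norm (f (fst p) * g (snd p) * k (fst p) (snd p)) \<le> norm (B *\<^sub>R (f (fst p) * g (snd p)))" for p
      using mult_left_mono[OF order.trans[OF B abs_ge_self], of "norm (f (fst p) * g (snd p))" "fst p" "snd p"]
      by (simp add: norm_mult mult_ac)
    then show "AE p in leb d \<Otimes>\<^sub>M leb d. norm (case p of (x, y) \<Rightarrow> f x * g y * k x y) \<le> norm (B *\<^sub>R (f (fst p) * g (snd p)))"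
      by (simp add: split_beta')
  qed
qed

section \<open>Gaussian regularisation\<close>

text \<open>A rescaling of the characteristic function of the standard normal distribution. The
  deviation \<open>\<epsilon> / (2 * pi)\<close> reflects the factor \<open>2 * pi\<close> in the
  exponent of the transform.\<close>

lemma gaussian_1d:
  assumes \<epsilon>: "\<epsilon> > 0"
  shows "integrable lborel (\<lambda>x::real. exp (- (\<epsilon> * x)\<^sup>2 / 2))"
    and "(\<integral>x. complex_of_real (exp (- (\<epsilon> * x)\<^sup>2 / 2)) * cis (2 * pi * (s * x)) \<partial>lborel)
      = complex_of_real (normal_density 0 (\<epsilon> / (2 * pi)) s)"
proof -
  have eq: "exp (- (\<epsilon> * x)\<^sup>2 / 2) = sqrt (2 * pi) * std_normal_density (0 + \<epsilon> * x)" for x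
    by (simp add: std_normal_density_def)
  show "integrable lborel (\<lambda>x::real. exp (- (\<epsilon> * x)\<^sup>2 / 2))"
    unfolding eq using \<epsilon> by (intro integrable_mult_right lborel_integrable_real_affine) auto
  define t where "t = 2 * pi * s / \<epsilon>"
  have "complex_of_real (exp (- t\<^sup>2 / 2)) = char std_normal_distribution t"
    by (simp add: char_std_normal_distribution)
  also have "\<dots> = (\<integral>x. std_normal_density x *\<^sub>R iexp (t * x) \<partial>lborel)"
    unfolding char_def by (subst integral_density) auto
  also have "\<dots> = \<epsilon> *\<^sub>R (\<integral>x. std_normal_density (0 + \<epsilon> * x) *\<^sub>R iexp (t * (0 + \<epsilon> * x)) \<partial>lborel)"
    using \<epsilon> by (subst lborel_integral_real_affine[where c = \<epsilon> and t = 0]) auto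
  also have "(\<integral>x. std_normal_density (0 + \<epsilon> * x) *\<^sub>R iexp (t * (0 + \<epsilon> * x)) \<partial>lborel) =
    (\<integral>x. complex_of_real (1 / sqrt (2 * pi)) * (complex_of_real (exp (- (\<epsilon> * x)\<^sup>2 / 2)) * cis (2 * pi * (s * x))) \<partial>lborel)"
    using \<epsilon> by (intro Bochner_Integration.integral_cong refl)
      (simp add: std_normal_density_def scaleR_conv_of_real cis_conv_exp t_def field_simps)
  also have "\<dots> = complex_of_real (1 / sqrt (2 * pi)) * (\<integral>x. complex_of_real (exp (- (\<epsilon> * x)\<^sup>2 / 2)) * cis (2 * pi * (s * x)) \<partial>lborel)"
    by simp
  finally have "(\<integral>x. complex_of_real (exp (- (\<epsilon> * x)\<^sup>2 / 2)) * cis (2 * pi * (s * x)) \<partial>lborel)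
    = complex_of_real (sqrt (2 * pi) / \<epsilon> * exp (- t\<^sup>2 / 2))"
    using \<epsilon> by (simp add: scaleR_conv_of_real field_simps)
  also have "sqrt (2 * pi) / \<epsilon> * exp (- t\<^sup>2 / 2) = normal_density 0 (\<epsilon> / (2 * pi)) s"
  proof -
    have "sqrt (2 * pi * (\<epsilon> / (2 * pi))\<^sup>2) = \<epsilon> / sqrt (2 * pi)"
    proof -
      have "2 * pi * (\<epsilon> / (2 * pi))\<^sup>2 = \<epsilon>\<^sup>2 / (2 * pi)" by (simp add: power2_eq_square)
      then show ?thesis using \<epsilon> by (simp add: real_sqrt_divide)
    qed
    moreover have "- (s - 0)\<^sup>2 / (2 * (\<epsilon> / (2 * pi))\<^sup>2) = - t\<^sup>2 / 2"
      using \<epsilon> by (simp add: t_def power2_eq_square field_simps)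
    ultimately show ?thesis unfolding normal_density_def by simp
  qed
  finally show "(\<integral>x. complex_of_real (exp (- (\<epsilon> * x)\<^sup>2 / 2)) * cis (2 * pi * (s * x)) \<partial>lborel)
      = complex_of_real (normal_density 0 (\<epsilon> / (2 * pi)) s)" .
qed

text \<open>A damping factor that makes bounded functions integrable and tends to \<open>1\<close>
  with \<open>\<epsilon> \<longlonglongrightarrow> 0\<close>. The Fourier transform of this factor
  is \<open>gauss_kernel\<close>, a probability density that concentrates at
  \<open>a\<close>.\<close>

definition gauss_weight :: "nat \<Rightarrow> real \<Rightarrow> (nat \<Rightarrow> real) \<Rightarrow> real" where
  "gauss_weight d \<epsilon> x = (\<Prod>i<d. exp (- (\<epsilon> * x i)\<^sup>2 / 2))"

definition gauss_kernel :: "nat \<Rightarrow> real \<Rightarrow> (nat \<Rightarrow> real) \<Rightarrow> (nat \<Rightarrow> real) \<Rightarrow> real" where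
  "gauss_kernel d \<epsilon> a x = (\<Prod>i<d. normal_density (a i) (\<epsilon> / (2 * pi)) (x i))"

lemma gauss_weight_bounds: "0 < gauss_weight d \<epsilon> x" "gauss_weight d \<epsilon> x \<le> 1"
  unfolding gauss_weight_def by (auto intro!: prod_pos prod_le_1)

lemma gauss_weight_nonneg [simp]: "0 \<le> gauss_weight d \<epsilon> x"
  by (simp add: gauss_weight_bounds(1) less_imp_le)

lemma gauss_weight_integrable: "\<epsilon> > 0 \<Longrightarrow> integrable (leb d) (gauss_weight d \<epsilon>)"
  unfolding gauss_weight_def[abs_def]
  by (rule lebesgue_product.product_integrable_prod) (simp, rule gaussian_1d(1))

lemma gauss_weight_measurable [measurable (raw)]:
  assumes [measurable]: "\<And>i. i < d \<Longrightarrow> (\<lambda>p. f p i) \<in> borel_measurable M"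
  shows "(\<lambda>p. gauss_weight d \<epsilon> (f p)) \<in> borel_measurable M"
  unfolding gauss_weight_def by measurable

lemma gauss_kernel_measurable [measurable (raw)]:
  assumes [measurable]: "\<And>i. i < d \<Longrightarrow> (\<lambda>p. f p i) \<in> borel_measurable M"
    "\<And>i. i < d \<Longrightarrow> (\<lambda>p. g p i) \<in> borel_measurable M"
  shows "(\<lambda>p. gauss_kernel d \<epsilon> (f p) (g p)) \<in> borel_measurable M"
  unfolding gauss_kernel_def normal_density_def by measurable

lemma gauss_kernel_nonneg [simp]: "0 \<le> gauss_kernel d \<epsilon> a x"
  unfolding gauss_kernel_def by (auto intro!: prod_nonneg)

lemma gauss_kernel_commute: "gauss_kernel d \<epsilon> a x = gauss_kernel d \<epsilon> x a"
  unfolding gauss_kernel_def normal_density_def by (simp add: power2_commute)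

lemma gauss_kernel_nn_integral:
  assumes "\<epsilon> > 0"
  shows "(\<integral>\<^sup>+x. ennreal (gauss_kernel d \<epsilon> a x) \<partial>leb d) = 1"
proof -
  have "(\<integral>\<^sup>+x. ennreal (gauss_kernel d \<epsilon> a x) \<partial>leb d)
    = (\<integral>\<^sup>+x. (\<Prod>i<d. ennreal (normal_density (a i) (\<epsilon> / (2 * pi)) (x i))) \<partial>leb d)"
    by (simp add: gauss_kernel_def prod_ennreal)
  also have "\<dots> = (\<Prod>i<d. \<integral>\<^sup>+y. ennreal (normal_density (a i) (\<epsilon> / (2 * pi)) y) \<partial>lborel)"
    by (intro lebesgue_product.product_nn_integral_prod) auto
  also have "\<dots> = (\<Prod>i<d. 1)"
  proof (intro prod.cong refl)
    fix i
    have "(\<integral>\<^sup>+y. ennreal (normal_density (a i) (\<epsilon> / (2 * pi)) y) \<partial>lborel)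
      = ennreal (\<integral>y. normal_density (a i) (\<epsilon> / (2 * pi)) y \<partial>lborel)"
      using assms by (intro nn_integral_eq_integral) auto
    then show "(\<integral>\<^sup>+y. ennreal (normal_density (a i) (\<epsilon> / (2 * pi)) y) \<partial>lborel) = 1" using assms by simp
  qed
  finally show ?thesis by simp
qed

lemma gauss_kernel_integrable: "\<epsilon> > 0 \<Longrightarrow> integrable (leb d) (gauss_kernel d \<epsilon> a)"
  using gauss_kernel_nn_integral[of \<epsilon> d a] gauss_kernel_nonneg
  by (intro integrableI_bounded) auto

lemma gauss_weight_fourier:
  assumes "\<epsilon> > 0"
  shows "(\<integral>x. complex_of_real (gauss_weight d \<epsilon> x) * (wave d \<xi> x * cnj (wave d \<eta> x)) \<partial>leb d)
    = complex_of_real (gauss_kernel d \<epsilon> \<eta> \<xi>)"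
proof -
  have w: "wave d \<xi> x * cnj (wave d \<eta> x) = (\<Prod>i<d. cis (2 * pi * ((\<xi> i - \<eta> i) * x i)))" for x
  proof -
    have "wave d \<xi> x * cnj (wave d \<eta> x) = cis (\<Sum>i<d. 2 * pi * ((\<xi> i - \<eta> i) * x i))"
      by (simp add: wave_def dot_def cis_cnj cis_mult sum_distrib_left sum_subtractf algebra_simps)
    also have "\<dots> = (\<Prod>i<d. cis (2 * pi * ((\<xi> i - \<eta> i) * x i)))"
      by (simp add: cis_conv_exp exp_sum sum_distrib_left)
    finally show ?thesis .
  qed
  have "(\<integral>x. complex_of_real (gauss_weight d \<epsilon> x) * (wave d \<xi> x * cnj (wave d \<eta> x)) \<partial>leb d)
    = (\<integral>x. (\<Prod>i<d. complex_of_real (exp (- (\<epsilon> * x i)\<^sup>2 / 2)) * cis (2 * pi * ((\<xi> i - \<eta> i) * x i))) \<partial>leb d)"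
    unfolding w gauss_weight_def by (simp add: prod.distrib del: of_real_exp)
  also have "\<dots> = (\<Prod>i<d. \<integral>x. complex_of_real (exp (- (\<epsilon> * x)\<^sup>2 / 2)) * cis (2 * pi * ((\<xi> i - \<eta> i) * x)) \<partial>lborel)"
  proof (rule lebesgue_product.product_integral_prod)
    fix i
    show "integrable lborel (\<lambda>x. complex_of_real (exp (- (\<epsilon> * x)\<^sup>2 / 2)) * cis (2 * pi * ((\<xi> i - \<eta> i) * x)))"
      by (rule Bochner_Integration.integrable_bound[OF gaussian_1d(1)[OF assms]]) (auto simp: norm_mult simp del: of_real_exp)
  qed simp
  also have "\<dots> = (\<Prod>i<d. complex_of_real (normal_density (\<eta> i) (\<epsilon> / (2 * pi)) (\<xi> i)))"
    by (simp only: gaussian_1d(2)[OF assms]) (simp add: normal_density_def)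
  finally show ?thesis by (simp add: gauss_kernel_def)
qed

text \<open>An approximate inversion formula that asks for no integrability of the transform of
  \<open>G\<close>: the damping makes Fubini's theorem applicable and reappears on the other side as
  smoothing of \<open>G\<close>.\<close>

lemma gauss_inversion:
  assumes \<epsilon>: "\<epsilon> > 0" and G: "integrable (leb d) G"
  shows "(\<integral>x. complex_of_real (gauss_weight d \<epsilon> x) * (inverse_fourier_integral d G x * cnj (wave d \<eta> x)) \<partial>leb d)
    = (\<integral>\<xi>. G \<xi> * complex_of_real (gauss_kernel d \<epsilon> \<eta> \<xi>) \<partial>leb d)"
proof -
  let ?w = "\<lambda>x. complex_of_real (gauss_weight d \<epsilon> x)"
  have "integrable (leb d \<Otimes>\<^sub>M leb d) (\<lambda>(x, \<xi>). ?w x * G \<xi> * (wave d \<xi> x * cnj (wave d \<eta> x)))"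
    using gauss_weight_integrable[OF \<epsilon>] G
    by (intro integrable_pair_mult[where B = 1]) (simp_all add: norm_mult)
  then have "(\<integral>\<xi>. \<integral>x. ?w x * G \<xi> * (wave d \<xi> x * cnj (wave d \<eta> x)) \<partial>leb d \<partial>leb d)
    = (\<integral>x. \<integral>\<xi>. ?w x * G \<xi> * (wave d \<xi> x * cnj (wave d \<eta> x)) \<partial>leb d \<partial>leb d)"
    by (rule leb_pair.Fubini_integral)
  also have "(\<lambda>\<xi>. \<integral>x. ?w x * G \<xi> * (wave d \<xi> x * cnj (wave d \<eta> x)) \<partial>leb d)
    = (\<lambda>\<xi>. G \<xi> * complex_of_real (gauss_kernel d \<epsilon> \<eta> \<xi>))"
  proof
    fix \<xi>
    have "(\<integral>x. ?w x * G \<xi> * (wave d \<xi> x * cnj (wave d \<eta> x)) \<partial>leb d)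
      = (\<integral>x. G \<xi> * (?w x * (wave d \<xi> x * cnj (wave d \<eta> x))) \<partial>leb d)" by (simp add: mult_ac)
    then show "(\<integral>x. ?w x * G \<xi> * (wave d \<xi> x * cnj (wave d \<eta> x)) \<partial>leb d) = G \<xi> * complex_of_real (gauss_kernel d \<epsilon> \<eta> \<xi>)"
      using gauss_weight_fourier[OF \<epsilon>, of d \<xi> \<eta>] by simp
  qed
  also have "(\<lambda>x. \<integral>\<xi>. ?w x * G \<xi> * (wave d \<xi> x * cnj (wave d \<eta> x)) \<partial>leb d)
    = (\<lambda>x. ?w x * (inverse_fourier_integral d G x * cnj (wave d \<eta> x)))"
  proof
    fix x
    have "(\<integral>\<xi>. ?w x * G \<xi> * (wave d \<xi> x * cnj (wave d \<eta> x)) \<partial>leb d)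
      = (\<integral>\<xi>. (?w x * cnj (wave d \<eta> x)) * (G \<xi> * wave d \<xi> x) \<partial>leb d)" by (simp add: mult_ac)
    also have "\<dots> = (?w x * cnj (wave d \<eta> x)) * inverse_fourier_integral d G x"
      unfolding inverse_fourier_integral_def by (rule integral_mult_right_zero)
    finally show "(\<integral>\<xi>. ?w x * G \<xi> * (wave d \<xi> x * cnj (wave d \<eta> x)) \<partial>leb d)
      = ?w x * (inverse_fourier_integral d G x * cnj (wave d \<eta> x))"
      by (simp add: mult_ac)
  qed
  finally show ?thesis ..
qed

text \<open>No integrability is assumed, because the Bochner integral of a non-integrable function
  is \<open>0\<close>.\<close>

lemma ennreal_norm_integral_le:
  fixes f :: "'a \<Rightarrow> 'b::{banach, second_countable_topology}"
  shows "ennreal (norm (integral\<^sup>L M f)) \<le> (\<integral>\<^sup>+x. ennreal (norm (f x)) \<partial>M)"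
  by (cases "integrable M f") (auto simp: integral_norm_bound_ennreal not_integrable_integral_eq)

section \<open>Bessel's inequality\<close>

text \<open>Writing the square as a product and using \<open>gauss_inversion\<close> turns the left
  side into a double integral of \<open>cnj (G \<eta>) * G \<xi>\<close> against the Gaussian
  kernel. The product is at most the mean of the two squares, and the kernel has mass
  \<open>1\<close> in each variable, as in Schur's test.\<close>

lemma bessel_weighted:
  assumes \<epsilon>: "\<epsilon> > 0" and G: "integrable (leb d) G"
  shows "(\<integral>\<^sup>+x. ennreal (gauss_weight d \<epsilon> x * (norm (inverse_fourier_integral d G x))\<^sup>2) \<partial>leb d)
    \<le> (\<integral>\<^sup>+\<xi>. ennreal ((norm (G \<xi>))\<^sup>2) \<partial>leb d)"
proof -
  define F where "F = inverse_fourier_integral d G"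
  have [measurable]: "G \<in> borel_measurable (leb d)" using G by simp
  have [measurable]: "F \<in> borel_measurable (leb d)" unfolding F_def by measurable
  define L where "L = (\<integral>\<xi>. norm (G \<xi>) \<partial>leb d)"
  have FL: "norm (F x) \<le> L" for x unfolding F_def L_def by (rule inverse_fourier_bound[OF G])
  let ?w = "\<lambda>x. complex_of_real (gauss_weight d \<epsilon> x)"
  let ?N = "gauss_kernel d \<epsilon>"
  have wF: "integrable (leb d) (\<lambda>x. ?w x * F x)"
  proof (rule Bochner_Integration.integrable_bound)
    show "integrable (leb d) (\<lambda>x. gauss_weight d \<epsilon> x * L)" using gauss_weight_integrable[OF \<epsilon>] by simp
    show "AE x in leb d. norm (?w x * F x) \<le> norm (gauss_weight d \<epsilon> x * L)"
      by (intro AE_I2) (simp add: norm_mult abs_mult mult_left_mono order.trans[OF FL abs_ge_self])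
  qed measurable
  have wFF: "integrable (leb d) (\<lambda>x. gauss_weight d \<epsilon> x * (norm (F x))\<^sup>2)"
  proof (rule Bochner_Integration.integrable_bound)
    show "integrable (leb d) (\<lambda>x. gauss_weight d \<epsilon> x * L\<^sup>2)" using gauss_weight_integrable[OF \<epsilon>] by simp
    show "AE x in leb d. norm (gauss_weight d \<epsilon> x * (norm (F x))\<^sup>2) \<le> norm (gauss_weight d \<epsilon> x * L\<^sup>2)"
      by (intro AE_I2) (simp add: abs_mult mult_left_mono power_mono FL)
  qed measurable
  have cG: "integrable (leb d) (\<lambda>x. cnj (G x))" using G by simp
  have pair: "integrable (leb d \<Otimes>\<^sub>M leb d) (\<lambda>(x, \<eta>). (?w x * F x) * cnj (G \<eta>) * cnj (wave d \<eta> x))"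
    by (rule integrable_pair_mult[OF wF cG, where B = 1 and k = "\<lambda>x \<eta>. cnj (wave d \<eta> x)"]) auto
  have "complex_of_real (\<integral>x. gauss_weight d \<epsilon> x * (norm (F x))\<^sup>2 \<partial>leb d)
    = (\<integral>x. complex_of_real (gauss_weight d \<epsilon> x * (norm (F x))\<^sup>2) \<partial>leb d)"
    by (rule integral_complex_of_real[symmetric])
  also have "\<dots> = (\<integral>x. \<integral>\<eta>. (?w x * F x) * cnj (G \<eta>) * cnj (wave d \<eta> x) \<partial>leb d \<partial>leb d)"
  proof (intro Bochner_Integration.integral_cong refl)
    fix x
    have "(\<integral>\<eta>. (?w x * F x) * cnj (G \<eta>) * cnj (wave d \<eta> x) \<partial>leb d)
      = (\<integral>\<eta>. (?w x * F x) * cnj (G \<eta> * wave d \<eta> x) \<partial>leb d)" by (simp add: mult_ac)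
    also have "\<dots> = (?w x * F x) * (\<integral>\<eta>. cnj (G \<eta> * wave d \<eta> x) \<partial>leb d)"
      by (rule integral_mult_right_zero)
    also have "(\<integral>\<eta>. cnj (G \<eta> * wave d \<eta> x) \<partial>leb d) = cnj (F x)"
      unfolding F_def inverse_fourier_integral_def by (rule Bochner_Integration.integral_cnj)
    finally show "complex_of_real (gauss_weight d \<epsilon> x * (norm (F x))\<^sup>2)
      = (\<integral>\<eta>. (?w x * F x) * cnj (G \<eta>) * cnj (wave d \<eta> x) \<partial>leb d)"
      by (simp only: of_real_mult complex_norm_square mult.assoc)
  qed
  also have "\<dots> = (\<integral>\<eta>. \<integral>x. (?w x * F x) * cnj (G \<eta>) * cnj (wave d \<eta> x) \<partial>leb d \<partial>leb d)"
    by (rule leb_pair.Fubini_integral[OF pair, symmetric])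
  also have "\<dots> = (\<integral>\<eta>. cnj (G \<eta>) * (\<integral>\<xi>. G \<xi> * complex_of_real (?N \<eta> \<xi>) \<partial>leb d) \<partial>leb d)"
  proof (intro Bochner_Integration.integral_cong refl)
    fix \<eta>
    have "(\<integral>x. (?w x * F x) * cnj (G \<eta>) * cnj (wave d \<eta> x) \<partial>leb d)
      = (\<integral>x. cnj (G \<eta>) * (?w x * (F x * cnj (wave d \<eta> x))) \<partial>leb d)" by (simp add: mult_ac)
    also have "\<dots> = cnj (G \<eta>) * (\<integral>x. ?w x * (F x * cnj (wave d \<eta> x)) \<partial>leb d)"
      by (rule integral_mult_right_zero)
    finally show "(\<integral>x. (?w x * F x) * cnj (G \<eta>) * cnj (wave d \<eta> x) \<partial>leb d)
      = cnj (G \<eta>) * (\<integral>\<xi>. G \<xi> * complex_of_real (?N \<eta> \<xi>) \<partial>leb d)"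
      using gauss_inversion[OF \<epsilon> G, of \<eta>] by (simp add: F_def)
  qed
  finally have eq: "complex_of_real (\<integral>x. gauss_weight d \<epsilon> x * (norm (F x))\<^sup>2 \<partial>leb d)
    = (\<integral>\<eta>. cnj (G \<eta>) * (\<integral>\<xi>. G \<xi> * complex_of_real (?N \<eta> \<xi>) \<partial>leb d) \<partial>leb d)" .
  have nonneg: "(\<integral>x. gauss_weight d \<epsilon> x * (norm (F x))\<^sup>2 \<partial>leb d) \<ge> 0"
    by (intro integral_nonneg_AE) simp
  let ?A = "\<lambda>\<xi>. ennreal ((norm (G \<xi>))\<^sup>2 / 2)"
  have "(\<integral>\<^sup>+x. ennreal (gauss_weight d \<epsilon> x * (norm (F x))\<^sup>2) \<partial>leb d)
    = ennreal (\<integral>x. gauss_weight d \<epsilon> x * (norm (F x))\<^sup>2 \<partial>leb d)"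
    using wFF by (intro nn_integral_eq_integral) simp_all
  also have "\<dots> = ennreal (norm (\<integral>\<eta>. cnj (G \<eta>) * (\<integral>\<xi>. G \<xi> * complex_of_real (?N \<eta> \<xi>) \<partial>leb d) \<partial>leb d))"
    unfolding eq[symmetric] using nonneg by simp
  also have "\<dots> \<le> (\<integral>\<^sup>+\<eta>. ennreal (norm (cnj (G \<eta>) * (\<integral>\<xi>. G \<xi> * complex_of_real (?N \<eta> \<xi>) \<partial>leb d))) \<partial>leb d)"
    by (rule ennreal_norm_integral_le)
  also have "\<dots> \<le> (\<integral>\<^sup>+\<eta>. (\<integral>\<^sup>+\<xi>. ?A \<eta> * ennreal (?N \<eta> \<xi>) + ?A \<xi> * ennreal (?N \<eta> \<xi>) \<partial>leb d) \<partial>leb d)"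
  proof (intro nn_integral_mono)
    fix \<eta>
    have "ennreal (norm (cnj (G \<eta>) * (\<integral>\<xi>. G \<xi> * complex_of_real (?N \<eta> \<xi>) \<partial>leb d)))
      \<le> ennreal (norm (G \<eta>)) * (\<integral>\<^sup>+\<xi>. ennreal (norm (G \<xi> * complex_of_real (?N \<eta> \<xi>))) \<partial>leb d)"
      unfolding norm_mult[of "cnj (G \<eta>)"] complex_mod_cnj ennreal_mult[OF norm_ge_zero norm_ge_zero]
      by (rule mult_left_mono[OF ennreal_norm_integral_le]) simp
    also have "\<dots> = (\<integral>\<^sup>+\<xi>. ennreal (norm (G \<eta>)) * ennreal (norm (G \<xi> * complex_of_real (?N \<eta> \<xi>))) \<partial>leb d)"
      by (rule nn_integral_cmult[symmetric]) simp
    also have "\<dots> \<le> (\<integral>\<^sup>+\<xi>. ?A \<eta> * ennreal (?N \<eta> \<xi>) + ?A \<xi> * ennreal (?N \<eta> \<xi>) \<partial>leb d)"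
    proof (intro nn_integral_mono)
      fix \<xi>
      have "norm (G \<eta>) * norm (G \<xi>) \<le> (norm (G \<eta>))\<^sup>2 / 2 + (norm (G \<xi>))\<^sup>2 / 2"
        using sum_squares_bound[of "norm (G \<eta>)" "norm (G \<xi>)"] by (simp add: field_simps)
      then have "norm (G \<eta>) * norm (G \<xi>) * ?N \<eta> \<xi> \<le> ((norm (G \<eta>))\<^sup>2 / 2 + (norm (G \<xi>))\<^sup>2 / 2) * ?N \<eta> \<xi>"
        by (intro mult_right_mono gauss_kernel_nonneg)
      then have "ennreal (norm (G \<eta>) * (norm (G \<xi>) * ?N \<eta> \<xi>)) \<le> ennreal ((norm (G \<eta>))\<^sup>2 / 2 * ?N \<eta> \<xi> + (norm (G \<xi>))\<^sup>2 / 2 * ?N \<eta> \<xi>)"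
        by (intro ennreal_leI) (simp add: algebra_simps)
      then show "ennreal (norm (G \<eta>)) * ennreal (norm (G \<xi> * complex_of_real (?N \<eta> \<xi>))) \<le> ?A \<eta> * ennreal (?N \<eta> \<xi>) + ?A \<xi> * ennreal (?N \<eta> \<xi>)"
        by (simp add: norm_mult gauss_kernel_nonneg ennreal_mult[symmetric] ennreal_plus[symmetric] del: ennreal_plus)
    qed
    finally show "ennreal (norm (cnj (G \<eta>) * (\<integral>\<xi>. G \<xi> * complex_of_real (?N \<eta> \<xi>) \<partial>leb d))) \<le> \<dots>" .
  qed
  also have "\<dots> = (\<integral>\<^sup>+\<eta>. (\<integral>\<^sup>+\<xi>. ?A \<eta> * ennreal (?N \<eta> \<xi>) \<partial>leb d) \<partial>leb d) + (\<integral>\<^sup>+\<eta>. (\<integral>\<^sup>+\<xi>. ?A \<xi> * ennreal (?N \<eta> \<xi>) \<partial>leb d) \<partial>leb d)"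
    by (subst nn_integral_add[symmetric]) (auto intro!: nn_integral_cong nn_integral_add leb.borel_measurable_nn_integral simp: split_beta')
  also have "(\<integral>\<^sup>+\<eta>. (\<integral>\<^sup>+\<xi>. ?A \<eta> * ennreal (?N \<eta> \<xi>) \<partial>leb d) \<partial>leb d) = (\<integral>\<^sup>+\<eta>. ?A \<eta> \<partial>leb d)"
    using \<epsilon> by (simp add: nn_integral_cmult gauss_kernel_nn_integral)
  also have "(\<integral>\<^sup>+\<eta>. (\<integral>\<^sup>+\<xi>. ?A \<xi> * ennreal (?N \<eta> \<xi>) \<partial>leb d) \<partial>leb d) = (\<integral>\<^sup>+\<xi>. (\<integral>\<^sup>+\<eta>. ?A \<xi> * ennreal (?N \<xi> \<eta>) \<partial>leb d) \<partial>leb d)"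
    by (subst leb_pair.Fubini') (auto simp: split_beta' gauss_kernel_commute)
  also have "\<dots> = (\<integral>\<^sup>+\<eta>. ?A \<eta> \<partial>leb d)"
    using \<epsilon> by (simp add: nn_integral_cmult gauss_kernel_nn_integral)
  also have "(\<integral>\<^sup>+\<eta>. ?A \<eta> \<partial>leb d) + (\<integral>\<^sup>+\<eta>. ?A \<eta> \<partial>leb d) = (\<integral>\<^sup>+\<xi>. ennreal ((norm (G \<xi>))\<^sup>2) \<partial>leb d)"
    by (subst nn_integral_add[symmetric]) (auto simp: ennreal_plus[symmetric] simp del: ennreal_plus)
  finally show ?thesis unfolding F_def .
qed

text \<open>One half of Plancherel's theorem, by Fatou's lemma from the damped version. It is going
  to bound the L^2 norms of all derivatives.\<close>

lemma bessel:
  assumes G: "integrable (leb d) G"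
  shows "(\<integral>\<^sup>+x. ennreal ((norm (inverse_fourier_integral d G x))\<^sup>2) \<partial>leb d)
    \<le> (\<integral>\<^sup>+\<xi>. ennreal ((norm (G \<xi>))\<^sup>2) \<partial>leb d)"
proof -
  have [measurable]: "G \<in> borel_measurable (leb d)" using G by simp
  let ?F = "inverse_fourier_integral d G"
  let ?e = "\<lambda>n. 1 / real (Suc n)"
  have lim: "(\<lambda>n. gauss_weight d (?e n) x) \<longlonglongrightarrow> 1" for x
  proof -
    have "(\<lambda>n. \<Prod>i<d. exp (- (?e n * x i)\<^sup>2 / 2)) \<longlonglongrightarrow> (\<Prod>i<d. exp (- (0 * x i)\<^sup>2 / 2))"
      by (intro tendsto_intros LIMSEQ_Suc[OF lim_1_over_n]) auto
    then show ?thesis by (simp add: gauss_weight_def)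
  qed
  have "(\<integral>\<^sup>+x. ennreal ((norm (?F x))\<^sup>2) \<partial>leb d)
    = (\<integral>\<^sup>+x. liminf (\<lambda>n. ennreal (gauss_weight d (?e n) x * (norm (?F x))\<^sup>2)) \<partial>leb d)"
  proof (intro nn_integral_cong)
    fix x
    have "(\<lambda>n. ennreal (gauss_weight d (?e n) x * (norm (?F x))\<^sup>2)) \<longlonglongrightarrow> ennreal (1 * (norm (?F x))\<^sup>2)"
      by (intro tendsto_ennrealI tendsto_intros lim)
    then have "liminf (\<lambda>n. ennreal (gauss_weight d (?e n) x * (norm (?F x))\<^sup>2)) = ennreal (1 * (norm (?F x))\<^sup>2)"
      by (rule lim_imp_Liminf[OF sequentially_bot])
    then show "ennreal ((norm (?F x))\<^sup>2) = liminf (\<lambda>n. ennreal (gauss_weight d (?e n) x * (norm (?F x))\<^sup>2))"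
      by (simp only: mult_1)
  qed
  also have "\<dots> \<le> liminf (\<lambda>n. \<integral>\<^sup>+x. ennreal (gauss_weight d (?e n) x * (norm (?F x))\<^sup>2) \<partial>leb d)"
    by (intro nn_integral_liminf) measurable
  also have "\<dots> \<le> liminf (\<lambda>n. \<integral>\<^sup>+\<xi>. ennreal ((norm (G \<xi>))\<^sup>2) \<partial>leb d)"
    by (intro Liminf_mono always_eventually allI bessel_weighted[OF _ G]) auto
  finally show ?thesis by (simp add: Liminf_const)
qed

section \<open>The L^2 Fourier transform tested against Gaussians\<close>

text \<open>The Cauchy--Schwarz inequality, applied to nonnegative integrals since
  \<open>L2_tendsto\<close> is expressed through these.\<close>

lemma L2_tendsto_integral:
  assumes lim: "L2_tendsto M F f"
    and [measurable]: "\<And>n. F n \<in> borel_measurable M" "f \<in> borel_measurable M" "k \<in> borel_measurable M"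
    and k: "(\<integral>\<^sup>+x. ennreal ((norm (k x))\<^sup>2) \<partial>M) < \<infinity>"
    and int: "\<And>n. integrable M (\<lambda>x. F n x * k x)" "integrable M (\<lambda>x. f x * k x)"
  shows "(\<lambda>n. \<integral>x. F n x * k x \<partial>M) \<longlonglongrightarrow> (\<integral>x. f x * k x \<partial>M)"
proof -
  let ?a = "\<lambda>n. norm ((\<integral>x. F n x * k x \<partial>M) - (\<integral>x. f x * k x \<partial>M))"
  let ?c = "\<lambda>n. \<integral>\<^sup>+x. ennreal ((norm (F n x - f x))\<^sup>2) \<partial>M"
  let ?K = "\<integral>\<^sup>+x. ennreal ((norm (k x))\<^sup>2) \<partial>M"
  have le: "ennreal ((?a n)\<^sup>2) \<le> ?K * ?c n" for n
  proof -
    have "(\<integral>x. F n x * k x \<partial>M) - (\<integral>x. f x * k x \<partial>M) = (\<integral>x. (F n x - f x) * k x \<partial>M)"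
      using int by (simp add: left_diff_distrib Bochner_Integration.integral_diff)
    then have "ennreal (?a n) \<le> (\<integral>\<^sup>+x. ennreal (norm ((F n x - f x) * k x)) \<partial>M)"
      by (simp only: ennreal_norm_integral_le)
    also have "\<dots> = (\<integral>\<^sup>+x. ennreal (norm (F n x - f x)) * ennreal (norm (k x)) \<partial>M)"
      by (simp add: norm_mult ennreal_mult)
    finally have "(ennreal (?a n))\<^sup>2 \<le> (\<integral>\<^sup>+x. ennreal (norm (F n x - f x)) * ennreal (norm (k x)) \<partial>M)\<^sup>2"
      by (rule power_mono) simp
    also have "\<dots> \<le> (\<integral>\<^sup>+x. (ennreal (norm (F n x - f x)))\<^sup>2 \<partial>M) * (\<integral>\<^sup>+x. (ennreal (norm (k x)))\<^sup>2 \<partial>M)"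
      by (rule Cauchy_Schwarz_nn_integral) auto
    finally show ?thesis by (simp add: ennreal_power mult.commute)
  qed
  have "(\<lambda>n. ?K * ?c n) \<longlonglongrightarrow> ?K * 0"
    using lim k unfolding L2_tendsto_def by (intro ennreal_tendsto_cmult) auto
  then have c0: "(\<lambda>n. ?K * ?c n) \<longlonglongrightarrow> 0" by simp
  have "(\<lambda>n. ennreal ((?a n)\<^sup>2)) \<longlonglongrightarrow> 0"
    by (rule tendsto_sandwich[OF _ _ tendsto_const c0]) (use le in simp_all)
  then have "(\<lambda>n. enn2real (ennreal ((?a n)\<^sup>2))) \<longlonglongrightarrow> enn2real 0"
    by (intro tendsto_enn2real) auto
  then have "(\<lambda>n. (?a n)\<^sup>2) \<longlonglongrightarrow> 0" by simp
  then have "(\<lambda>n. sqrt ((?a n)\<^sup>2)) \<longlonglongrightarrow> sqrt 0" by (rule tendsto_real_sqrt)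
  then have "?a \<longlonglongrightarrow> 0" by simp
  then show ?thesis by (rule LIM_zero_cancel[OF tendsto_norm_zero_cancel])
qed

lemma integrable_mult_L2:
  fixes f k :: "'a \<Rightarrow> complex"
  assumes [measurable]: "f \<in> borel_measurable M" "k \<in> borel_measurable M"
    and "integrable M (\<lambda>x. (norm (f x))\<^sup>2)" "integrable M (\<lambda>x. (norm (k x))\<^sup>2)"
  shows "integrable M (\<lambda>x. f x * k x)"
proof (rule Bochner_Integration.integrable_bound)
  show "integrable M (\<lambda>x. (norm (f x))\<^sup>2 + (norm (k x))\<^sup>2)" using assms by simp
  have "norm (f x * k x) \<le> (norm (f x))\<^sup>2 + (norm (k x))\<^sup>2" for x
    using sum_squares_bound[of "norm (f x)" "norm (k x)"] mult_nonneg_nonneg[OF norm_ge_zero[of "f x"] norm_ge_zero[of "k x"]]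
    unfolding norm_mult by linarith
  then show "AE x in M. norm (f x * k x) \<le> norm ((norm (f x))\<^sup>2 + (norm (k x))\<^sup>2)" by (simp add: abs_of_nonneg)
qed measurable

lemma gauss_kernel_square_integrable:
  assumes \<epsilon>: "\<epsilon> > 0"
  shows "integrable (leb d) (\<lambda>x. (gauss_kernel d \<epsilon> a x)\<^sup>2)"
proof (rule Bochner_Integration.integrable_bound)
  define B where "B = (1 / sqrt (2 * pi * (\<epsilon> / (2 * pi))\<^sup>2)) ^ d"
  have B: "gauss_kernel d \<epsilon> a x \<le> B" for x
  proof -
    have "gauss_kernel d \<epsilon> a x \<le> (\<Prod>i<d. 1 / sqrt (2 * pi * (\<epsilon> / (2 * pi))\<^sup>2))"
      unfolding gauss_kernel_def
    proof (intro prod_mono conjI)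
      fix i
      show "normal_density (a i) (\<epsilon> / (2 * pi)) (x i) \<le> 1 / sqrt (2 * pi * (\<epsilon> / (2 * pi))\<^sup>2)"
        unfolding normal_density_def by (intro mult_left_le) (auto simp: divide_nonpos_nonneg)
    qed simp
    then show ?thesis by (simp add: B_def)
  qed
  show "integrable (leb d) (\<lambda>x. B * gauss_kernel d \<epsilon> a x)" using gauss_kernel_integrable[OF \<epsilon>] by simp
  show "AE x in leb d. norm ((gauss_kernel d \<epsilon> a x)\<^sup>2) \<le> norm (B * gauss_kernel d \<epsilon> a x)"
    using B gauss_kernel_nonneg[of d \<epsilon> a]
    by (auto simp: power2_eq_square abs_mult intro!: mult_right_mono order.trans[OF B])
qed measurable

text \<open>Here the approximating sequence in the definition of the transform is disposed of. For
  its members the identity is the conjugate of \<open>gauss_inversion\<close>, and both sides are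
  continuous in L^2 because the Gaussian weight and kernel are square-integrable.\<close>

lemma gauss_fourier_transform:
  assumes ft: "is_fourier_transform d f g" and \<epsilon>: "\<epsilon> > 0"
  shows "(\<integral>\<xi>. g \<xi> * (complex_of_real (gauss_weight d \<epsilon> \<xi>) * wave d \<xi> a) \<partial>leb d)
    = (\<integral>t. f t * complex_of_real (gauss_kernel d \<epsilon> a t) \<partial>leb d)"
proof -
  from ft obtain F where F: "\<And>n. integrable (leb d) (F n)" "\<And>n. square_integrable (leb d) (F n)"
    and Ff: "L2_tendsto (leb d) F f" and Fg: "L2_tendsto (leb d) (\<lambda>n. fourier_integral d (F n)) g"
    unfolding is_fourier_transform_def by blast
  have f: "f \<in> borel_measurable (leb d)" "integrable (leb d) (\<lambda>x. (norm (f x))\<^sup>2)"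
    and g: "g \<in> borel_measurable (leb d)" "integrable (leb d) (\<lambda>x. (norm (g x))\<^sup>2)"
    using ft by (auto simp: is_fourier_transform_def square_integrable_def)
  note [measurable] = f(1) g(1)
  have [measurable]: "F n \<in> borel_measurable (leb d)" for n using F(1) by simp
  let ?k = "\<lambda>\<xi>. complex_of_real (gauss_weight d \<epsilon> \<xi>) * wave d \<xi> a"
  let ?N = "\<lambda>t. complex_of_real (gauss_kernel d \<epsilon> a t)"
  have FTm [measurable]: "fourier_integral d (F n) \<in> borel_measurable (leb d)" for n
    unfolding fourier_integral_eq[abs_def] by measurable
  have kint: "integrable (leb d) ?k"
    using gauss_weight_integrable[OF \<epsilon>, of d] by (intro integrable_mult_wave) simp
  have k2: "integrable (leb d) (\<lambda>\<xi>. (norm (?k \<xi>))\<^sup>2)"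
  proof (rule Bochner_Integration.integrable_bound[OF gauss_weight_integrable[OF \<epsilon>, of d]])
    have "(gauss_weight d \<epsilon> \<xi>)\<^sup>2 \<le> gauss_weight d \<epsilon> \<xi>" for \<xi>
      using gauss_weight_bounds[of d \<epsilon> \<xi>] by (simp add: power2_eq_square mult_left_le)
    then show "AE \<xi> in leb d. norm ((norm (?k \<xi>))\<^sup>2) \<le> norm (gauss_weight d \<epsilon> \<xi>)"
      using gauss_weight_bounds(1)[of d \<epsilon>] by (auto simp: norm_mult intro: order.trans[OF _ abs_ge_self])
  qed measurable
  have N2: "integrable (leb d) (\<lambda>\<xi>. (norm (?N \<xi>))\<^sup>2)"
    using gauss_kernel_square_integrable[OF \<epsilon>, of d a] by simp
  have fin: "(\<integral>\<^sup>+x. ennreal ((norm (h x))\<^sup>2) \<partial>leb d) < \<infinity>" if "integrable (leb d) (\<lambda>x. (norm (h x))\<^sup>2)" for h :: "_ \<Rightarrow> complex"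
    using that by (simp add: integrable_iff_bounded)
  have eq: "(\<integral>\<xi>. fourier_integral d (F n) \<xi> * ?k \<xi> \<partial>leb d) = (\<integral>t. F n t * ?N t \<partial>leb d)" for n
  proof -
    have "(\<integral>x. complex_of_real (gauss_weight d \<epsilon> x) * (inverse_fourier_integral d (\<lambda>x. cnj (F n x)) x * cnj (wave d a x)) \<partial>leb d)
      = (\<integral>\<xi>. cnj (F n \<xi>) * complex_of_real (gauss_kernel d \<epsilon> a \<xi>) \<partial>leb d)"
      using F(1) by (intro gauss_inversion[OF \<epsilon>]) simp
    then have "cnj (\<integral>x. complex_of_real (gauss_weight d \<epsilon> x) * (inverse_fourier_integral d (\<lambda>x. cnj (F n x)) x * cnj (wave d a x)) \<partial>leb d)
      = cnj (\<integral>\<xi>. cnj (F n \<xi>) * complex_of_real (gauss_kernel d \<epsilon> a \<xi>) \<partial>leb d)" by simp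
    then show ?thesis
      unfolding Bochner_Integration.integral_cnj[symmetric] by (simp add: fourier_integral_eq wave_commute[of d a] mult_ac)
  qed
  have "(\<lambda>n. \<integral>\<xi>. fourier_integral d (F n) \<xi> * ?k \<xi> \<partial>leb d) \<longlonglongrightarrow> (\<integral>\<xi>. g \<xi> * ?k \<xi> \<partial>leb d)"
  proof (rule L2_tendsto_integral[OF Fg])
    show "integrable (leb d) (\<lambda>\<xi>. fourier_integral d (F n) \<xi> * ?k \<xi>)" for n
    proof (rule Bochner_Integration.integrable_bound)
      show "integrable (leb d) (\<lambda>\<xi>. (\<integral>t. norm (F n t) \<partial>leb d) *\<^sub>R ?k \<xi>)" using kint by (rule integrable_scaleR_right)
      have "norm (fourier_integral d (F n) \<xi>) \<le> (\<integral>t. norm (F n t) \<partial>leb d)" for \<xi>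
        using inverse_fourier_bound[of d "\<lambda>x. cnj (F n x)" \<xi>] F(1) by (simp add: fourier_integral_eq)
      then have "norm (fourier_integral d (F n) \<xi>) \<le> norm (\<integral>t. norm (F n t) \<partial>leb d)" for \<xi>
        by (simp add: order.trans[OF _ abs_ge_self])
      then show "AE \<xi> in leb d. norm (fourier_integral d (F n) \<xi> * ?k \<xi>) \<le> norm ((\<integral>t. norm (F n t) \<partial>leb d) *\<^sub>R ?k \<xi>)"
        unfolding norm_mult norm_scaleR real_norm_def by (intro AE_I2 mult_right_mono) auto
    qed measurable
    show "integrable (leb d) (\<lambda>\<xi>. g \<xi> * ?k \<xi>)" using g k2 by (intro integrable_mult_L2) measurable
  qed (use fin[OF k2] in measurable)
  moreover have "(\<lambda>n. \<integral>t. F n t * ?N t \<partial>leb d) \<longlonglongrightarrow> (\<integral>t. f t * ?N t \<partial>leb d)"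
  proof (rule L2_tendsto_integral[OF Ff])
    show "integrable (leb d) (\<lambda>t. F n t * ?N t)" for n
      using F(2) N2 by (intro integrable_mult_L2) (auto simp: square_integrable_def)
    show "integrable (leb d) (\<lambda>t. f t * ?N t)" using f N2 by (intro integrable_mult_L2) measurable
  qed (use fin[OF N2] in measurable)
  ultimately show ?thesis unfolding eq by (rule LIMSEQ_unique)
qed

section \<open>Smoothed indicators of rectangles\<close>

text \<open>The substitution fixes the Gaussian and moves \<open>\<sigma>\<close> into the argument
  of \<open>h\<close>, so that a single density serves as majorant for all
  \<open>\<sigma>\<close>.\<close>

lemma normal_density_affine_integral:
  fixes h :: "real \<Rightarrow> real"
  assumes "\<sigma> > 0"
  shows "(\<integral>s. h s * normal_density t \<sigma> s \<partial>lborel) = (\<integral>z. h (t + \<sigma> * z) * std_normal_density z \<partial>lborel)"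
proof -
  have "(\<integral>s. h s * normal_density t \<sigma> s \<partial>lborel)
    = \<bar>\<sigma>\<bar> *\<^sub>R (\<integral>z. h (t + \<sigma> * z) * normal_density t \<sigma> (t + \<sigma> * z) \<partial>lborel)"
    using assms by (intro lborel_integral_real_affine) simp
  also have "\<dots> = (\<integral>z. \<sigma> * (h (t + \<sigma> * z) * normal_density t \<sigma> (t + \<sigma> * z)) \<partial>lborel)"
    using assms by simp
  also have "\<dots> = (\<integral>z. h (t + \<sigma> * z) * std_normal_density z \<partial>lborel)"
  proof (intro Bochner_Integration.integral_cong refl)
    fix z
    have "\<sigma> * normal_density t \<sigma> (t + \<sigma> * z) = std_normal_density z"
      using assms by (simp add: normal_density_def real_sqrt_mult power_mult_distrib)
    then show "\<sigma> * (h (t + \<sigma> * z) * normal_density t \<sigma> (t + \<sigma> * z)) = h (t + \<sigma> * z) * std_normal_density z"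
      by (metis mult.left_commute mult.commute)
  qed
  finally show ?thesis .
qed

definition smoothed_interval :: "real \<Rightarrow> real \<Rightarrow> real \<Rightarrow> real \<Rightarrow> real" where
  "smoothed_interval A B \<sigma> t = (\<integral>s. indicator {A..B} s * normal_density t \<sigma> s \<partial>lborel)"

lemma smoothed_interval_eq:
  "\<sigma> > 0 \<Longrightarrow> smoothed_interval A B \<sigma> t = (\<integral>z. indicator {A..B} (t + \<sigma> * z) * std_normal_density z \<partial>lborel)"
  unfolding smoothed_interval_def by (rule normal_density_affine_integral)

lemma indicator_normal_integrable:
  "\<sigma> > 0 \<Longrightarrow> integrable lborel (\<lambda>s. indicator {A..B} s * normal_density t \<sigma> s)"
  by (rule Bochner_Integration.integrable_bound[OF integrable_normal_density[of \<sigma> t]])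
    (auto simp: indicator_def)

lemma smoothed_interval_nonneg: "smoothed_interval A B \<sigma> t \<ge> 0"
  unfolding smoothed_interval_def by (intro integral_nonneg_AE) (auto simp: indicator_def)

text \<open>At an endpoint of a proper interval the limit is \<open>1 / 2\<close>, whence the
  exclusion; rectangles have null boundary.\<close>

lemma smoothed_interval_tendsto:
  assumes \<sigma>: "\<And>n. 0 < \<sigma> n" "\<sigma> \<longlonglongrightarrow> 0" and t: "t \<noteq> A" "t \<noteq> B"
  shows "(\<lambda>n. smoothed_interval A B (\<sigma> n) t) \<longlonglongrightarrow> indicator {A..B} t"
proof -
  have "(\<lambda>n. \<integral>z. indicator {A..B} (t + \<sigma> n * z) * std_normal_density z \<partial>lborel)
    \<longlonglongrightarrow> (\<integral>z. indicator {A..B} t * std_normal_density z \<partial>lborel)"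
  proof (rule integral_dominated_convergence[where w = std_normal_density])
    show "AE z in lborel. (\<lambda>n. indicator {A..B} (t + \<sigma> n * z) * std_normal_density z)
      \<longlonglongrightarrow> indicator {A..B} t * std_normal_density z"
    proof (intro AE_I2 tendsto_mult_right)
      fix z
      have lim: "(\<lambda>n. t + \<sigma> n * z) \<longlonglongrightarrow> t" using \<sigma>(2) by (auto intro!: tendsto_eq_intros)
      have "\<forall>\<^sub>F n in sequentially. t + \<sigma> n * z \<in> {A..B} \<longleftrightarrow> t \<in> {A..B}"
      proof (cases "t \<in> {A..B}")
        case True
        then have "t \<in> {A<..<B}" using t by auto
        show ?thesis
          by (rule eventually_mono[OF topological_tendstoD[OF lim open_greaterThanLessThan \<open>t \<in> {A<..<B}\<close>]])
            (use True in auto)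
      next
        case False
        then have "t \<in> - {A..B}" by simp
        show ?thesis
          by (rule eventually_mono[OF topological_tendstoD[OF lim _ \<open>t \<in> - {A..B}\<close>]])
            (use False in \<open>auto simp: open_Compl\<close>)
      qed
      then show "(\<lambda>n. indicator {A..B} (t + \<sigma> n * z)) \<longlonglongrightarrow> (indicator {A..B} t :: real)"
        by (intro tendsto_eventually) (auto elim!: eventually_mono simp: indicator_def)
    qed
    show "integrable lborel std_normal_density" by simp
    show "AE z in lborel. norm (indicator {A..B} (t + \<sigma> n * z) * std_normal_density z) \<le> std_normal_density z" for n
      by (intro AE_I2) (simp add: indicator_def)
  qed measurable
  then show ?thesis unfolding smoothed_interval_eq[OF \<sigma>(1)] by simp
qed

text \<open>Chebyshev's inequality, with a constant that does not depend on \<open>\<sigma>\<close>.\<close>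

lemma smoothed_interval_bound:
  assumes \<sigma>: "0 < \<sigma>" "\<sigma> \<le> 1" and R: "\<bar>A\<bar> \<le> R" "\<bar>B\<bar> \<le> R"
  shows "smoothed_interval A B \<sigma> t \<le> (\<integral>z. (1 + 2 * R\<^sup>2 + 2 * z\<^sup>2) * std_normal_density z \<partial>lborel) / (1 + t\<^sup>2)"
proof -
  have pos: "1 + t\<^sup>2 > 0" by (simp add: add_pos_nonneg)
  have int: "integrable lborel (\<lambda>z. (1 + 2 * R\<^sup>2 + 2 * z\<^sup>2) * std_normal_density z)"
  proof -
    have "integrable lborel (\<lambda>z. (1 + 2 * R\<^sup>2) * std_normal_density z + 2 * (std_normal_density z * z\<^sup>2))"
      by (intro Bochner_Integration.integrable_add integrable_mult_right integrable_std_normal_moment) simp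
    then show ?thesis by (simp add: algebra_simps)
  qed
  have "(1 + t\<^sup>2) * smoothed_interval A B \<sigma> t
    = (1 + t\<^sup>2) * (\<integral>z. indicator {A..B} (t + \<sigma> * z) * std_normal_density z \<partial>lborel)"
    using \<sigma> by (simp only: smoothed_interval_eq)
  also have "\<dots> = (\<integral>z. (1 + t\<^sup>2) * (indicator {A..B} (t + \<sigma> * z) * std_normal_density z) \<partial>lborel)"
    by (rule integral_mult_right_zero[symmetric])
  also have "\<dots> \<le> (\<integral>z. (1 + 2 * R\<^sup>2 + 2 * z\<^sup>2) * std_normal_density z \<partial>lborel)"
  proof (rule integral_mono)
    show "integrable lborel (\<lambda>z. (1 + t\<^sup>2) * (indicator {A..B} (t + \<sigma> * z) * std_normal_density z))"
      by (intro integrable_mult_right Bochner_Integration.integrable_bound[OF integrable_normal_density[of 1 0]])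
        (auto simp: indicator_def)
    fix z
    show "(1 + t\<^sup>2) * (indicator {A..B} (t + \<sigma> * z) * std_normal_density z) \<le> (1 + 2 * R\<^sup>2 + 2 * z\<^sup>2) * std_normal_density z"
    proof (cases "t + \<sigma> * z \<in> {A..B}")
      case True
      then have "\<bar>t + \<sigma> * z\<bar> \<le> R" using R by auto
      then have "(t + \<sigma> * z)\<^sup>2 \<le> R\<^sup>2" by (metis abs_ge_zero power2_abs power_mono)
      moreover have "(\<sigma> * z)\<^sup>2 \<le> z\<^sup>2"
        using \<sigma> by (auto simp: power_mult_distrib intro!: mult_left_le_one_le power_le_one)
      moreover have "t\<^sup>2 \<le> 2 * (t + \<sigma> * z)\<^sup>2 + 2 * (\<sigma> * z)\<^sup>2"
        using zero_le_power2[of "t + 2 * (\<sigma> * z)"] by (simp add: power2_eq_square algebra_simps)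
      ultimately have "1 + t\<^sup>2 \<le> 1 + 2 * R\<^sup>2 + 2 * z\<^sup>2" by linarith
      then show ?thesis using True by (simp add: mult_right_mono)
    qed (simp add: add_nonneg_nonneg)
  qed (rule int)
  finally show ?thesis using pos by (simp add: pos_le_divide_eq mult.commute)
qed

definition rectangle :: "nat \<Rightarrow> (nat \<Rightarrow> real) \<Rightarrow> (nat \<Rightarrow> real) \<Rightarrow> (nat \<Rightarrow> real) set" where
  "rectangle d A B = PiE {..<d} (\<lambda>i. {A i..B i})"

lemma rectangle_in_sets [measurable]: "rectangle d A B \<in> sets (leb d)"
  unfolding rectangle_def by (intro sets_PiM_I_finite) auto

lemma emeasure_rectangle_finite: "emeasure (leb d) (rectangle d A B) < \<infinity>"
proof -
  have "emeasure (leb d) (rectangle d A B) = (\<Prod>i<d. emeasure lborel {A i..B i})"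
    unfolding rectangle_def by (intro lebesgue_product.emeasure_PiM) auto
  also have "\<dots> = (\<Prod>i<d. ennreal (max 0 (B i - A i)))"
    by (intro prod.cong refl) (auto simp: emeasure_lborel_Icc_eq max_def)
  also have "\<dots> = ennreal (\<Prod>i<d. max 0 (B i - A i))" by (rule prod_ennreal) simp
  finally show ?thesis by simp
qed

lemma indicator_rectangle:
  "x \<in> space (leb d) \<Longrightarrow> indicator (rectangle d A B) x = (\<Prod>i<d. indicator {A i..B i} (x i) :: real)"
  by (auto simp: rectangle_def indicator_def space_PiM PiE_iff)

lemma smoothed_rectangle:
  assumes "\<epsilon> > 0"
  shows "(\<integral>a. indicator (rectangle d A B) a * gauss_kernel d \<epsilon> a t \<partial>leb d)
    = (\<Prod>i<d. smoothed_interval (A i) (B i) (\<epsilon> / (2 * pi)) (t i))"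
proof -
  have "(\<integral>a. indicator (rectangle d A B) a * gauss_kernel d \<epsilon> a t \<partial>leb d)
    = (\<integral>a. (\<Prod>i<d. indicator {A i..B i} (a i) * normal_density (t i) (\<epsilon> / (2 * pi)) (a i)) \<partial>leb d)"
  proof (intro Bochner_Integration.integral_cong refl)
    fix a assume a: "a \<in> space (leb d)"
    have "gauss_kernel d \<epsilon> a t = (\<Prod>i<d. normal_density (t i) (\<epsilon> / (2 * pi)) (a i))"
      by (subst gauss_kernel_commute) (simp only: gauss_kernel_def)
    then show "indicator (rectangle d A B) a * gauss_kernel d \<epsilon> a t
      = (\<Prod>i<d. indicator {A i..B i} (a i) * normal_density (t i) (\<epsilon> / (2 * pi)) (a i))"
      by (simp only: indicator_rectangle[OF a] prod.distrib)
  qed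
  also have "\<dots> = (\<Prod>i<d. smoothed_interval (A i) (B i) (\<epsilon> / (2 * pi)) (t i))"
    unfolding smoothed_interval_def
    using assms by (intro lebesgue_product.product_integral_prod indicator_normal_integrable) auto
  finally show ?thesis .
qed

lemma AE_coordinate_neq:
  assumes "i < d"
  shows "AE x in leb d. x i \<noteq> c"
proof (rule AE_I)
  let ?N = "PiE {..<d} (\<lambda>j. if j = i then {c} else UNIV)"
  show "{x \<in> space (leb d). \<not> x i \<noteq> c} \<subseteq> ?N" by (auto simp: space_PiM PiE_iff extensional_def)
  show "?N \<in> sets (leb d)" by (intro sets_PiM_I_finite) auto
  have "emeasure (leb d) ?N = (\<Prod>j<d. emeasure lborel (if j = i then {c} else UNIV))"
    by (intro lebesgue_product.emeasure_PiM) auto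
  also have "\<dots> = 0" using assms by (intro prod_zero bexI[of _ i]) auto
  finally show "emeasure (leb d) ?N = 0" .
qed

lemma AE_rectangle_boundary: "AE x in leb d. \<forall>i<d. x i \<noteq> A i \<and> x i \<noteq> B i"
proof -
  have "AE x in leb d. \<forall>i\<in>{..<d}. x i \<noteq> A i \<and> x i \<noteq> B i"
    using AE_coordinate_neq by (subst AE_finite_all) auto
  then show ?thesis by eventually_elim auto
qed

lemma integrable_inverse_square_plus_one: "integrable lborel (\<lambda>x::real. 1 / (1 + x\<^sup>2))"
  using integrable_inverse_1_plus_square
  by (simp add: set_integrable_def einterval_def inverse_eq_divide)

lemma gauss_kernel_le:
  "gauss_kernel d \<epsilon> a x \<le> (1 / sqrt (2 * pi * (\<epsilon> / (2 * pi))\<^sup>2)) ^ d"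
proof -
  have "gauss_kernel d \<epsilon> a x \<le> (\<Prod>i<d. 1 / sqrt (2 * pi * (\<epsilon> / (2 * pi))\<^sup>2))"
    unfolding gauss_kernel_def
  proof (intro prod_mono conjI)
    fix i
    show "normal_density (a i) (\<epsilon> / (2 * pi)) (x i) \<le> 1 / sqrt (2 * pi * (\<epsilon> / (2 * pi))\<^sup>2)"
      unfolding normal_density_def by (intro mult_left_le) (auto simp: divide_nonpos_nonneg)
  qed simp
  then show ?thesis by simp
qed

text \<open>Fubini's theorem moves the smoothing from \<open>f\<close> to the indicator. Since
  \<open>f\<close> is only square-integrable, dominated convergence asks for a square-integrable
  majorant \<open>D\<close> of the smoothed indicators that does not depend on \<open>n\<close>; the
  uniform Chebyshev bound in each coordinate provides it.\<close>

lemma smoothed_rectangle_integral_tendsto: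
  fixes f :: "(nat \<Rightarrow> real) \<Rightarrow> complex"
  assumes f: "square_integrable (leb d) f"
    and \<epsilon>: "\<And>n. 0 < \<epsilon> n" "\<And>n. \<epsilon> n \<le> 1" "\<epsilon> \<longlonglongrightarrow> 0"
  shows "(\<lambda>n. \<integral>a. indicator (rectangle d A B) a *\<^sub>R (\<integral>t. f t * complex_of_real (gauss_kernel d (\<epsilon> n) a t) \<partial>leb d) \<partial>leb d)
    \<longlonglongrightarrow> (\<integral>t. indicator (rectangle d A B) t *\<^sub>R f t \<partial>leb d)"
proof -
  have [measurable]: "f \<in> borel_measurable (leb d)" and f2: "integrable (leb d) (\<lambda>x. (norm (f x))\<^sup>2)"
    using f by (auto simp: square_integrable_def)
  define \<Psi> where "\<Psi> = (\<lambda>n t. \<Prod>i<d. smoothed_interval (A i) (B i) (\<epsilon> n / (2 * pi)) (t i))"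
  have \<Psi>eq: "\<Psi> n t = (\<integral>a. indicator (rectangle d A B) a * gauss_kernel d (\<epsilon> n) a t \<partial>leb d)" for n t
    unfolding \<Psi>_def by (rule smoothed_rectangle[OF \<epsilon>(1), symmetric])
  have \<Psi>m [measurable]: "\<Psi> n \<in> borel_measurable (leb d)" for n
    unfolding \<Psi>eq[abs_def] by (rule leb.borel_measurable_lebesgue_integral) measurable
  let ?K = "\<lambda>n a t. complex_of_real (gauss_kernel d (\<epsilon> n) a t)"
  have swap: "(\<integral>a. indicator (rectangle d A B) a *\<^sub>R (\<integral>t. f t * ?K n a t \<partial>leb d) \<partial>leb d)
    = (\<integral>t. \<Psi> n t *\<^sub>R f t \<partial>leb d)" for n
  proof -
    define Bd where "Bd = (1 / sqrt (2 * pi * (\<epsilon> n / (2 * pi))\<^sup>2)) ^ d"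
    have K2: "integrable (leb d) (\<lambda>t. (norm (?K n a t))\<^sup>2)" for a
      using gauss_kernel_square_integrable[OF \<epsilon>(1)] by simp
    have fK: "integrable (leb d) (\<lambda>t. f t * ?K n a t)" for a
      using f2 K2 by (intro integrable_mult_L2) measurable
    \<comment> \<open>A crude bound independent of \<open>a\<close>. As the rectangle has finite
      measure, it makes the double integral absolutely convergent.\<close>
    have bd: "(\<integral>t. norm (f t * ?K n a t) \<partial>leb d) \<le> (\<integral>t. (norm (f t))\<^sup>2 \<partial>leb d) + Bd" for a
    proof -
      have "(\<integral>t. norm (f t * ?K n a t) \<partial>leb d) \<le> (\<integral>t. (norm (f t))\<^sup>2 + Bd * gauss_kernel d (\<epsilon> n) a t \<partial>leb d)"
      proof (rule integral_mono)
        show "integrable (leb d) (\<lambda>t. (norm (f t))\<^sup>2 + Bd * gauss_kernel d (\<epsilon> n) a t)"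
          using f2 gauss_kernel_integrable[OF \<epsilon>(1)] by simp
        fix t
        have "norm (f t * ?K n a t) \<le> (norm (f t))\<^sup>2 + (gauss_kernel d (\<epsilon> n) a t)\<^sup>2"
          using sum_squares_bound[of "norm (f t)" "gauss_kernel d (\<epsilon> n) a t"]
            mult_nonneg_nonneg[OF norm_ge_zero[of "f t"] gauss_kernel_nonneg[of d "\<epsilon> n" a t]]
          unfolding norm_mult norm_of_real abs_of_nonneg[OF gauss_kernel_nonneg] by linarith
        also have "(gauss_kernel d (\<epsilon> n) a t)\<^sup>2 \<le> Bd * gauss_kernel d (\<epsilon> n) a t"
          unfolding power2_eq_square[of "gauss_kernel d (\<epsilon> n) a t"] Bd_def by (intro mult_right_mono gauss_kernel_le gauss_kernel_nonneg)
        finally show "norm (f t * ?K n a t) \<le> (norm (f t))\<^sup>2 + Bd * gauss_kernel d (\<epsilon> n) a t" by simp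
      qed (use fK in simp)
      also have "\<dots> = (\<integral>t. (norm (f t))\<^sup>2 \<partial>leb d) + Bd"
      proof -
        have "(\<integral>t. gauss_kernel d (\<epsilon> n) a t \<partial>leb d) = 1"
          using nn_integral_eq_integral[OF gauss_kernel_integrable[OF \<epsilon>(1)], of d n a] gauss_kernel_nn_integral[OF \<epsilon>(1), of d n a] gauss_kernel_nonneg
          by (simp add: ennreal_eq_1)
        then show ?thesis using f2 gauss_kernel_integrable[OF \<epsilon>(1)] by simp
      qed
      finally show ?thesis .
    qed
    have int: "integrable (leb d \<Otimes>\<^sub>M leb d) (\<lambda>(a, t). indicator (rectangle d A B) a *\<^sub>R (f t * ?K n a t))"
    proof (rule leb_pair.Fubini_integrable)
      show "integrable (leb d) (\<lambda>a. \<integral>t. norm (case (a, t) of (a, t) \<Rightarrow> indicator (rectangle d A B) a *\<^sub>R (f t * ?K n a t)) \<partial>leb d)"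
      proof (rule Bochner_Integration.integrable_bound)
        show "integrable (leb d) (\<lambda>a. indicator (rectangle d A B) a *\<^sub>R ((\<integral>t. (norm (f t))\<^sup>2 \<partial>leb d) + Bd))"
          using emeasure_rectangle_finite by (intro integrable_scaleR_left) (simp add: integrable_indicator_iff)
        have "norm (\<integral>t. norm (indicator (rectangle d A B) a *\<^sub>R (f t * ?K n a t)) \<partial>leb d)
          \<le> norm (indicator (rectangle d A B) a *\<^sub>R ((\<integral>t. (norm (f t))\<^sup>2 \<partial>leb d) + Bd))" for a
          using order.trans[OF bd abs_ge_self, of a] by (auto simp: indicator_def abs_of_nonneg)
        then show "AE a in leb d. norm (\<integral>t. norm (case (a, t) of (a, t) \<Rightarrow> indicator (rectangle d A B) a *\<^sub>R (f t * ?K n a t)) \<partial>leb d)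
          \<le> norm (indicator (rectangle d A B) a *\<^sub>R ((\<integral>t. (norm (f t))\<^sup>2 \<partial>leb d) + Bd))" by simp
      qed (rule leb.borel_measurable_lebesgue_integral, measurable)
      show "AE a in leb d. integrable (leb d) (\<lambda>t. case (a, t) of (a, t) \<Rightarrow> indicator (rectangle d A B) a *\<^sub>R (f t * ?K n a t))"
        using fK by (intro AE_I2) simp
    qed measurable
    have "(\<integral>a. indicator (rectangle d A B) a *\<^sub>R (\<integral>t. f t * ?K n a t \<partial>leb d) \<partial>leb d)
      = (\<integral>a. \<integral>t. indicator (rectangle d A B) a *\<^sub>R (f t * ?K n a t) \<partial>leb d \<partial>leb d)" by simp
    also have "\<dots> = (\<integral>t. \<integral>a. indicator (rectangle d A B) a *\<^sub>R (f t * ?K n a t) \<partial>leb d \<partial>leb d)"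
      by (rule leb_pair.Fubini_integral[OF int, symmetric])
    also have "\<dots> = (\<integral>t. \<Psi> n t *\<^sub>R f t \<partial>leb d)"
    proof (intro Bochner_Integration.integral_cong refl)
      fix t
      have "integrable (leb d) (\<lambda>a. indicator (rectangle d A B) a * gauss_kernel d (\<epsilon> n) a t)"
        by (rule Bochner_Integration.integrable_bound[OF gauss_kernel_integrable[OF \<epsilon>(1), of d n t]])
          (auto simp: indicator_def gauss_kernel_commute[of d _ t])
      then have "\<Psi> n t *\<^sub>R f t = (\<integral>a. (indicator (rectangle d A B) a * gauss_kernel d (\<epsilon> n) a t) *\<^sub>R f t \<partial>leb d)"
        unfolding \<Psi>eq by (rule integral_scaleR_left[symmetric])
      moreover have "indicator (rectangle d A B) a *\<^sub>R (f t * ?K n a t) = (indicator (rectangle d A B) a * gauss_kernel d (\<epsilon> n) a t) *\<^sub>R f t" for a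
        by (simp add: scaleR_conv_of_real)
      ultimately show "(\<integral>a. indicator (rectangle d A B) a *\<^sub>R (f t * ?K n a t) \<partial>leb d) = \<Psi> n t *\<^sub>R f t"
        by (simp only:)
    qed
    finally show ?thesis .
  qed
  define R where "R = (\<Sum>i<d. \<bar>A i\<bar> + \<bar>B i\<bar>)"
  have R: "\<bar>A i\<bar> \<le> R" "\<bar>B i\<bar> \<le> R" if "i < d" for i
  proof -
    have "\<bar>A i\<bar> + \<bar>B i\<bar> \<le> R" unfolding R_def using that by (intro member_le_sum) auto
    then show "\<bar>A i\<bar> \<le> R" "\<bar>B i\<bar> \<le> R" by linarith+
  qed
  define C where "C = (\<integral>z. (1 + 2 * R\<^sup>2 + 2 * z\<^sup>2) * std_normal_density z \<partial>lborel)"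
  have \<sigma>: "0 < \<epsilon> n / (2 * pi)" "\<epsilon> n / (2 * pi) \<le> 1" for n
    using \<epsilon>(1,2)[of n] pi_gt3 by (auto simp: field_simps)
  define D where "D = (\<lambda>t::nat \<Rightarrow> real. \<Prod>i<d. C / (1 + (t i)\<^sup>2))"
  have D: "0 \<le> \<Psi> n t" "\<Psi> n t \<le> D t" for n t
    unfolding \<Psi>_def D_def C_def using \<sigma> R smoothed_interval_nonneg
    by (auto intro!: prod_nonneg prod_mono smoothed_interval_bound)
  have [measurable]: "D \<in> borel_measurable (leb d)" unfolding D_def by measurable
  have C0: "C \<ge> 0" unfolding C_def by (intro integral_nonneg_AE) auto
  have D2: "integrable (leb d) (\<lambda>t. (D t)\<^sup>2)"
  proof (rule Bochner_Integration.integrable_bound)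
    show "integrable (leb d) (\<lambda>t. \<Prod>i<d. C\<^sup>2 * (1 / (1 + (t i)\<^sup>2)))"
      by (rule lebesgue_product.product_integrable_prod)
        (rule finite_lessThan, intro integrable_mult_right integrable_inverse_square_plus_one)
    have "(D t)\<^sup>2 \<le> (\<Prod>i<d. C\<^sup>2 * (1 / (1 + (t i)\<^sup>2)))" for t
      unfolding D_def prod_power_distrib
    proof (intro prod_mono conjI)
      fix i
      have "1 / (1 + (t i)\<^sup>2) * (1 / (1 + (t i)\<^sup>2)) \<le> 1 * (1 / (1 + (t i)\<^sup>2))"
        by (intro mult_right_mono) (auto simp: add_pos_nonneg)
      then have "C\<^sup>2 * (1 / (1 + (t i)\<^sup>2) * (1 / (1 + (t i)\<^sup>2))) \<le> C\<^sup>2 * (1 * (1 / (1 + (t i)\<^sup>2)))"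
        by (rule mult_left_mono) simp
      then show "(C / (1 + (t i)\<^sup>2))\<^sup>2 \<le> C\<^sup>2 * (1 / (1 + (t i)\<^sup>2))" by (simp add: power2_eq_square)
    qed simp
    then show "AE t in leb d. norm ((D t)\<^sup>2) \<le> norm (\<Prod>i<d. C\<^sup>2 * (1 / (1 + (t i)\<^sup>2)))"
      by (intro AE_I2) (simp add: order.trans[OF _ abs_ge_self])
  qed measurable
  have "(\<lambda>n. \<integral>t. \<Psi> n t *\<^sub>R f t \<partial>leb d) \<longlonglongrightarrow> (\<integral>t. indicator (rectangle d A B) t *\<^sub>R f t \<partial>leb d)"
  proof (rule integral_dominated_convergence[where w = "\<lambda>t. norm (f t * complex_of_real (D t))"])
    show "integrable (leb d) (\<lambda>t. norm (f t * complex_of_real (D t)))"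
      using f2 D2 by (intro integrable_norm integrable_mult_L2) auto
    show "AE t in leb d. norm (\<Psi> n t *\<^sub>R f t) \<le> norm (f t * complex_of_real (D t))" for n
    proof (rule AE_I2)
      fix t
      have "\<Psi> n t * norm (f t) \<le> \<bar>D t\<bar> * norm (f t)"
        using D(2) by (intro mult_right_mono order.trans[OF _ abs_ge_self]) auto
      then show "norm (\<Psi> n t *\<^sub>R f t) \<le> norm (f t * complex_of_real (D t))"
        using D(1)[of n t] by (simp add: norm_mult mult.commute)
    qed
    show "AE t in leb d. (\<lambda>n. \<Psi> n t *\<^sub>R f t) \<longlonglongrightarrow> indicator (rectangle d A B) t *\<^sub>R f t"
      using AE_rectangle_boundary[of d A B] AE_space
    proof eventually_elim
      case (elim t)
      have "(\<lambda>n. \<epsilon> n / (2 * pi)) \<longlonglongrightarrow> 0" using \<epsilon>(3) by (auto intro!: tendsto_eq_intros)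
      then have "(\<lambda>n. \<Psi> n t) \<longlonglongrightarrow> (\<Prod>i<d. indicator {A i..B i} (t i))"
        unfolding \<Psi>_def using elim \<sigma> by (intro tendsto_prod smoothed_interval_tendsto) auto
      then show ?case using elim by (intro tendsto_scaleR tendsto_const) (simp add: indicator_rectangle)
    qed
  qed measurable
  then show ?thesis unfolding swap .
qed

section \<open>Functions determined by their integrals over rectangles\<close>

lemma space_leb: "space (leb d) = extensional {..<d}"
  by (auto simp: space_PiM PiE_def)

lemma mem_rectangle_iff:
  "x \<in> rectangle d A B \<longleftrightarrow> x \<in> extensional {..<d} \<and> (\<forall>i<d. A i \<le> x i \<and> x i \<le> B i)"
  by (simp add: rectangle_def PiE_iff) blast

lemma PiE_UNIV_ext: "PiE I (\<lambda>_. UNIV) = extensional I"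
  by (auto simp: PiE_def)

lemma sets_leb_rectangles: "sets (leb d) = sigma_sets (space (leb d)) (range (\<lambda>(A, B). rectangle d A B))"
proof -
  define \<E> where "\<E> = range (\<lambda>(a, b). {a..b :: real})"
  have "sets (leb d) = sets (PiM {..<d} (\<lambda>_. sigma UNIV \<E>))"
    by (intro sets_PiM_cong refl) (simp add: \<E>_def borel_eq_atLeastAtMost[symmetric])
  also have "\<dots> = sets (sigma (PiE {..<d} (\<lambda>_. UNIV :: real set))
      {{f \<in> PiE {..<d} (\<lambda>_. UNIV :: real set). \<forall>i\<in>j. f i \<in> A i} | A j. j \<in> {{..<d}} \<and> A \<in> Pi j (\<lambda>_. \<E>)})"
  proof (rule sets_PiM_sigma)
    show "\<exists>S\<subseteq>\<E>. countable S \<and> UNIV = \<Union>S"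
    proof (intro exI[of _ "range (\<lambda>n::nat. {- real n..real n})"] conjI)
      show "range (\<lambda>n::nat. {- real n..real n}) \<subseteq> \<E>" by (auto simp: \<E>_def)
      have "\<exists>n::nat. x \<in> {- real n..real n}" for x :: real
      proof -
        obtain n :: nat where "\<bar>x\<bar> \<le> real n" using real_arch_simple by blast
        then show ?thesis by (intro exI[of _ n]) auto
      qed
      then show "(UNIV :: real set) = (\<Union>n. {- real n..real n})" by auto
    qed auto
  qed auto
  also have "{{f \<in> PiE {..<d} (\<lambda>_. UNIV :: real set). \<forall>i\<in>j. f i \<in> A i} | A j. j \<in> {{..<d}} \<and> A \<in> Pi j (\<lambda>_. \<E>)}
    = range (\<lambda>(A, B). rectangle d A B)" (is "?L = ?R")
  proof (intro equalityI subsetI)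
    fix X assume "X \<in> ?L"
    then obtain A where A: "\<And>i. i < d \<Longrightarrow> A i \<in> \<E>" and X: "X = {f \<in> PiE {..<d} (\<lambda>_. UNIV :: real set). \<forall>i<d. f i \<in> A i}"
      by auto
    from A have "\<exists>p. A i = {fst p..snd p}" if "i < d" for i using that by (force simp: \<E>_def)
    then obtain p where p: "\<And>i. i < d \<Longrightarrow> A i = {fst (p i)..snd (p i)}" by metis
    have "X = rectangle d (\<lambda>i. fst (p i)) (\<lambda>i. snd (p i))"
      using p by (auto simp: X mem_rectangle_iff PiE_UNIV_ext)
    then show "X \<in> ?R" by auto
  next
    fix X assume "X \<in> ?R"
    then obtain A B where X: "X = rectangle d A B" by auto
    then have 1: "X = {f \<in> PiE {..<d} (\<lambda>_. UNIV :: real set). \<forall>i\<in>{..<d}. f i \<in> {A i..B i}}"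
      by (auto simp: mem_rectangle_iff PiE_UNIV_ext)
    have 2: "(\<lambda>i. {A i..B i}) \<in> Pi {..<d} (\<lambda>_. \<E>)" by (auto simp: \<E>_def)
    show "X \<in> ?L"
      by (intro CollectI exI[of _ "\<lambda>i. {A i..B i}"] exI[of _ "{..<d}"] conjI 1 2 singletonI)
  qed
  also have "sets (sigma (PiE {..<d} (\<lambda>_. UNIV :: real set)) (range (\<lambda>(A, B). rectangle d A B)))
    = sigma_sets (PiE {..<d} (\<lambda>_. UNIV :: real set)) (range (\<lambda>(A, B). rectangle d A B))"
    by (rule sets_measure_of) (auto simp: mem_rectangle_iff PiE_UNIV_ext)
  finally show ?thesis by (simp add: space_leb PiE_UNIV_ext)
qed

lemma nn_integral_pos_neg_eq:
  fixes k :: "'a \<Rightarrow> real"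
  assumes "integrable M k" "integral\<^sup>L M k = 0"
  shows "(\<integral>\<^sup>+x. ennreal (k x) \<partial>M) = (\<integral>\<^sup>+x. ennreal (- k x) \<partial>M)" "(\<integral>\<^sup>+x. ennreal (k x) \<partial>M) < \<infinity>"
proof -
  have "(\<integral>\<^sup>+x. ennreal (norm (k x)) \<partial>M) < \<infinity>" using assms by (simp add: integrable_iff_bounded)
  then have p: "(\<integral>\<^sup>+x. ennreal (k x) \<partial>M) < \<infinity>" and n: "(\<integral>\<^sup>+x. ennreal (- k x) \<partial>M) < \<infinity>"
    by (auto elim!: le_less_trans[rotated] intro!: nn_integral_mono ennreal_leI)
  have "enn2real (\<integral>\<^sup>+x. ennreal (k x) \<partial>M) = enn2real (\<integral>\<^sup>+x. ennreal (- k x) \<partial>M)"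
    using assms real_lebesgue_integral_def[OF assms(1)] by simp
  then show "(\<integral>\<^sup>+x. ennreal (k x) \<partial>M) = (\<integral>\<^sup>+x. ennreal (- k x) \<partial>M)"
    using p n by (metis ennreal_enn2real infinity_ennreal_def)
  show "(\<integral>\<^sup>+x. ennreal (k x) \<partial>M) < \<infinity>" by (rule p)
qed

text \<open>The positive and the negative part of \<open>h\<close> are densities of two measures
  that agree on rectangles, an intersection-stable generator, hence everywhere; and densities are
  unique almost everywhere.\<close>

lemma AE_zero_of_rectangle_integrals_real:
  fixes h :: "(nat \<Rightarrow> real) \<Rightarrow> real"
  assumes [measurable]: "h \<in> borel_measurable (leb d)"
    and int: "\<And>A B. integrable (leb d) (\<lambda>x. indicator (rectangle d A B) x * h x)"
    and zero: "\<And>A B. (\<integral>x. indicator (rectangle d A B) x * h x \<partial>leb d) = 0"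
  shows "AE x in leb d. h x = 0"
proof -
  \<comment> \<open>Negative values become \<open>0\<close> under \<open>ennreal\<close>, so the
    densities are the positive and the negative part of \<open>h\<close>.\<close>
  let ?P = "density (leb d) (\<lambda>x. ennreal (h x))" and ?N = "density (leb d) (\<lambda>x. ennreal (- h x))"
  have P: "emeasure ?P (rectangle d A B) = (\<integral>\<^sup>+x. ennreal (indicator (rectangle d A B) x * h x) \<partial>leb d)" for A B
    by (subst emeasure_density) (auto intro!: nn_integral_cong simp: indicator_def)
  have N: "emeasure ?N (rectangle d A B) = (\<integral>\<^sup>+x. ennreal (- (indicator (rectangle d A B) x * h x)) \<partial>leb d)" for A B
    by (subst emeasure_density) (auto intro!: nn_integral_cong simp: indicator_def)
  have "?P = ?N"
  proof (rule measure_eqI_generator_eq[where E = "range (\<lambda>(A, B). rectangle d A B)" and \<Omega> = "space (leb d)"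
      and A = "\<lambda>n::nat. rectangle d (\<lambda>_. - real n) (\<lambda>_. real n)"])
    show "Int_stable (range (\<lambda>(A, B). rectangle d A B))"
    proof (rule Int_stableI)
      fix X Y assume "X \<in> range (\<lambda>(A, B). rectangle d A B)" "Y \<in> range (\<lambda>(A, B). rectangle d A B)"
      then obtain A B A' B' where XY: "X = rectangle d A B" "Y = rectangle d A' B'" by auto
      have "X \<inter> Y = rectangle d (\<lambda>i. max (A i) (A' i)) (\<lambda>i. min (B i) (B' i))"
        by (auto simp: XY mem_rectangle_iff)
      then show "X \<inter> Y \<in> range (\<lambda>(A, B). rectangle d A B)" by auto
    qed
    show "range (\<lambda>(A, B). rectangle d A B) \<subseteq> Pow (space (leb d))"
      by (auto simp: mem_rectangle_iff space_leb)
    show "emeasure ?P X = emeasure ?N X" if "X \<in> range (\<lambda>(A, B). rectangle d A B)" for X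
    proof -
      from that obtain A B where "X = rectangle d A B" by auto
      then show ?thesis by (simp only: P N nn_integral_pos_neg_eq(1)[OF int zero])
    qed
    have "emeasure ?P (rectangle d (\<lambda>_. - real n) (\<lambda>_. real n)) < \<infinity>" for n
      unfolding P by (rule nn_integral_pos_neg_eq(2)[OF int zero])
    then show "emeasure ?P (rectangle d (\<lambda>_. - real n) (\<lambda>_. real n)) \<noteq> \<infinity>" for n
      by (simp add: less_top)
    show "(\<Union>n. rectangle d (\<lambda>_. - real n) (\<lambda>_. real n)) = space (leb d)"
    proof (intro equalityI subsetI)
      fix x assume x: "x \<in> space (leb d)"
      obtain n :: nat where n: "(\<Sum>i<d. \<bar>x i\<bar>) \<le> real n" using real_arch_simple by blast
      have xn: "\<bar>x i\<bar> \<le> real n" if "i < d" for i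
        using member_le_sum[of i "{..<d}" "\<lambda>i. \<bar>x i\<bar>"] that n by auto
      then have "x \<in> rectangle d (\<lambda>_. - real n) (\<lambda>_. real n)"
        using x xn by (auto simp: mem_rectangle_iff space_leb abs_le_iff minus_le_iff)
      then show "x \<in> (\<Union>n. rectangle d (\<lambda>_. - real n) (\<lambda>_. real n))" by blast
    qed (auto simp: mem_rectangle_iff space_leb)
  qed (auto simp: sets_leb_rectangles)
  then have "AE x in leb d. ennreal (h x) = ennreal (- h x)"
    by (intro leb.density_unique) auto
  then show ?thesis
  proof eventually_elim
    case (elim x)
    show ?case
    proof (cases "h x \<ge> 0")
      case True
      then have "ennreal (h x) = 0" using elim by (simp add: ennreal_neg)
      then show ?thesis using True by simp
    next
      case False
      then have "ennreal (- h x) = 0" using elim by (simp add: ennreal_neg)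
      then show ?thesis using False by simp
    qed
  qed
qed

lemma AE_eq_of_rectangle_integrals:
  fixes f u :: "(nat \<Rightarrow> real) \<Rightarrow> complex"
  assumes [measurable]: "f \<in> borel_measurable (leb d)" "u \<in> borel_measurable (leb d)"
    and f: "\<And>A B. integrable (leb d) (\<lambda>x. indicator (rectangle d A B) x *\<^sub>R f x)"
    and u: "\<And>A B. integrable (leb d) (\<lambda>x. indicator (rectangle d A B) x *\<^sub>R u x)"
    and eq: "\<And>A B. (\<integral>x. indicator (rectangle d A B) x *\<^sub>R f x \<partial>leb d) = (\<integral>x. indicator (rectangle d A B) x *\<^sub>R u x \<partial>leb d)"
  shows "AE x in leb d. f x = u x"
proof -
  have int: "integrable (leb d) (\<lambda>x. indicator (rectangle d A B) x *\<^sub>R (f x - u x))" for A B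
    using Bochner_Integration.integrable_diff[OF f u, of A B A B] by (simp add: scaleR_diff_right)
  have zero: "(\<integral>x. indicator (rectangle d A B) x *\<^sub>R (f x - u x) \<partial>leb d) = 0" for A B
    using Bochner_Integration.integral_diff[OF f u, of A B A B] eq[of A B] by (simp add: scaleR_diff_right)
  have "AE x in leb d. Re (f x - u x) = 0"
  proof (rule AE_zero_of_rectangle_integrals_real)
    fix A B
    show "integrable (leb d) (\<lambda>x. indicator (rectangle d A B) x * Re (f x - u x))"
      using integrable_Re[OF int[of A B]] by simp
    show "(\<integral>x. indicator (rectangle d A B) x * Re (f x - u x) \<partial>leb d) = 0"
      using integral_Re[OF int[of A B]] zero[of A B] by simp
  qed measurable
  moreover have "AE x in leb d. Im (f x - u x) = 0"
  proof (rule AE_zero_of_rectangle_integrals_real)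
    fix A B
    show "integrable (leb d) (\<lambda>x. indicator (rectangle d A B) x * Im (f x - u x))"
      using integrable_Im[OF int[of A B]] by simp
    show "(\<integral>x. indicator (rectangle d A B) x * Im (f x - u x) \<partial>leb d) = 0"
      using integral_Im[OF int[of A B]] zero[of A B] by simp
  qed measurable
  ultimately show ?thesis by eventually_elim (simp add: complex_eq_iff)
qed

section \<open>Fourier inversion\<close>

text \<open>The damped inversion integrals of \<open>g\<close> are Gaussian smoothings of
  \<open>f\<close>. Integrated over a rectangle they converge to the integral of the inversion
  integral, by dominated convergence, and to that of \<open>f\<close>, by smoothing the rectangle.
  Testing in this way avoids any statement on pointwise convergence of the smoothings of
  \<open>f\<close>.\<close>

lemma fourier_inversion:
  assumes ft: "is_fourier_transform d f g" and g1: "integrable (leb d) g"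
  shows "AE x in leb d. f x = inverse_fourier_integral d g x"
proof (rule AE_eq_of_rectangle_integrals)
  let ?u = "inverse_fourier_integral d g"
  have f: "square_integrable (leb d) f" and g: "square_integrable (leb d) g"
    using ft by (auto simp: is_fourier_transform_def)
  show [measurable]: "f \<in> borel_measurable (leb d)" using f by (simp add: square_integrable_def)
  have [measurable]: "g \<in> borel_measurable (leb d)" using g1 by simp
  show [measurable]: "?u \<in> borel_measurable (leb d)" by measurable
  fix A B :: "nat \<Rightarrow> real"
  let ?I = "indicator (rectangle d A B) :: _ \<Rightarrow> real"
  have Ii: "integrable (leb d) ?I" using emeasure_rectangle_finite by (simp add: integrable_indicator_iff)
  define L where "L = (\<integral>\<xi>. norm (g \<xi>) \<partial>leb d)"
  have bound_int: "integrable (leb d) (\<lambda>x. ?I x *\<^sub>R L)" using Ii by (rule integrable_scaleR_left)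
  show "integrable (leb d) (\<lambda>x. ?I x *\<^sub>R f x)"
  proof (rule Bochner_Integration.integrable_bound)
    show "integrable (leb d) (\<lambda>x. ?I x + (norm (f x))\<^sup>2)"
      using Ii f by (auto simp: square_integrable_def)
    have "norm (f x) \<le> 1 + (norm (f x))\<^sup>2" for x
      using sum_squares_bound[of 1 "norm (f x)"] norm_ge_zero[of "f x"] unfolding one_power2 mult_1_right by linarith
    then have "norm (?I x *\<^sub>R f x) \<le> norm (?I x + (norm (f x))\<^sup>2)" for x
      by (simp add: indicator_def)
    then show "AE x in leb d. norm (?I x *\<^sub>R f x) \<le> norm (?I x + (norm (f x))\<^sup>2)" by simp
  qed measurable
  have uL: "norm (?u x) \<le> L" for x unfolding L_def by (rule inverse_fourier_bound[OF g1])
  show "integrable (leb d) (\<lambda>x. ?I x *\<^sub>R ?u x)"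
    by (rule Bochner_Integration.integrable_bound[OF bound_int]) (use order.trans[OF uL abs_ge_self] in \<open>auto simp: indicator_def\<close>)
  let ?e = "\<lambda>n. 1 / real (Suc n)"
  have e0: "?e \<longlonglongrightarrow> 0" by (rule LIMSEQ_Suc[OF lim_1_over_n])
  let ?k = "\<lambda>n a \<xi>. complex_of_real (gauss_weight d (?e n) \<xi>) * wave d \<xi> a"
  have lim: "(\<lambda>n. gauss_weight d (?e n) x) \<longlonglongrightarrow> 1" for x
  proof -
    have "(\<lambda>n. \<Prod>i<d. exp (- (?e n * x i)\<^sup>2 / 2)) \<longlonglongrightarrow> (\<Prod>i<d. exp (- (0 * x i)\<^sup>2 / 2))"
      by (intro tendsto_intros e0) auto
    then show ?thesis by (simp add: gauss_weight_def)
  qed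
  have ptw: "(\<lambda>n. \<integral>\<xi>. g \<xi> * ?k n a \<xi> \<partial>leb d) \<longlonglongrightarrow> ?u a" for a
    unfolding inverse_fourier_integral_def
  proof (rule integral_dominated_convergence[where w = "\<lambda>\<xi>. norm (g \<xi>)"])
    show "AE \<xi> in leb d. (\<lambda>n. g \<xi> * ?k n a \<xi>) \<longlonglongrightarrow> g \<xi> * wave d \<xi> a"
    proof (rule AE_I2)
      fix \<xi>
      have "(\<lambda>n. g \<xi> * ?k n a \<xi>) \<longlonglongrightarrow> g \<xi> * (complex_of_real 1 * wave d \<xi> a)"
        by (intro tendsto_intros lim)
      then show "(\<lambda>n. g \<xi> * ?k n a \<xi>) \<longlonglongrightarrow> g \<xi> * wave d \<xi> a" by simp
    qed
    show "AE \<xi> in leb d. norm (g \<xi> * ?k n a \<xi>) \<le> norm (g \<xi>)" for n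
      by (intro AE_I2) (simp add: norm_mult mult_left_le gauss_weight_bounds(2) del: of_nat_Suc)
    show "integrable (leb d) (\<lambda>\<xi>. norm (g \<xi>))" by (rule integrable_norm[OF g1])
  qed measurable
  have kbound: "norm (\<integral>\<xi>. g \<xi> * ?k n a \<xi> \<partial>leb d) \<le> L" for n a
  proof -
    have "norm (\<integral>\<xi>. g \<xi> * ?k n a \<xi> \<partial>leb d) \<le> (\<integral>\<xi>. norm (g \<xi> * ?k n a \<xi>) \<partial>leb d)"
      by (rule integral_norm_bound)
    also have "\<dots> \<le> L" unfolding L_def
    proof (rule integral_mono)
      show "integrable (leb d) (\<lambda>\<xi>. norm (g \<xi> * ?k n a \<xi>))"
        by (rule Bochner_Integration.integrable_bound[OF g1])
          (auto simp: norm_mult mult_left_le gauss_weight_bounds(2) simp del: of_nat_Suc)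
      show "norm (g \<xi> * ?k n a \<xi>) \<le> norm (g \<xi>)" for \<xi>
        by (simp add: norm_mult mult_left_le gauss_weight_bounds(2) del: of_nat_Suc)
    qed (rule integrable_norm[OF g1])
    finally show ?thesis .
  qed
  have "(\<lambda>n. \<integral>a. ?I a *\<^sub>R (\<integral>\<xi>. g \<xi> * ?k n a \<xi> \<partial>leb d) \<partial>leb d) \<longlonglongrightarrow> (\<integral>a. ?I a *\<^sub>R ?u a \<partial>leb d)"
  proof (rule integral_dominated_convergence[OF _ _ bound_int])
    show "(\<lambda>a. ?I a *\<^sub>R (\<integral>\<xi>. g \<xi> * ?k n a \<xi> \<partial>leb d)) \<in> borel_measurable (leb d)" for n
      by (intro borel_measurable_scaleR leb.borel_measurable_lebesgue_integral) measurable
    show "AE a in leb d. (\<lambda>n. ?I a *\<^sub>R (\<integral>\<xi>. g \<xi> * ?k n a \<xi> \<partial>leb d)) \<longlonglongrightarrow> ?I a *\<^sub>R ?u a"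
      by (intro AE_I2 tendsto_scaleR tendsto_const ptw)
    show "AE a in leb d. norm (?I a *\<^sub>R (\<integral>\<xi>. g \<xi> * ?k n a \<xi> \<partial>leb d)) \<le> ?I a *\<^sub>R L" for n
      using kbound[of n] by (intro AE_I2) (simp add: indicator_def del: of_nat_Suc)
  qed measurable
  moreover have gf: "(\<integral>\<xi>. g \<xi> * ?k n a \<xi> \<partial>leb d) = (\<integral>t. f t * complex_of_real (gauss_kernel d (?e n) a t) \<partial>leb d)" for n a
    by (rule gauss_fourier_transform[OF ft]) simp
  have "(\<lambda>n. \<integral>a. ?I a *\<^sub>R (\<integral>\<xi>. g \<xi> * ?k n a \<xi> \<partial>leb d) \<partial>leb d) \<longlonglongrightarrow> (\<integral>t. ?I t *\<^sub>R f t \<partial>leb d)"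
    unfolding gf by (rule smoothed_rectangle_integral_tendsto[OF f _ _ e0]) auto
  ultimately show "(\<integral>x. ?I x *\<^sub>R f x \<partial>leb d) = (\<integral>x. ?I x *\<^sub>R ?u x \<partial>leb d)"
    by (rule LIMSEQ_unique[rotated])
qed

section \<open>Derivatives and moments\<close>

lemma has_vector_derivativeI_quadratic:
  fixes F :: "real \<Rightarrow> 'a::real_normed_vector"
  assumes "\<And>s. norm (F s - F t - (s - t) *\<^sub>R D) \<le> C * (s - t)\<^sup>2"
  shows "(F has_vector_derivative D) (at t)"
  unfolding has_vector_derivative_def has_derivative_within
proof
  show "bounded_linear (\<lambda>h. h *\<^sub>R D)" by (rule bounded_linear_scaleR_left)
  show "((\<lambda>s. (1 / norm (s - t)) *\<^sub>R (F s - (F t + (s - t) *\<^sub>R D))) \<longlongrightarrow> 0) (at t)"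
  proof (rule Lim_null_comparison)
    show "\<forall>\<^sub>F s in at t. norm ((1 / norm (s - t)) *\<^sub>R (F s - (F t + (s - t) *\<^sub>R D))) \<le> C * \<bar>s - t\<bar>"
      unfolding eventually_at_topological
    proof (intro exI[of _ UNIV] conjI ballI impI)
      fix s assume "s \<noteq> t"
      then have "norm (F s - (F t + (s - t) *\<^sub>R D)) / \<bar>s - t\<bar> \<le> C * (s - t)\<^sup>2 / \<bar>s - t\<bar>"
        using assms[of s] by (intro divide_right_mono) (auto simp: algebra_simps)
      also have "\<dots> = C * \<bar>s - t\<bar>"
      proof -
        have sq: "(s - t)\<^sup>2 = \<bar>s - t\<bar> * \<bar>s - t\<bar>" by (simp add: power2_eq_square)
        have c: "C * (y * y) / y = C * y" if "y \<noteq> 0" for y using that by simp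
        show ?thesis unfolding sq by (rule c) (use \<open>s \<noteq> t\<close> in simp)
      qed
      finally show "norm ((1 / norm (s - t)) *\<^sub>R (F s - (F t + (s - t) *\<^sub>R D))) \<le> C * \<bar>s - t\<bar>"
        by simp
    qed auto
    show "((\<lambda>s. C * \<bar>s - t\<bar>) \<longlongrightarrow> 0) (at t)"
      by (auto intro!: tendsto_eq_intros)
  qed
qed

lemma wave_fun_upd:
  assumes "i < d"
  shows "wave d \<xi> (x(i := s)) = wave d \<xi> (x(i := t)) * cis (2 * pi * \<xi> i * (s - t))"
proof -
  have *: "dot d \<xi> (x(i := s)) = dot d \<xi> (x(i := t)) + \<xi> i * (s - t)"
  proof -
    have "dot d \<xi> (x(i := r)) = \<xi> i * r + (\<Sum>j\<in>{..<d} - {i}. \<xi> j * x j)" for r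
      unfolding dot_def using assms by (subst sum.remove[of _ i]) (auto intro!: sum.cong)
    then show ?thesis by (simp add: algebra_simps)
  qed
  show ?thesis unfolding wave_def * cis_mult by (simp only: distrib_left mult.assoc)
qed

lemma norm_cis_remainder: "norm (cis b - 1 - \<i> * b) \<le> b\<^sup>2"
proof -
  have "norm (iexp b - (\<Sum>k\<le>1. (\<i> * b) ^ k / fact k)) \<le> \<bar>b\<bar> ^ Suc 1 / fact (Suc 1)" by (rule iexp_approx1)
  then have "norm (cis b - 1 - \<i> * b) \<le> b\<^sup>2 / 2"
    by (simp add: cis_conv_exp power2_eq_square abs_mult_self_eq algebra_simps)
  then show ?thesis using zero_le_power2[of b] by linarith
qed

text \<open>With a finite second moment the Taylor remainder of the wave can be integrated, which
  gives an error quadratic in \<open>s - t\<close> and spares an exchange of limits. In the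
  application all moments are finite.\<close>

lemma inverse_fourier_has_derivative:
  assumes i: "i < d"
    and G: "integrable (leb d) G" "integrable (leb d) (\<lambda>\<xi>. 2 * pi * \<i> * \<xi> i * G \<xi>)"
      "integrable (leb d) (\<lambda>\<xi>. (2 * pi * \<i> * \<xi> i)\<^sup>2 * G \<xi>)"
  shows "((\<lambda>t. inverse_fourier_integral d G (x(i := t))) has_vector_derivative
    inverse_fourier_integral d (\<lambda>\<xi>. 2 * pi * \<i> * \<xi> i * G \<xi>) (x(i := t))) (at t)"
proof (rule has_vector_derivativeI_quadratic)
  fix s
  let ?x = "x(i := t)"
  let ?b = "\<lambda>\<xi>. 2 * pi * \<xi> i * (s - t)"
  have int: "integrable (leb d) (\<lambda>\<xi>. G \<xi> * wave d \<xi> (x(i := s)))"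
    "integrable (leb d) (\<lambda>\<xi>. G \<xi> * wave d \<xi> ?x)"
    "integrable (leb d) (\<lambda>\<xi>. (s - t) *\<^sub>R ((2 * pi * \<i> * \<xi> i * G \<xi>) * wave d \<xi> ?x))"
    by (intro integrable_mult_wave integrable_scaleR_right G)+
  have eq: "inverse_fourier_integral d G (x(i := s)) - inverse_fourier_integral d G ?x
      - (s - t) *\<^sub>R inverse_fourier_integral d (\<lambda>\<xi>. 2 * pi * \<i> * \<xi> i * G \<xi>) ?x
    = (\<integral>\<xi>. G \<xi> * wave d \<xi> (x(i := s)) - G \<xi> * wave d \<xi> ?x
      - (s - t) *\<^sub>R ((2 * pi * \<i> * \<xi> i * G \<xi>) * wave d \<xi> ?x) \<partial>leb d)"
    unfolding inverse_fourier_integral_def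
    by (simp only: Bochner_Integration.integral_diff[OF Bochner_Integration.integrable_diff[OF int(1,2)] int(3)]
        Bochner_Integration.integral_diff[OF int(1,2)] integral_scaleR_right)
  have "norm (inverse_fourier_integral d G (x(i := s)) - inverse_fourier_integral d G ?x
      - (s - t) *\<^sub>R inverse_fourier_integral d (\<lambda>\<xi>. 2 * pi * \<i> * \<xi> i * G \<xi>) ?x)
    \<le> (\<integral>\<xi>. norm (G \<xi> * wave d \<xi> (x(i := s)) - G \<xi> * wave d \<xi> ?x
      - (s - t) *\<^sub>R ((2 * pi * \<i> * \<xi> i * G \<xi>) * wave d \<xi> ?x)) \<partial>leb d)"
    unfolding eq by (rule integral_norm_bound)
  also have "\<dots> \<le> (\<integral>\<xi>. norm ((2 * pi * \<i> * \<xi> i)\<^sup>2 * G \<xi>) * (s - t)\<^sup>2 \<partial>leb d)"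
  proof (rule integral_mono)
    show "integrable (leb d) (\<lambda>\<xi>. norm (G \<xi> * wave d \<xi> (x(i := s)) - G \<xi> * wave d \<xi> ?x
      - (s - t) *\<^sub>R ((2 * pi * \<i> * \<xi> i * G \<xi>) * wave d \<xi> ?x)))"
      by (intro integrable_norm Bochner_Integration.integrable_diff int)
    show "integrable (leb d) (\<lambda>\<xi>. norm ((2 * pi * \<i> * \<xi> i)\<^sup>2 * G \<xi>) * (s - t)\<^sup>2)"
      by (intro integrable_mult_left integrable_norm G)
    fix \<xi>
    have "G \<xi> * wave d \<xi> (x(i := s)) - G \<xi> * wave d \<xi> ?x - (s - t) *\<^sub>R ((2 * pi * \<i> * \<xi> i * G \<xi>) * wave d \<xi> ?x)
      = (G \<xi> * wave d \<xi> ?x) * (cis (?b \<xi>) - 1 - \<i> * ?b \<xi>)"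
      unfolding wave_fun_upd[OF i, of \<xi> x s t] by (simp add: scaleR_conv_of_real algebra_simps)
    then have "norm (G \<xi> * wave d \<xi> (x(i := s)) - G \<xi> * wave d \<xi> ?x - (s - t) *\<^sub>R ((2 * pi * \<i> * \<xi> i * G \<xi>) * wave d \<xi> ?x))
      = norm (G \<xi>) * norm (cis (?b \<xi>) - 1 - \<i> * ?b \<xi>)" by (simp only: norm_mult norm_wave mult_1_right)
    also have "\<dots> \<le> norm (G \<xi>) * (?b \<xi>)\<^sup>2" by (intro mult_left_mono norm_cis_remainder) simp
    also have "\<dots> = norm ((2 * pi * \<i> * \<xi> i)\<^sup>2 * G \<xi>) * (s - t)\<^sup>2"
      by (simp add: norm_mult norm_power power_mult_distrib)
    finally show "norm (G \<xi> * wave d \<xi> (x(i := s)) - G \<xi> * wave d \<xi> ?x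
      - (s - t) *\<^sub>R ((2 * pi * \<i> * \<xi> i * G \<xi>) * wave d \<xi> ?x)) \<le> norm ((2 * pi * \<i> * \<xi> i)\<^sup>2 * G \<xi>) * (s - t)\<^sup>2" .
  qed
  finally show "norm (inverse_fourier_integral d G (x(i := s)) - inverse_fourier_integral d G ?x
      - (s - t) *\<^sub>R inverse_fourier_integral d (\<lambda>\<xi>. 2 * pi * \<i> * \<xi> i * G \<xi>) ?x)
    \<le> (\<integral>\<xi>. norm ((2 * pi * \<i> * \<xi> i)\<^sup>2 * G \<xi>) \<partial>leb d) * (s - t)\<^sup>2"
    by simp
qed


text \<open>The Fourier multiplier of the partial derivative with multi-index
  \<open>\<alpha>\<close>, a function of which only the values below \<open>d\<close> count.\<close>

definition symbol :: "nat \<Rightarrow> (nat \<Rightarrow> nat) \<Rightarrow> (nat \<Rightarrow> real) \<Rightarrow> complex" where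
  "symbol d \<alpha> \<xi> = (\<Prod>j<d. (2 * pi * \<i> * \<xi> j) ^ \<alpha> j)"

lemma symbol_measurable [measurable]: "symbol d \<alpha> \<in> borel_measurable (leb d)"
  unfolding symbol_def[abs_def] by measurable

lemma symbol_zero [simp]: "symbol d (\<lambda>_. 0) \<xi> = 1"
  by (simp add: symbol_def)

lemma symbol_Suc:
  assumes "i < d"
  shows "symbol d (\<alpha>(i := Suc (\<alpha> i))) \<xi> = 2 * pi * \<i> * \<xi> i * symbol d \<alpha> \<xi>"
proof -
  have "symbol d \<beta> \<xi> = (2 * pi * \<i> * \<xi> i) ^ \<beta> i * (\<Prod>j\<in>{..<d} - {i}. (2 * pi * \<i> * \<xi> j) ^ \<beta> j)" for \<beta>
    unfolding symbol_def using assms by (subst prod.remove[of _ i]) auto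
  note * = this
  show ?thesis by (subst (1 2) *) (simp add: mult_ac)
qed

lemma abs_le_L2_set: "(i::nat) < d \<Longrightarrow> \<bar>\<xi> i\<bar> \<le> L2_set \<xi> {..<d}"
  unfolding L2_set_def using member_le_sum[of i "{..<d}" "\<lambda>j. (\<xi> j)\<^sup>2"]
  by (intro real_le_rsqrt) simp

lemma norm_symbol_le: "norm (symbol d \<alpha> \<xi>) \<le> (2 * pi * L2_set \<xi> {..<d}) ^ (\<Sum>j<d. \<alpha> j)"
proof -
  have "norm (symbol d \<alpha> \<xi>) = (\<Prod>j<d. (2 * pi * \<bar>\<xi> j\<bar>) ^ \<alpha> j)"
    by (simp add: symbol_def prod_norm[symmetric] norm_power norm_mult)
  also have "\<dots> \<le> (\<Prod>j<d. (2 * pi * L2_set \<xi> {..<d}) ^ \<alpha> j)"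
    by (intro prod_mono conjI power_mono mult_left_mono abs_le_L2_set) auto
  finally show ?thesis by (simp add: power_sum)
qed

lemma L2_set_measurable [measurable]: "(\<lambda>\<xi>. L2_set \<xi> {..<d}) \<in> borel_measurable (leb d)"
  unfolding L2_set_def by measurable

lemma one_plus_power_le:
  fixes a :: real
  assumes "a \<ge> 0"
  shows "(1 + a) ^ n \<le> 2 ^ n * (1 + a ^ n)"
proof (cases "a \<le> 1")
  case True
  then have "(1 + a) ^ n \<le> 2 ^ n" using assms by (intro power_mono) auto
  also have "\<dots> \<le> 2 ^ n * (1 + a ^ n)" using assms by simp
  finally show ?thesis .
next
  case False
  then have "(1 + a) ^ n \<le> (2 * a) ^ n" by (intro power_mono) auto
  also have "\<dots> \<le> 2 ^ n * (1 + a ^ n)" by (simp add: power_mult_distrib)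
  finally show ?thesis .
qed

text \<open>With \<open>q\<close> the product of the \<open>1 + (\<xi> j)\<^sup>2\<close>, the
  function \<open>1 / q\<close> is integrable, and \<open>q\<close> grows at most like a power of
  the norm, so \<open>a * q\<close> is square-integrable by the moments. The inequality
  \<open>a \<le> (a * q)\<^sup>2 + 1 / q\<close>, immediate for \<open>a * q \<le> 1\<close> and for
  \<open>a * q > 1\<close>, combines the two.\<close>

lemma integrable_power_mult_of_moments:
  assumes [measurable]: "g \<in> borel_measurable (leb d)"
    and mom: "\<And>n. integrable (leb d) (\<lambda>\<xi>. (L2_set \<xi> {..<d} ^ n * norm (g \<xi>))\<^sup>2)"
  shows "integrable (leb d) (\<lambda>\<xi>. L2_set \<xi> {..<d} ^ m * norm (g \<xi>))"
proof (rule Bochner_Integration.integrable_bound)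
  let ?r = "\<lambda>\<xi>::nat \<Rightarrow> real. L2_set \<xi> {..<d}"
  let ?Q = "\<lambda>\<xi>::nat \<Rightarrow> real. \<Prod>j<d. 1 / (1 + (\<xi> j)\<^sup>2)"
  let ?h = "\<lambda>\<xi>. 2 ^ d * 2 ^ d * 2 * ((?r \<xi> ^ m * norm (g \<xi>))\<^sup>2 + (?r \<xi> ^ (m + 2 * d) * norm (g \<xi>))\<^sup>2) + ?Q \<xi>"
  show "integrable (leb d) ?h"
    by (intro Bochner_Integration.integrable_add integrable_mult_right mom lebesgue_product.product_integrable_prod
        integrable_inverse_square_plus_one finite_lessThan)
  show "AE \<xi> in leb d. norm (?r \<xi> ^ m * norm (g \<xi>)) \<le> norm (?h \<xi>)"
  proof (rule AE_I2)
    fix \<xi> :: "nat \<Rightarrow> real"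
    define q where "q = (\<Prod>j<d. 1 + (\<xi> j)\<^sup>2)"
    have q1: "q \<ge> 1" unfolding q_def by (rule prod_ge_1) simp
    have r0: "?r \<xi> \<ge> 0" by (simp add: L2_set_nonneg)
    have "q \<le> (\<Prod>j<d. 1 + (?r \<xi>)\<^sup>2)" unfolding q_def
    proof (intro prod_mono conjI add_left_mono)
      fix j assume "j \<in> {..<d}"
      then have "\<bar>\<xi> j\<bar>\<^sup>2 \<le> (?r \<xi>)\<^sup>2" by (intro power_mono abs_le_L2_set) auto
      then show "(\<xi> j)\<^sup>2 \<le> (?r \<xi>)\<^sup>2" by simp
    qed simp
    also have "\<dots> = (1 + (?r \<xi>)\<^sup>2) ^ d" by simp
    also have "\<dots> \<le> 2 ^ d * (1 + ((?r \<xi>)\<^sup>2) ^ d)" by (rule one_plus_power_le) simp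
    finally have q2: "q \<le> 2 ^ d * (1 + ?r \<xi> ^ (2 * d))" by (simp add: power_mult)
    define a where "a = ?r \<xi> ^ m * norm (g \<xi>)"
    define b where "b = ?r \<xi> ^ (m + 2 * d) * norm (g \<xi>)"
    have a0: "a \<ge> 0" "b \<ge> 0" using r0 by (auto simp: a_def b_def)
    have aq: "a * q \<le> 2 ^ d * (a + b)"
    proof -
      have "a * q \<le> a * (2 ^ d * (1 + ?r \<xi> ^ (2 * d)))" using q2 a0 by (intro mult_left_mono)
      also have "\<dots> = 2 ^ d * (a + b)" by (simp add: a_def b_def algebra_simps power_add)
      finally show ?thesis .
    qed
    have ab: "(a + b)\<^sup>2 \<le> 2 * (a\<^sup>2 + b\<^sup>2)" using sum_squares_bound[of a b] by (simp add: power2_sum)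
    have aa: "a * a \<le> a * q * a" using q1 a0 mult_left_mono[of 1 q "a * a"] by (simp add: mult_ac)
    have "a \<le> (a * q)\<^sup>2 + 1 / q"
    proof (cases "a * q \<le> 1")
      case True
      then have "a \<le> 1 / q" using q1 by (simp add: field_simps)
      then show ?thesis by (simp add: add_increasing)
    next
      case False
      then have "a * q * 1 \<le> a * q * (a * q)" using a0 q1 by (intro mult_left_mono) auto
      moreover have "a * 1 \<le> a * q" using a0 q1 by (intro mult_left_mono) auto
      moreover have "1 / q \<ge> 0" using q1 by simp
      ultimately show ?thesis unfolding power2_eq_square by linarith
    qed
    also have "(a * q)\<^sup>2 \<le> (2 ^ d * (a + b))\<^sup>2" using aq a0 q1 by (intro power_mono) auto
    also have "\<dots> = 2 ^ d * 2 ^ d * (a + b)\<^sup>2" by (simp add: power2_eq_square mult_ac)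
    also have "\<dots> \<le> 2 ^ d * 2 ^ d * (2 * (a\<^sup>2 + b\<^sup>2))" using ab by (intro mult_left_mono) auto
    also have "\<dots> = 2 ^ d * 2 ^ d * 2 * (a\<^sup>2 + b\<^sup>2)" by (simp only: mult.assoc)
    also have "1 / q = ?Q \<xi>" by (simp add: q_def prod_dividef)
    finally have "a \<le> ?h \<xi>" by (simp only: a_def b_def)
    then show "norm (?r \<xi> ^ m * norm (g \<xi>)) \<le> norm (?h \<xi>)"
      using a0 by (simp add: a_def)
  qed
qed measurable

section \<open>A Sobolev inequality on cubes\<close>

text \<open>The derivative of the squared norm is at most the integrand \<open>k\<close>, so the
  squared norm varies over the interval by at most the integral \<open>M\<close> of
  \<open>k\<close>. Averaging over the interval gives the constant \<open>1 / l + 1\<close>.\<close>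

lemma sobolev_1d:
  fixes h h' :: "real \<Rightarrow> complex"
  assumes der: "\<And>s. (h has_vector_derivative h' s) (at s)" and cont: "\<And>s. isCont h' s"
    and l: "l > 0" and t: "t \<in> {a..a + l}"
  shows "ennreal ((norm (h t))\<^sup>2)
    \<le> ennreal ((1 + l) / l) * (\<integral>\<^sup>+s. (ennreal ((norm (h s))\<^sup>2) + ennreal ((norm (h' s))\<^sup>2)) * indicator {a..a + l} s \<partial>lborel)"
proof -
  define k where "k = (\<lambda>s. (norm (h s))\<^sup>2 + (norm (h' s))\<^sup>2)"
  define q where "q = (\<lambda>s. (norm (h s))\<^sup>2)"
  define q' where "q' = (\<lambda>s. 2 * (h s \<bullet> h' s))"
  let ?I = "indicator {a..a + l} :: real \<Rightarrow> real"
  have conth: "isCont h s" for s using der by (rule has_vector_derivative_continuous)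
  have q: "DERIV q s :> q' s" for s
  proof -
    have "((\<lambda>s. h s \<bullet> h s) has_vector_derivative (h s \<bullet> h' s + h' s \<bullet> h s)) (at s)"
      by (rule bounded_bilinear.has_vector_derivative[OF bounded_bilinear_inner der der])
    then show ?thesis
      by (simp add: q_def q'_def power2_norm_eq_inner has_real_derivative_iff_has_vector_derivative inner_commute)
  qed
  have contq': "isCont q' s" for s unfolding q'_def by (intro continuous_intros conth cont)
  have q'k: "\<bar>q' s\<bar> \<le> k s" for s
  proof -
    have "\<bar>q' s\<bar> \<le> 2 * (norm (h s) * norm (h' s))"
      using Cauchy_Schwarz_ineq2[of "h s" "h' s"] by (simp add: q'_def abs_mult)
    also have "\<dots> \<le> k s" using sum_squares_bound[of "norm (h s)" "norm (h' s)"] by (simp add: k_def)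
    finally show ?thesis .
  qed
  have k0: "k s \<ge> 0" for s by (simp add: k_def)
  have hm [measurable]: "h \<in> borel_measurable borel" "h' \<in> borel_measurable borel"
    using conth cont by (auto intro!: borel_measurable_continuous_onI continuous_at_imp_continuous_on)
  have qm [measurable]: "q \<in> borel_measurable borel" unfolding q_def by measurable
  have km [measurable]: "k \<in> borel_measurable borel" unfolding k_def by measurable
  have kint: "integrable lborel (\<lambda>s. k s * ?I s)"
  proof -
    have "integrable lborel (\<lambda>s. ?I s *\<^sub>R k s)"
      unfolding k_def by (rule borel_integrable_compact[OF compact_Icc])
        (intro continuous_at_imp_continuous_on ballI continuous_intros conth cont)
    then show ?thesis by (simp add: mult.commute)
  qed
  have Iint: "integrable lborel ?I" by (simp add: integrable_indicator_iff emeasure_lborel_Icc_eq)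
  have qint: "integrable lborel (\<lambda>s. q s * ?I s)"
    by (rule Bochner_Integration.integrable_bound[OF kint]) (auto simp: indicator_def q_def k_def)
  define M where "M = (\<integral>s. k s * ?I s \<partial>lborel)"
  have le: "\<bar>\<integral>x. q' x * indicator {u..v} x \<partial>lborel\<bar> \<le> M" if "u \<in> {a..a+l}" "v \<in> {a..a+l}" "u \<le> v" for u v
  proof -
    have "has_bochner_integral lborel (\<lambda>x. q' x * indicator {u..v} x) (q v - q u)"
      using that q contq' by (intro has_bochner_integral_FTC_Icc_real) auto
    then have int: "integrable lborel (\<lambda>x. q' x * indicator {u..v} x)" by (simp add: has_bochner_integral_iff)
    have "\<bar>\<integral>x. q' x * indicator {u..v} x \<partial>lborel\<bar> \<le> (\<integral>x. \<bar>q' x * indicator {u..v} x\<bar> \<partial>lborel)"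
      by (rule integral_abs_bound)
    also have "\<dots> \<le> M" unfolding M_def
    proof (rule integral_mono[OF _ kint])
      show "integrable lborel (\<lambda>x. \<bar>q' x * indicator {u..v} x\<bar>)" using int by (rule integrable_abs)
      show "\<bar>q' x * indicator {u..v} x\<bar> \<le> k x * ?I x" for x
        using q'k[of x] k0[of x] that by (auto simp: indicator_def)
    qed
    finally show ?thesis .
  qed
  have qts: "q t \<le> q s + M" if s: "s \<in> {a..a+l}" for s
  proof (cases "s \<le> t")
    case True
    have "has_bochner_integral lborel (\<lambda>x. q' x * indicator {s..t} x) (q t - q s)"
      using True q contq' by (intro has_bochner_integral_FTC_Icc_real) auto
    then show ?thesis using le[OF s t True] by (simp add: has_bochner_integral_iff)
  next
    case False
    have "has_bochner_integral lborel (\<lambda>x. q' x * indicator {t..s} x) (q s - q t)"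
      using False q contq' by (intro has_bochner_integral_FTC_Icc_real) auto
    then show ?thesis using le[OF t s] False by (simp add: has_bochner_integral_iff)
  qed
  have Mq: "(\<integral>s. q s * ?I s \<partial>lborel) \<le> M" unfolding M_def
    by (rule integral_mono[OF qint kint]) (auto simp: indicator_def q_def k_def)
  have "l * q t = (\<integral>s. q t * ?I s \<partial>lborel)" using l by simp
  also have "\<dots> \<le> (\<integral>s. q s * ?I s + M * ?I s \<partial>lborel)"
  proof (rule integral_mono)
    show "integrable lborel (\<lambda>s. q s * ?I s + M * ?I s)"
      by (intro Bochner_Integration.integrable_add qint integrable_mult_right Iint)
    show "q t * ?I s \<le> q s * ?I s + M * ?I s" for s using qts[of s] by (auto simp: indicator_def)
  qed (intro integrable_mult_right Iint)
  also have "\<dots> = (\<integral>s. q s * ?I s \<partial>lborel) + M * l"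
    using l by (subst Bochner_Integration.integral_add[OF qint integrable_mult_right[OF Iint]]) simp
  also have "\<dots> \<le> (1 + l) * M" using Mq by (simp add: algebra_simps)
  finally have "q t \<le> (1 + l) / l * M" using l by (simp add: field_simps)
  then have "ennreal (q t) \<le> ennreal ((1 + l) / l) * ennreal M"
    using l k0 by (simp add: ennreal_mult[symmetric] ennreal_leI M_def integral_nonneg_AE)
  also have "ennreal M = (\<integral>\<^sup>+s. ennreal (k s * ?I s) \<partial>lborel)"
    unfolding M_def using k0 by (intro nn_integral_eq_integral[symmetric] kint) auto
  also have "\<dots> = (\<integral>\<^sup>+s. (ennreal ((norm (h s))\<^sup>2) + ennreal ((norm (h' s))\<^sup>2)) * indicator {a..a + l} s \<partial>lborel)"
    by (intro nn_integral_cong) (auto simp: indicator_def k_def)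
  finally show ?thesis by (simp add: q_def)
qed

lemma measurable_fix_last [measurable]:
  "(\<lambda>z. z(d := t)) \<in> measurable (leb d) (leb (Suc d))"
proof -
  have "(\<lambda>z. (\<lambda>(y, s). y(d := s)) (z, t)) \<in> measurable (leb d) (leb (Suc d))"
    by (rule measurable_compose[OF _ measurable_add_coordinate]) measurable
  then show ?thesis by simp
qed

lemma nn_integral_cube_Suc:
  assumes [measurable]: "f \<in> borel_measurable (leb (Suc d))"
  shows "(\<integral>\<^sup>+x. f x * indicator (cube (Suc d) a l) x \<partial>leb (Suc d))
    = (\<integral>\<^sup>+z. (\<integral>\<^sup>+s. f (z(d := s)) * indicator {a d..a d + l} s \<partial>lborel) * indicator (cube d a l) z \<partial>leb d)"
proof -
  have "(\<integral>\<^sup>+x. f x * indicator (cube (Suc d) a l) x \<partial>leb (Suc d))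
    = (\<integral>\<^sup>+z. (\<integral>\<^sup>+s. f (z(d := s)) * indicator (cube (Suc d) a l) (z(d := s)) \<partial>lborel) \<partial>leb d)"
    by (rule nn_integral_leb_Suc) measurable
  also have "\<dots> = (\<integral>\<^sup>+z. (\<integral>\<^sup>+s. f (z(d := s)) * indicator {a d..a d + l} s \<partial>lborel) * indicator (cube d a l) z \<partial>leb d)"
  proof (intro nn_integral_cong)
    fix z assume z: "z \<in> space (leb d)"
    show "(\<integral>\<^sup>+s. f (z(d := s)) * indicator (cube (Suc d) a l) (z(d := s)) \<partial>lborel)
      = (\<integral>\<^sup>+s. f (z(d := s)) * indicator {a d..a d + l} s \<partial>lborel) * indicator (cube d a l) z"
    proof (cases "z \<in> cube d a l")
      case True
      have "z(d := s) \<in> cube (Suc d) a l \<longleftrightarrow> s \<in> {a d..a d + l}" for s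
        using fun_upd_in_cube[OF True, of s] fun_upd_in_cubeD[OF z, of s a l] by blast
      then show ?thesis using True by (simp add: indicator_def)
    next
      case False
      then have "z(d := s) \<notin> cube (Suc d) a l" for s using fun_upd_in_cubeD[OF z, of s a l] by blast
      then show ?thesis using False by simp
    qed
  qed
  finally show ?thesis .
qed

text \<open>The index \<open>B\<close> is the set of coordinates in which one derivative has been
  taken: the one-dimensional inequality, applied in every coordinate, produces all mixed derivatives
  of order at most one in each variable. The induction step splits the subsets of
  \<open>{..<Suc d}\<close> according to whether they contain \<open>d\<close>.\<close>

lemma sobolev_cube:
  fixes v :: "nat set \<Rightarrow> (nat \<Rightarrow> real) \<Rightarrow> complex"
  assumes l: "l > 0"
    and "\<And>B. v B \<in> borel_measurable (leb d)"
    and "\<And>B i x t. \<lbrakk>i < d; i \<notin> B; x \<in> extensional {..<d}\<rbrakk> \<Longrightarrow>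
      ((\<lambda>t. v B (x(i := t))) has_vector_derivative v (insert i B) (x(i := t))) (at t)"
    and "\<And>B i x t. \<lbrakk>i < d; x \<in> extensional {..<d}\<rbrakk> \<Longrightarrow> isCont (\<lambda>t. v B (x(i := t))) t"
    and "x \<in> cube d a l"
  shows "ennreal ((norm (v {} x))\<^sup>2) \<le> ennreal ((1 + l) / l) ^ d *
    (\<Sum>B\<in>Pow {..<d}. \<integral>\<^sup>+y. ennreal ((norm (v B y))\<^sup>2) * indicator (cube d a l) y \<partial>leb d)"
  using assms(2-)
proof (induction d arbitrary: v x)
  case 0
  have "leb 0 = count_space {\<lambda>_. undefined}" by (simp add: PiM_empty)
  then show ?case using 0 by (simp add: nn_integral_count_space_finite cube_def)
next
  case (Suc d)
  note [measurable] = Suc.prems(1)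
  let ?C = "ennreal ((1 + l) / l)"
  let ?n = "\<lambda>B y. ennreal ((norm (v B y))\<^sup>2)"
  obtain y t where xy: "x = y(d := t)" "y \<in> cube d a l" "t \<in> {a d..a d + l}"
    using restrict_in_cube[OF Suc.prems(4)] by blast
  have ext: "z(d := s) \<in> extensional {..<Suc d}" if "z \<in> extensional {..<d}" for z s
    using that by (auto simp: extensional_def)
  have "ennreal ((norm (v {} (y(d := t))))\<^sup>2) \<le> ?C ^ d *
    (\<Sum>B\<in>Pow {..<d}. \<integral>\<^sup>+z. ?n B (z(d := t)) * indicator (cube d a l) z \<partial>leb d)"
  proof (rule Suc.IH[where v = "\<lambda>B z. v B (z(d := t))", OF _ _ _ xy(2)])
    show "(\<lambda>z. v B (z(d := t))) \<in> borel_measurable (leb d)" for B by measurable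
    fix B i and z :: "nat \<Rightarrow> real" and s assume i: "i < d" and z: "z \<in> extensional {..<d}"
    have tw: "z(d := t, i := r) = z(i := r, d := t)" for r using i by (auto simp: fun_eq_iff)
    show "isCont (\<lambda>s. v B (z(i := s, d := t))) s"
      unfolding tw[symmetric] by (rule Suc.prems(3)[OF less_SucI[OF i] ext[OF z]])
    assume iB: "i \<notin> B"
    show "((\<lambda>s. v B (z(i := s, d := t))) has_vector_derivative v (insert i B) (z(i := s, d := t))) (at s)"
      unfolding tw[symmetric] by (rule Suc.prems(2)[OF less_SucI[OF i] iB ext[OF z]])
  qed
  also have "\<dots> \<le> ?C ^ d * (\<Sum>B\<in>Pow {..<d}. ?C * ((\<integral>\<^sup>+x. ?n B x * indicator (cube (Suc d) a l) x \<partial>leb (Suc d))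
      + (\<integral>\<^sup>+x. ?n (insert d B) x * indicator (cube (Suc d) a l) x \<partial>leb (Suc d))))"
  proof (intro mult_left_mono sum_mono)
    fix B assume "B \<in> Pow {..<d}"
    then have dB: "d \<notin> B" by auto
    have "(\<integral>\<^sup>+z. ?n B (z(d := t)) * indicator (cube d a l) z \<partial>leb d)
      \<le> (\<integral>\<^sup>+z. ?C * ((\<integral>\<^sup>+s. (?n B (z(d := s)) + ?n (insert d B) (z(d := s))) * indicator {a d..a d + l} s \<partial>lborel) * indicator (cube d a l) z) \<partial>leb d)"
    proof (intro nn_integral_mono)
      fix z assume "z \<in> space (leb d)"
      then have z: "z \<in> extensional {..<d}"
        by (auto simp: space_leb extensional_def)
      have "?n B (z(d := t)) \<le> ?C * (\<integral>\<^sup>+s. (?n B (z(d := s)) + ?n (insert d B) (z(d := s))) * indicator {a d..a d + l} s \<partial>lborel)"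
      proof (rule sobolev_1d[OF _ _ l xy(3), where h = "\<lambda>s. v B (z(d := s))" and h' = "\<lambda>s. v (insert d B) (z(d := s))"])
        show "((\<lambda>s. v B (z(d := s))) has_vector_derivative v (insert d B) (z(d := s))) (at s)" for s
          using Suc.prems(2)[OF lessI dB ext[OF z, of 0], of s] by (simp only: fun_upd_upd)
        show "isCont (\<lambda>s. v (insert d B) (z(d := s))) s" for s
          using Suc.prems(3)[OF lessI ext[OF z, of 0], where B = "insert d B" and t = s] by (simp only: fun_upd_upd)
      qed
      then have "?n B (z(d := t)) * indicator (cube d a l) z
        \<le> (?C * (\<integral>\<^sup>+s. (?n B (z(d := s)) + ?n (insert d B) (z(d := s))) * indicator {a d..a d + l} s \<partial>lborel)) * indicator (cube d a l) z"
        by (rule mult_right_mono) simp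
      then show "?n B (z(d := t)) * indicator (cube d a l) z
        \<le> ?C * ((\<integral>\<^sup>+s. (?n B (z(d := s)) + ?n (insert d B) (z(d := s))) * indicator {a d..a d + l} s \<partial>lborel) * indicator (cube d a l) z)"
        by (simp only: mult.assoc)
    qed
    also have "\<dots> = ?C * (\<integral>\<^sup>+z. ((\<integral>\<^sup>+s. (?n B (z(d := s)) + ?n (insert d B) (z(d := s))) * indicator {a d..a d + l} s \<partial>lborel) * indicator (cube d a l) z) \<partial>leb d)"
    proof (rule nn_integral_cmult)
      have "(\<lambda>z. \<integral>\<^sup>+s. (?n B (z(d := s)) + ?n (insert d B) (z(d := s))) * indicator {a d..a d + l} s \<partial>lborel) \<in> borel_measurable (leb d)"
        by (rule lborel.borel_measurable_nn_integral) measurable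
      then show "(\<lambda>z. (\<integral>\<^sup>+s. (?n B (z(d := s)) + ?n (insert d B) (z(d := s))) * indicator {a d..a d + l} s \<partial>lborel) * indicator (cube d a l) z) \<in> borel_measurable (leb d)"
        by measurable
    qed
    also have "(\<integral>\<^sup>+z. ((\<integral>\<^sup>+s. (?n B (z(d := s)) + ?n (insert d B) (z(d := s))) * indicator {a d..a d + l} s \<partial>lborel) * indicator (cube d a l) z) \<partial>leb d)
      = (\<integral>\<^sup>+x. (?n B x + ?n (insert d B) x) * indicator (cube (Suc d) a l) x \<partial>leb (Suc d))"
      by (rule nn_integral_cube_Suc[symmetric, of "\<lambda>x. ?n B x + ?n (insert d B) x"]) measurable
    also have "\<dots> = (\<integral>\<^sup>+x. ?n B x * indicator (cube (Suc d) a l) x \<partial>leb (Suc d))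
      + (\<integral>\<^sup>+x. ?n (insert d B) x * indicator (cube (Suc d) a l) x \<partial>leb (Suc d))"
      by (simp only: distrib_right) (rule nn_integral_add; measurable)
    finally show "(\<integral>\<^sup>+z. ?n B (z(d := t)) * indicator (cube d a l) z \<partial>leb d) \<le> ?C * ((\<integral>\<^sup>+x. ?n B x * indicator (cube (Suc d) a l) x \<partial>leb (Suc d))
      + (\<integral>\<^sup>+x. ?n (insert d B) x * indicator (cube (Suc d) a l) x \<partial>leb (Suc d)))" .
  qed simp
  also have "\<dots> = ?C ^ Suc d * (\<Sum>B\<in>Pow {..<Suc d}. \<integral>\<^sup>+x. ?n B x * indicator (cube (Suc d) a l) x \<partial>leb (Suc d))"
  proof -
    let ?J = "\<lambda>B. \<integral>\<^sup>+x. ?n B x * indicator (cube (Suc d) a l) x \<partial>leb (Suc d)"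
    have "(\<Sum>B\<in>Pow {..<Suc d}. ?J B) = (\<Sum>B\<in>Pow {..<d}. ?J B) + (\<Sum>B\<in>insert d ` Pow {..<d}. ?J B)"
      unfolding lessThan_Suc Pow_insert by (intro sum.union_disjoint) auto
    also have "(\<Sum>B\<in>insert d ` Pow {..<d}. ?J B) = (\<Sum>B\<in>Pow {..<d}. ?J (insert d B))"
      by (rule sum.reindex_cong[of "insert d"]) (auto simp: inj_on_def)
    finally have "(\<Sum>B\<in>Pow {..<Suc d}. ?J B) = (\<Sum>B\<in>Pow {..<d}. ?J B + ?J (insert d B))"
      by (simp only: sum.distrib)
    then show ?thesis by (simp only: sum_distrib_left[symmetric] power_Suc mult_ac)
  qed
  finally show ?case by (simp only: xy(1))
qed

section \<open>Good and bad cubes\<close>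

text \<open>Chebyshev's inequality on the part of \<open>A\<close> where \<open>h > \<tau>\<close>,
  which keeps at least half of the guaranteed measure.\<close>

lemma small_on_dense_part:
  fixes h :: "(nat \<Rightarrow> real) \<Rightarrow> real"
  assumes [measurable]: "h \<in> borel_measurable (leb d)" "A \<in> sets (leb d)"
    and A: "ennreal \<gamma> \<le> emeasure (leb d) A" "\<gamma> > 0" and \<tau>: "\<tau> \<ge> 0"
    and small: "emeasure (leb d) {x \<in> A. h x \<le> \<tau>} < ennreal (\<gamma> / 2)"
  shows "ennreal (\<tau> * (\<gamma> / 2)) \<le> (\<integral>\<^sup>+x. ennreal (h x) * indicator A x \<partial>leb d)"
proof -
  have As: "A \<subseteq> space (leb d)" using sets.sets_into_space[OF assms(2)] .
  let ?B = "{x \<in> A. h x \<le> \<tau>}" and ?G = "{x \<in> A. h x > \<tau>}"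
  have "?B = A \<inter> {x \<in> space (leb d). h x \<le> \<tau>}" "?G = A \<inter> {x \<in> space (leb d). h x > \<tau>}" using As by auto
  then have [measurable]: "?B \<in> sets (leb d)" "?G \<in> sets (leb d)" by simp_all
  have "A = ?B \<union> ?G" by auto
  then have "ennreal \<gamma> \<le> emeasure (leb d) (?B \<union> ?G)" using A by simp
  also have "\<dots> \<le> emeasure (leb d) ?B + emeasure (leb d) ?G" by (rule emeasure_subadditive) measurable
  also have "\<dots> \<le> ennreal (\<gamma> / 2) + emeasure (leb d) ?G" using small by (intro add_right_mono) simp
  finally have le: "ennreal \<gamma> \<le> ennreal (\<gamma> / 2) + emeasure (leb d) ?G" .
  have G: "ennreal (\<gamma> / 2) \<le> emeasure (leb d) ?G"
  proof (cases "emeasure (leb d) ?G")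
    case (real r)
    then have "ennreal \<gamma> \<le> ennreal (\<gamma> / 2 + r)" using le A by simp
    then have "\<gamma> \<le> \<gamma> / 2 + r" using A real by (subst (asm) ennreal_le_iff) auto
    then show ?thesis using real by (simp add: ennreal_leI)
  qed simp
  have "ennreal (\<tau> * (\<gamma> / 2)) = ennreal \<tau> * ennreal (\<gamma> / 2)" using \<tau> A by (intro ennreal_mult) auto
  also have "\<dots> \<le> ennreal \<tau> * emeasure (leb d) ?G" by (rule mult_left_mono[OF G]) simp
  also have "\<dots> = (\<integral>\<^sup>+x. ennreal \<tau> * indicator ?G x \<partial>leb d)" by (rule nn_integral_cmult_indicator[symmetric]) measurable
  also have "\<dots> \<le> (\<integral>\<^sup>+x. ennreal (h x) * indicator A x \<partial>leb d)"
    by (intro nn_integral_mono) (auto simp: indicator_def intro: ennreal_leI)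
  finally show ?thesis .
qed

text \<open>The argument for a good cube. If \<open>u\<close>, with mass normalised to
  \<open>1\<close>, were small on a part of \<open>E\<close> of measure \<open>\<gamma> / 2\<close>,
  smallness would spread over the cube and leave mass at most \<open>1 / 2\<close>, a contradiction.
  So \<open>u\<close> is not small on most of \<open>E\<close>, and the mass there is bounded
  below.\<close>

lemma cube_comparison:
  fixes \<rho> :: "nat \<Rightarrow> real"
  assumes d: "d \<ge> 1" and \<rho>: "\<And>k. 0 < \<rho> k" "mono \<rho>" "\<not> summable (\<lambda>k. 1 / \<rho> k)"
    and pos: "S > 0" "l > 0" "\<gamma> > 0"
  obtains c where "c > 0" "\<And>a E u U. \<lbrakk>u \<in> borel_measurable (leb d); \<And>i. i < d \<Longrightarrow> U i 0 = u;
      \<And>i n x t. i < d \<Longrightarrow> x \<in> extensional {..<d} \<Longrightarrow>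
        ((\<lambda>t. U i n (x(i := t))) has_vector_derivative U i (Suc n) (x(i := t))) (at t);
      \<And>i n x. i < d \<Longrightarrow> x \<in> cube d a l \<Longrightarrow> ennreal ((norm (U i n x))\<^sup>2)
        \<le> ennreal ((S * (\<Prod>k<n. \<rho> k))\<^sup>2) * (\<integral>\<^sup>+y. ennreal ((norm (u y))\<^sup>2) * indicator (cube d a l) y \<partial>leb d);
      E \<in> sets (leb d); ennreal \<gamma> \<le> emeasure (leb d) (E \<inter> cube d a l);
      (\<integral>\<^sup>+y. ennreal ((norm (u y))\<^sup>2) * indicator (cube d a l) y \<partial>leb d) < \<infinity>\<rbrakk> \<Longrightarrow>
    ennreal c * (\<integral>\<^sup>+y. ennreal ((norm (u y))\<^sup>2) * indicator (cube d a l) y \<partial>leb d)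
      \<le> (\<integral>\<^sup>+y. ennreal ((norm (u y :: complex))\<^sup>2) * indicator (E \<inter> cube d a l) y \<partial>leb d)"
proof -
  \<comment> \<open>If the real and imaginary parts are both at most \<open>\<delta>\<close> on the
    cube, the mass is at most \<open>2 * \<delta>\<^sup>2 * l ^ d = 1 / 2\<close>.\<close>
  define \<delta> where "\<delta> = 1 / (2 * sqrt (l ^ d))"
  have \<delta>: "\<delta> > 0" using pos by (simp add: \<delta>_def)
  have \<delta>2: "\<delta>\<^sup>2 * l ^ d = 1 / 4" using pos by (simp add: \<delta>_def power_divide power_mult_distrib)
  have "\<gamma> / 2 > 0" using pos by simp
  from propagation_cube[OF \<rho> pos(1,2) this \<delta>, of d] obtain \<epsilon> where
    \<epsilon>: "\<epsilon> > 0 \<and> (\<forall>a E D v. (\<forall>i<d. D i 0 = v) \<longrightarrow>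
    (\<forall>i<d. \<forall>n. \<forall>x\<in>extensional {..<d}. \<forall>t. DERIV (\<lambda>t. D i n (x(i := t))) t :> D i (Suc n) (x(i := t))) \<longrightarrow>
    (\<forall>i<d. \<forall>n. \<forall>x\<in>cube d a l. \<bar>D i n x\<bar> \<le> S * (\<Prod>k<n. \<rho> k)) \<longrightarrow>
    E \<in> sets (leb d) \<longrightarrow> E \<subseteq> cube d a l \<longrightarrow> ennreal (\<gamma> / 2) \<le> emeasure (leb d) E \<longrightarrow>
    (\<forall>x\<in>E. \<bar>v x\<bar> \<le> \<epsilon>) \<longrightarrow> (\<forall>x\<in>cube d a l. \<bar>v x\<bar> \<le> \<delta>))" by (rule exE)
  note propag = conjunct2[OF \<epsilon>]
  show ?thesis
  proof (rule that[of "\<epsilon>\<^sup>2 * (\<gamma> / 2)"])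
    show "\<epsilon>\<^sup>2 * (\<gamma> / 2) > 0" using \<epsilon> pos by simp
    fix a E and u :: "(nat \<Rightarrow> real) \<Rightarrow> complex" and U :: "nat \<Rightarrow> nat \<Rightarrow> (nat \<Rightarrow> real) \<Rightarrow> complex"
    let ?J = "\<integral>\<^sup>+y. ennreal ((norm (u y))\<^sup>2) * indicator (cube d a l) y \<partial>leb d"
    assume um [measurable]: "u \<in> borel_measurable (leb d)" and U0: "\<And>i. i < d \<Longrightarrow> U i 0 = u"
      and der: "\<And>i n x t. i < d \<Longrightarrow> x \<in> extensional {..<d} \<Longrightarrow>
        ((\<lambda>t. U i n (x(i := t))) has_vector_derivative U i (Suc n) (x(i := t))) (at t)"
      and bound: "\<And>i n x. i < d \<Longrightarrow> x \<in> cube d a l \<Longrightarrow> ennreal ((norm (U i n x))\<^sup>2)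
        \<le> ennreal ((S * (\<Prod>k<n. \<rho> k))\<^sup>2) * ?J"
      and E [measurable]: "E \<in> sets (leb d)" and Ebig: "ennreal \<gamma> \<le> emeasure (leb d) (E \<inter> cube d a l)"
      and fin: "?J < \<infinity>"
    obtain m where m: "m \<ge> 0" "?J = ennreal m" using fin by (cases ?J) auto
    have goal: "ennreal (\<epsilon>\<^sup>2 * (\<gamma> / 2)) * ennreal m
      \<le> (\<integral>\<^sup>+y. ennreal ((norm (u y))\<^sup>2) * indicator (E \<inter> cube d a l) y \<partial>leb d)"
    proof (cases "m = 0")
      case False
      then have m0: "m > 0" using m by simp
      define q where "q = sqrt m"
      have q: "q > 0" "q\<^sup>2 = m" using m0 by (auto simp: q_def)
      have P: "S * (\<Prod>k<n. \<rho> k) > 0" for n using pos \<rho>(1) by (intro mult_pos_pos prod_pos) auto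
      have Ub: "norm (U i n x) / q \<le> S * (\<Prod>k<n. \<rho> k)" if "i < d" "x \<in> cube d a l" for i n x
      proof -
        have "ennreal ((S * (\<Prod>k<n. \<rho> k))\<^sup>2) * ennreal m = ennreal ((S * (\<Prod>k<n. \<rho> k))\<^sup>2 * m)"
          by (rule ennreal_mult[symmetric]) (simp_all add: m(1))
        then have "ennreal ((norm (U i n x))\<^sup>2) \<le> ennreal ((S * (\<Prod>k<n. \<rho> k))\<^sup>2 * m)"
          using bound[OF that, of n] unfolding m(2) by (simp only:)
        then have "(norm (U i n x))\<^sup>2 \<le> (S * (\<Prod>k<n. \<rho> k))\<^sup>2 * m"
          by (rule ennreal_le_iff[THEN iffD1, rotated]) (intro mult_nonneg_nonneg zero_le_power2 m(1))
        then have "(norm (U i n x))\<^sup>2 \<le> (S * (\<Prod>k<n. \<rho> k) * q)\<^sup>2" by (simp only: power_mult_distrib q(2))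
        then have "norm (U i n x) \<le> S * (\<Prod>k<n. \<rho> k) * q"
          by (rule power2_le_imp_le) (intro mult_nonneg_nonneg less_imp_le P q(1))
        then show ?thesis by (simp only: pos_divide_le_eq[OF q(1)])
      qed
      define E' where "E' = {x \<in> E \<inter> cube d a l. (norm (u x))\<^sup>2 \<le> \<epsilon>\<^sup>2 * m}"
      have E's: "E' \<in> sets (leb d)" "E' \<subseteq> cube d a l"
      proof -
        have "E' = E \<inter> cube d a l \<inter> {x \<in> space (leb d). (norm (u x))\<^sup>2 \<le> \<epsilon>\<^sup>2 * m}"
          using cube_subset_space by (auto simp: E'_def)
        also have "\<dots> \<in> sets (leb d)" by measurable
        finally show "E' \<in> sets (leb d)" .
      qed (auto simp: E'_def)
      have E'u: "norm (u x) / q \<le> \<epsilon>" if "x \<in> E'" for x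
      proof -
        have "(norm (u x))\<^sup>2 \<le> (\<epsilon> * q)\<^sup>2" using that q by (simp add: E'_def power_mult_distrib)
        then have "norm (u x) \<le> \<epsilon> * q" by (rule power2_le_imp_le) (use \<epsilon> q in simp)
        then show ?thesis by (simp only: pos_divide_le_eq[OF q(1)])
      qed
      \<comment> \<open>Propagation concerns real functions; \<open>L\<close> is going to be
        \<open>Re\<close> and \<open>Im\<close>, and the division by \<open>q\<close> normalises the
        mass.\<close>
      have part: "\<bar>L (u x) / q\<bar> \<le> \<delta>"
        if L: "bounded_linear L" "\<And>z. \<bar>L z\<bar> \<le> norm z" and big: "ennreal (\<gamma> / 2) \<le> emeasure (leb d) E'" and x: "x \<in> cube d a l"
        for L :: "complex \<Rightarrow> real" and x
      proof (rule propag[THEN spec[of _ a], THEN spec[of _ E'], THEN spec[of _ "\<lambda>i n x. L (U i n x) / q"],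
          THEN spec[of _ "\<lambda>x. L (u x) / q"], THEN mp, THEN mp, THEN mp, THEN mp, THEN mp, THEN mp, THEN mp,
          THEN bspec, OF _ _ _ E's big _ x])
        show "\<forall>i<d. (\<lambda>x. L (U i 0 x) / q) = (\<lambda>x. L (u x) / q)" using U0 by simp
        show "\<forall>i<d. \<forall>n. \<forall>x\<in>extensional {..<d}. \<forall>t. DERIV (\<lambda>t. L (U i n (x(i := t))) / q) t :> L (U i (Suc n) (x(i := t))) / q"
        proof (intro allI impI ballI)
          fix i n and z :: "nat \<Rightarrow> real" and t assume "i < d" "z \<in> extensional {..<d}"
          from bounded_linear.has_vector_derivative[OF L(1) der[OF this, of n t]]
          show "DERIV (\<lambda>t. L (U i n (z(i := t))) / q) t :> L (U i (Suc n) (z(i := t))) / q"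
            by (intro DERIV_cdivide) (simp only: has_real_derivative_iff_has_vector_derivative)
        qed
        have "\<bar>L z / q\<bar> \<le> norm z / q" for z using L(2)[of z] q by (simp add: divide_right_mono)
        then show "\<forall>i<d. \<forall>n. \<forall>x\<in>cube d a l. \<bar>L (U i n x) / q\<bar> \<le> S * (\<Prod>k<n. \<rho> k)"
          "\<forall>x\<in>E'. \<bar>L (u x) / q\<bar> \<le> \<epsilon>"
          using Ub E'u by (meson order.trans)+
      qed
      have "\<not> ennreal (\<gamma> / 2) \<le> emeasure (leb d) E'"
      proof
        assume big: "ennreal (\<gamma> / 2) \<le> emeasure (leb d) E'"
        have uq: "(norm (u x))\<^sup>2 \<le> 2 * \<delta>\<^sup>2 * m" if x: "x \<in> cube d a l" for x
        proof -
          have "\<bar>Re (u x) / q\<bar>\<^sup>2 \<le> \<delta>\<^sup>2" "\<bar>Im (u x) / q\<bar>\<^sup>2 \<le> \<delta>\<^sup>2"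
            using part[OF bounded_linear_Re abs_Re_le_cmod big x] part[OF bounded_linear_Im abs_Im_le_cmod big x]
            by (intro power_mono; simp)+
          then have "(Re (u x))\<^sup>2 \<le> \<delta>\<^sup>2 * m" "(Im (u x))\<^sup>2 \<le> \<delta>\<^sup>2 * m"
            using m0 by (simp_all add: power_divide q(2) pos_divide_le_eq)
          then show ?thesis by (simp add: cmod_power2)
        qed
        have "ennreal m \<le> (\<integral>\<^sup>+y. ennreal (2 * \<delta>\<^sup>2 * m) * indicator (cube d a l) y \<partial>leb d)"
          unfolding m(2)[symmetric] using uq by (intro nn_integral_mono) (auto simp: indicator_def intro: ennreal_leI)
        also have "\<dots> = ennreal (2 * \<delta>\<^sup>2 * m * l ^ d)"
          using pos m by (simp add: nn_integral_cmult_indicator emeasure_cube ennreal_mult)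
        also have "2 * \<delta>\<^sup>2 * m * l ^ d = m / 2" using \<delta>2 by (simp add: mult_ac)
        finally show False using m0 by (simp add: ennreal_le_iff)
      qed
      then have "ennreal (\<epsilon>\<^sup>2 * m * (\<gamma> / 2)) \<le> (\<integral>\<^sup>+y. ennreal ((norm (u y))\<^sup>2) * indicator (E \<inter> cube d a l) y \<partial>leb d)"
        using Ebig pos m by (intro small_on_dense_part) (auto simp: E'_def not_le)
      moreover have "ennreal (\<epsilon>\<^sup>2 * (\<gamma> / 2)) * ennreal m = ennreal (\<epsilon>\<^sup>2 * m * (\<gamma> / 2))"
        using pos m by (simp add: ennreal_mult[symmetric] mult_ac)
      ultimately show ?thesis by simp
    qed simp
    then show "ennreal (\<epsilon>\<^sup>2 * (\<gamma> / 2)) * ?J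
      \<le> (\<integral>\<^sup>+y. ennreal ((norm (u y))\<^sup>2) * indicator (E \<inter> cube d a l) y \<partial>leb d)"
      by (simp only: m(2))
  qed
qed

text \<open>The cubes with corners in the lattice of mesh \<open>l\<close>, numbered through a code
  for lists of integers. They are closed and share faces; the identity for integrals holds because
  the hyperplanes containing the faces are null sets.\<close>

lemma cube_tiling:
  assumes l: "l > 0"
  obtains Q :: "nat \<Rightarrow> (nat \<Rightarrow> real) set" where
    "\<And>n. Q n = {} \<or> (\<exists>a. Q n = cube d a l)"
    "\<And>h. h \<in> borel_measurable (leb d) \<Longrightarrow>
      (\<integral>\<^sup>+x. h x \<partial>leb d) = (\<Sum>n. \<integral>\<^sup>+x. h x * indicator (Q n) x \<partial>leb d)"
proof -
  define code where "code = (\<lambda>x::nat \<Rightarrow> real. to_nat (map (\<lambda>i. \<lfloor>x i / l\<rfloor>) [0..<d]))"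
  define a where "a = (\<lambda>n i. l * of_int ((from_nat n :: int list) ! i))"
  \<comment> \<open>Numbers that are no codes are given the empty set, since \<open>from_nat\<close>
    might decode them to a cube that is already listed.\<close>
  define Q where "Q = (\<lambda>n. if n \<in> code ` space (leb d) then cube d (a n) l else {})"
  have gen: "AE x in leb d. \<forall>i<d. \<forall>z::int. x i \<noteq> l * of_int z"
  proof -
    have "AE x in leb d. \<forall>i\<in>{..<d}. \<forall>z::int. x i \<noteq> l * of_int z"
      using AE_coordinate_neq by (subst AE_finite_all) (auto simp: AE_all_countable)
    then show ?thesis by eventually_elim auto
  qed
  have mem: "x \<in> Q n \<longleftrightarrow> code x = n" if x: "x \<in> space (leb d)" and g: "\<forall>i<d. \<forall>z::int. x i \<noteq> l * of_int z" for x n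
  proof
    assume c: "code x = n"
    then have L: "(from_nat n :: int list) = map (\<lambda>i. \<lfloor>x i / l\<rfloor>) [0..<d]" by (auto simp: code_def)
    have "a n i \<le> x i \<and> x i \<le> a n i + l" if "i < d" for i
    proof -
      have "of_int \<lfloor>x i / l\<rfloor> \<le> x i / l" "x i / l \<le> of_int \<lfloor>x i / l\<rfloor> + 1" by linarith+
      then have "of_int \<lfloor>x i / l\<rfloor> * l \<le> x i" "x i \<le> (of_int \<lfloor>x i / l\<rfloor> + 1) * l"
        using l by (simp_all only: pos_le_divide_eq pos_divide_le_eq)
      then show ?thesis using that by (simp add: a_def L algebra_simps)
    qed
    then show "x \<in> Q n" using x c by (auto simp: Q_def cube_def space_leb PiE_iff)
  next
    assume "x \<in> Q n"
    then have n: "n \<in> code ` space (leb d)" and xc: "x \<in> cube d (a n) l" by (auto simp: Q_def split: if_splits)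
    from n obtain y where y: "n = code y" by auto
    have L: "(from_nat n :: int list) = map (\<lambda>i. \<lfloor>y i / l\<rfloor>) [0..<d]" by (simp add: y code_def)
    have "\<lfloor>x i / l\<rfloor> = \<lfloor>y i / l\<rfloor>" if i: "i < d" for i
    proof -
      have "a n i \<le> x i" "x i \<le> a n i + l" using xc i by (auto simp: cube_def PiE_iff)
      moreover have "x i \<noteq> a n i + l" using g[rule_format, OF i, of "\<lfloor>y i / l\<rfloor> + 1"] i by (simp add: a_def L algebra_simps)
      moreover have "a n i = l * of_int \<lfloor>y i / l\<rfloor>" using i by (simp add: a_def L)
      ultimately have "of_int \<lfloor>y i / l\<rfloor> \<le> x i / l" "x i / l < of_int \<lfloor>y i / l\<rfloor> + 1"
        using l by (simp_all add: field_simps)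
      then show ?thesis by linarith
    qed
    then show "code x = n" unfolding y code_def by (intro arg_cong[of _ _ to_nat] map_cong) auto
  qed
  show ?thesis
  proof (rule that[of Q])
    show "Q n = {} \<or> (\<exists>a. Q n = cube d a l)" for n by (auto simp: Q_def)
    have [measurable]: "Q n \<in> sets (leb d)" for n by (simp add: Q_def)
    fix h :: "(nat \<Rightarrow> real) \<Rightarrow> ennreal" assume [measurable]: "h \<in> borel_measurable (leb d)"
    have "(\<integral>\<^sup>+x. h x \<partial>leb d) = (\<integral>\<^sup>+x. (\<Sum>n. h x * indicator (Q n) x) \<partial>leb d)"
    proof (intro nn_integral_cong_AE)
      show "AE x in leb d. h x = (\<Sum>n. h x * indicator (Q n) x)"
        using gen AE_space
      proof eventually_elim
        case (elim x)
        have "(\<Sum>n. h x * indicator (Q n) x) = (\<Sum>n\<in>{code x}. h x * indicator (Q n) x)"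
          using mem[OF elim(2,1)] by (intro suminf_finite) (auto simp: indicator_def)
        also have "\<dots> = h x" using mem[OF elim(2,1), of "code x"] by simp
        finally show ?case by simp
      qed
    qed
    also have "\<dots> = (\<Sum>n. \<integral>\<^sup>+x. h x * indicator (Q n) x \<partial>leb d)"
      by (rule nn_integral_suminf) measurable
    finally show "(\<integral>\<^sup>+x. h x \<partial>leb d) = (\<Sum>n. \<integral>\<^sup>+x. h x * indicator (Q n) x \<partial>leb d)" .
  qed
qed

section \<open>Moments of the transform and derivatives of the smooth representative\<close>

lemma integrable_of_nn_bound:
  fixes h :: "'a \<Rightarrow> real"
  assumes "h \<in> borel_measurable M" "\<And>x. 0 \<le> h x" "(\<integral>\<^sup>+x. ennreal (h x) \<partial>M) \<le> ennreal K"
  shows "integrable M h"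
  using assms by (intro integrableI_bounded) (auto simp: le_less_trans)

lemma moment_bound:
  fixes W :: "real \<Rightarrow> ennreal"
  assumes [measurable]: "g \<in> borel_measurable (leb d)" and p: "p > 0"
    and W: "\<And>t. 0 \<le> t \<Longrightarrow> ennreal (t ^ n) \<le> W t * ennreal p"
    and bound: "(\<integral>\<^sup>+\<xi>. (ennreal (cmod (g \<xi>)) * W (L2_set \<xi> {..<d}))\<^sup>2 \<partial>leb d) \<le> ennreal K"
    and K: "K \<ge> 0"
  shows "(\<integral>\<^sup>+\<xi>. ennreal ((L2_set \<xi> {..<d} ^ n * cmod (g \<xi>))\<^sup>2) \<partial>leb d) \<le> ennreal (p\<^sup>2 * K)"
proof -
  have "ennreal ((L2_set \<xi> {..<d} ^ n * cmod (g \<xi>))\<^sup>2)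
    = ennreal (p\<^sup>2) * ennreal ((L2_set \<xi> {..<d} ^ n / p * cmod (g \<xi>))\<^sup>2)" for \<xi>
    using p by (simp add: ennreal_mult[symmetric] power_mult_distrib power_divide)
  then have "(\<integral>\<^sup>+\<xi>. ennreal ((L2_set \<xi> {..<d} ^ n * cmod (g \<xi>))\<^sup>2) \<partial>leb d)
    = ennreal (p\<^sup>2) * (\<integral>\<^sup>+\<xi>. ennreal ((L2_set \<xi> {..<d} ^ n / p * cmod (g \<xi>))\<^sup>2) \<partial>leb d)"
    by (simp add: nn_integral_cmult)
  also have "(\<integral>\<^sup>+\<xi>. ennreal ((L2_set \<xi> {..<d} ^ n / p * cmod (g \<xi>))\<^sup>2) \<partial>leb d)
    \<le> (\<integral>\<^sup>+\<xi>. (ennreal (cmod (g \<xi>)) * W (L2_set \<xi> {..<d}))\<^sup>2 \<partial>leb d)"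
  proof (intro nn_integral_mono)
    fix \<xi> :: "nat \<Rightarrow> real"
    let ?r = "L2_set \<xi> {..<d}"
    have r: "?r \<ge> 0" by (rule L2_set_nonneg)
    have "ennreal (?r ^ n / p) = ennreal (?r ^ n) * ennreal (1 / p)"
      using p r by (simp add: ennreal_mult[symmetric])
    also have "\<dots> \<le> (W ?r * ennreal p) * ennreal (1 / p)" by (intro mult_right_mono W r) simp
    also have "\<dots> = W ?r * (ennreal p * ennreal (1 / p))" by (simp only: mult.assoc)
    also have "ennreal p * ennreal (1 / p) = 1" using p by (simp add: ennreal_mult[symmetric])
    finally have "ennreal (?r ^ n / p) \<le> W ?r" by simp
    then have "(ennreal (cmod (g \<xi>)) * ennreal (?r ^ n / p))\<^sup>2 \<le> (ennreal (cmod (g \<xi>)) * W ?r)\<^sup>2"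
      by (intro power_mono mult_left_mono) auto
    also have "(ennreal (cmod (g \<xi>)) * ennreal (?r ^ n / p))\<^sup>2 = ennreal ((?r ^ n / p * cmod (g \<xi>))\<^sup>2)"
      using p r by (simp add: ennreal_mult[symmetric] ennreal_power mult.commute)
    finally show "ennreal ((?r ^ n / p * cmod (g \<xi>))\<^sup>2) \<le> (ennreal (cmod (g \<xi>)) * W ?r)\<^sup>2" .
  qed
  also have "ennreal (p\<^sup>2) * (\<integral>\<^sup>+\<xi>. (ennreal (cmod (g \<xi>)) * W (L2_set \<xi> {..<d}))\<^sup>2 \<partial>leb d) \<le> ennreal (p\<^sup>2) * ennreal K"
    using bound by (rule mult_left_mono) simp
  finally show ?thesis using K by (simp add: ennreal_mult mult_left_mono)
qed

lemma symbol_mult_integrable: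
  assumes [measurable]: "g \<in> borel_measurable (leb d)"
    and mom: "\<And>n. integrable (leb d) (\<lambda>\<xi>. (L2_set \<xi> {..<d} ^ n * norm (g \<xi>))\<^sup>2)"
  shows "integrable (leb d) (\<lambda>\<xi>. symbol d \<alpha> \<xi> * g \<xi>)"
proof (rule Bochner_Integration.integrable_bound)
  let ?k = "\<Sum>j<d. \<alpha> j"
  show "integrable (leb d) (\<lambda>\<xi>. (2 * pi) ^ ?k * (L2_set \<xi> {..<d} ^ ?k * norm (g \<xi>)))"
    by (intro integrable_mult_right integrable_power_mult_of_moments mom) measurable
  have "norm (symbol d \<alpha> \<xi> * g \<xi>) \<le> (2 * pi) ^ ?k * (L2_set \<xi> {..<d} ^ ?k * norm (g \<xi>))" for \<xi>
    using mult_right_mono[OF norm_symbol_le[of d \<alpha> \<xi>] norm_ge_zero[of "g \<xi>"]]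
    by (simp only: norm_mult power_mult_distrib mult.assoc)
  then show "AE \<xi> in leb d. norm (symbol d \<alpha> \<xi> * g \<xi>) \<le> norm ((2 * pi) ^ ?k * (L2_set \<xi> {..<d} ^ ?k * norm (g \<xi>)))"
    by (intro AE_I2) (simp only: real_norm_def order.trans[OF _ abs_ge_self])
qed measurable

lemma symbol_derivative:
  assumes i: "i < d" and int: "\<And>\<alpha>. integrable (leb d) (\<lambda>\<xi>. symbol d \<alpha> \<xi> * g \<xi>)"
  shows "((\<lambda>t. inverse_fourier_integral d (\<lambda>\<xi>. symbol d \<alpha> \<xi> * g \<xi>) (x(i := t))) has_vector_derivative
    inverse_fourier_integral d (\<lambda>\<xi>. symbol d (\<alpha>(i := Suc (\<alpha> i))) \<xi> * g \<xi>) (x(i := t))) (at t)"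
proof -
  let ?\<beta> = "\<alpha>(i := Suc (\<alpha> i))"
  have 1: "(\<lambda>\<xi>. 2 * pi * \<i> * \<xi> i * (symbol d \<alpha> \<xi> * g \<xi>)) = (\<lambda>\<xi>. symbol d ?\<beta> \<xi> * g \<xi>)"
    unfolding symbol_Suc[OF i] by (simp only: mult.assoc)
  have 2: "(\<lambda>\<xi>. (2 * pi * \<i> * \<xi> i)\<^sup>2 * (symbol d \<alpha> \<xi> * g \<xi>)) = (\<lambda>\<xi>. symbol d (?\<beta>(i := Suc (?\<beta> i))) \<xi> * g \<xi>)"
    unfolding symbol_Suc[OF i] by (simp only: mult.assoc power2_eq_square)
  show ?thesis
    using inverse_fourier_has_derivative[OF i, of "\<lambda>\<xi>. symbol d \<alpha> \<xi> * g \<xi>" x t] int[of \<alpha>] int[of ?\<beta>] int[of "?\<beta>(i := Suc (?\<beta> i))"]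
    unfolding 1 2 by blast
qed

text \<open>Bessel's inequality; the symbol contributes \<open>2 * pi\<close> per derivative, the
  moment bound contributes \<open>p\<close>.\<close>

lemma symbol_L2_bound:
  assumes [measurable]: "g \<in> borel_measurable (leb d)"
    and mom: "\<And>n. (\<integral>\<^sup>+\<xi>. ennreal ((L2_set \<xi> {..<d} ^ n * cmod (g \<xi>))\<^sup>2) \<partial>leb d) \<le> ennreal ((p n)\<^sup>2 * K)"
    and K: "K \<ge> 0"
    and int: "integrable (leb d) (\<lambda>\<xi>. symbol d \<alpha> \<xi> * g \<xi>)"
  shows "(\<integral>\<^sup>+x. ennreal ((norm (inverse_fourier_integral d (\<lambda>\<xi>. symbol d \<alpha> \<xi> * g \<xi>) x))\<^sup>2) \<partial>leb d)
    \<le> ennreal (((2 * pi) ^ (\<Sum>j<d. \<alpha> j) * p (\<Sum>j<d. \<alpha> j))\<^sup>2 * K)"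
proof -
  let ?k = "\<Sum>j<d. \<alpha> j"
  have "(\<integral>\<^sup>+x. ennreal ((norm (inverse_fourier_integral d (\<lambda>\<xi>. symbol d \<alpha> \<xi> * g \<xi>) x))\<^sup>2) \<partial>leb d)
    \<le> (\<integral>\<^sup>+\<xi>. ennreal ((norm (symbol d \<alpha> \<xi> * g \<xi>))\<^sup>2) \<partial>leb d)" by (rule bessel[OF int])
  also have "\<dots> \<le> (\<integral>\<^sup>+\<xi>. ennreal (((2 * pi) ^ ?k)\<^sup>2) * ennreal ((L2_set \<xi> {..<d} ^ ?k * cmod (g \<xi>))\<^sup>2) \<partial>leb d)"
  proof (intro nn_integral_mono)
    fix \<xi>
    have "norm (symbol d \<alpha> \<xi> * g \<xi>) \<le> (2 * pi) ^ ?k * (L2_set \<xi> {..<d} ^ ?k * norm (g \<xi>))"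
      using mult_right_mono[OF norm_symbol_le[of d \<alpha> \<xi>] norm_ge_zero[of "g \<xi>"]]
      by (simp only: norm_mult power_mult_distrib mult.assoc)
    then have "(norm (symbol d \<alpha> \<xi> * g \<xi>))\<^sup>2 \<le> ((2 * pi) ^ ?k * (L2_set \<xi> {..<d} ^ ?k * norm (g \<xi>)))\<^sup>2"
      by (rule power_mono) simp
    then have "ennreal ((norm (symbol d \<alpha> \<xi> * g \<xi>))\<^sup>2) \<le> ennreal (((2 * pi) ^ ?k)\<^sup>2 * (L2_set \<xi> {..<d} ^ ?k * norm (g \<xi>))\<^sup>2)"
      by (intro ennreal_leI) (simp only: power_mult_distrib)
    also have "\<dots> = ennreal (((2 * pi) ^ ?k)\<^sup>2) * ennreal ((L2_set \<xi> {..<d} ^ ?k * cmod (g \<xi>))\<^sup>2)"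
      by (rule ennreal_mult) simp_all
    finally show "ennreal ((norm (symbol d \<alpha> \<xi> * g \<xi>))\<^sup>2)
      \<le> ennreal (((2 * pi) ^ ?k)\<^sup>2) * ennreal ((L2_set \<xi> {..<d} ^ ?k * cmod (g \<xi>))\<^sup>2)" .
  qed
  also have "\<dots> = ennreal (((2 * pi) ^ ?k)\<^sup>2) * (\<integral>\<^sup>+\<xi>. ennreal ((L2_set \<xi> {..<d} ^ ?k * cmod (g \<xi>))\<^sup>2) \<partial>leb d)"
    by (rule nn_integral_cmult) measurable
  also have "\<dots> \<le> ennreal (((2 * pi) ^ ?k)\<^sup>2) * ennreal ((p ?k)\<^sup>2 * K)" by (rule mult_left_mono[OF mom]) simp
  also have "\<dots> = ennreal (((2 * pi) ^ ?k * p ?k)\<^sup>2 * K)"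
    using K by (simp add: ennreal_mult[symmetric] power_mult_distrib mult_ac)
  finally show ?thesis .
qed

text \<open>The multi-index of \<open>m\<close> derivatives in direction \<open>i\<close> and one
  more in each direction of \<open>B\<close>: pure derivatives serve Bang's argument, the additional
  ones the Sobolev inequality.\<close>

definition partial_index :: "nat \<Rightarrow> nat \<Rightarrow> nat set \<Rightarrow> nat \<Rightarrow> nat" where
  "partial_index i m B j = (if j = i then m else 0) + (if j \<in> B then 1 else 0)"

lemma partial_index_insert:
  "j \<notin> B \<Longrightarrow> partial_index i m (insert j B) = (partial_index i m B)(j := Suc (partial_index i m B j))"
  by (auto simp: partial_index_def fun_eq_iff)

lemma partial_index_Suc:
  "partial_index i (Suc m) B = (partial_index i m B)(i := Suc (partial_index i m B i))"
  by (auto simp: partial_index_def fun_eq_iff)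

lemma partial_index_zero: "partial_index i 0 {} = (\<lambda>_. 0)"
  by (auto simp: partial_index_def fun_eq_iff)

lemma sum_partial_index_le: "(\<Sum>j<d. partial_index i m B j) \<le> m + d"
proof -
  have "(\<Sum>j<d. partial_index i m B j) = (\<Sum>j<d. if j = i then m else 0) + (\<Sum>j<d. if j \<in> B then 1 else 0)"
    by (simp add: partial_index_def sum.distrib)
  also have "(\<Sum>j<d. if j = i then m else 0) \<le> m" by simp
  also have "(\<Sum>j<d. if j \<in> B then 1 else 0) \<le> (\<Sum>j<d. 1::nat)" by (intro sum_mono) auto
  finally show ?thesis by simp
qed

lemma L2_norm_restrict_space:
  assumes "E \<in> sets M"
  shows "L2_norm (restrict_space M E) f = sqrt (\<integral>x. indicator E x * (cmod (f x))\<^sup>2 \<partial>M)"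
  using assms by (simp add: L2_norm_def integral_restrict_space sets.Int_space_eq2)

section \<open>The estimate by good and bad cubes\<close>

text \<open>A cube is bad if one of the weighted derivatives has more mass on it than
  \<open>u\<close>. All weighted derivatives together form \<open>h\<close>, whose integral is at
  most half of the mass of \<open>u\<close>. On a bad cube \<open>h\<close> dominates, on a good one
  the comparison with \<open>E\<close> applies, so that \<open>H\<close> dominates on every cube;
  after summation over the tiling the half coming from \<open>h\<close> is absorbed on the left.
  This is the origin of \<open>sqrt (2 / c)\<close>.\<close>

lemma PLS_estimate:
  fixes W :: "real \<Rightarrow> ennreal" and \<rho> :: "nat \<Rightarrow> real"
  assumes d: "d \<ge> 1" and pos: "\<gamma> > 0" "l > 0" "CW > 0"
    and \<rho>: "\<And>k. 1 \<le> \<rho> k" "mono \<rho>" "\<not> summable (\<lambda>k. 1 / \<rho> k)"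
    and W: "\<And>n t. 0 \<le> t \<Longrightarrow> ennreal (t ^ n) \<le> W t * ennreal (\<Prod>k<n. \<rho> k)"
  obtains C where "C > 0" "\<And>f g E. \<lbrakk>is_fourier_transform d f g;
      (\<integral>\<^sup>+\<xi>. (ennreal (cmod (g \<xi>)) * W (L2_set \<xi> {..<d}))\<^sup>2 \<partial>leb d) \<le> ennreal (CW\<^sup>2 * (L2_norm (leb d) f)\<^sup>2);
      relatively_dense d \<gamma> l E\<rbrakk> \<Longrightarrow> L2_norm (leb d) f \<le> C * L2_norm (restrict_space (leb d) E) f"
proof -
  define P where "P = (\<lambda>n. \<Prod>k<n. \<rho> k)"
  have P1: "P n \<ge> 1" for n unfolding P_def by (intro prod_ge_1 \<rho>)
  then have P0: "P n > 0" for n by (rule less_le_trans[OF zero_less_one])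
  have Pmono: "P m \<le> P n" if "m \<le> n" for m n
    using that
  proof (induction n rule: dec_induct)
    case (step n)
    have "P n * 1 \<le> P n * \<rho> n" using P0[of n] \<rho>(1) by (intro mult_left_mono) auto
    then show ?case using step by (simp add: P_def)
  qed simp
  \<comment> \<open>Orders up to \<open>m + d\<close> occur: \<open>m\<close> derivatives in one
    direction and at most \<open>d\<close> for the Sobolev inequality.\<close>
  define T where "T = (\<lambda>m. (2 * pi) ^ (m + d) * P (m + d))"
  have T0: "T m > 0" for m using P0 by (simp add: T_def)
  have Tge: "(2 * pi) ^ k * P k \<le> T m" if "k \<le> m + d" for k m
    unfolding T_def using that P0 pi_gt3 by (intro mult_mono power_increasing Pmono less_imp_le[OF P0]) auto
  \<comment> \<open>There are \<open>d * 2 ^ d\<close> pairs \<open>(i, B)\<close> for each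
    \<open>m\<close>; with the factor \<open>4\<close>, order \<open>m\<close> contributes at most
    \<open>N / (4 * 2 ^ m)\<close> to the integral of \<open>h\<close>, in total
    \<open>N / 2\<close>.\<close>
  define \<Lambda> where "\<Lambda> = 4 * real d * 2 ^ d"
  have \<Lambda>: "\<Lambda> > 0" using d by (simp add: \<Lambda>_def)
  define w where "w = (\<lambda>m. 1 / (\<Lambda> * 2 ^ m * (T m)\<^sup>2 * CW\<^sup>2))"
  have w: "w m > 0" for m using \<Lambda> T0[of m] pos by (simp add: w_def)
  \<comment> \<open>A factor \<open>2 * pi\<close> comes from differentiation and \<open>2\<close>
    from the weights \<open>w\<close>; the shift by \<open>d\<close> accounts for the Sobolev
    derivatives. None of this affects divergence.\<close>
  define \<rho>' where "\<rho>' = (\<lambda>k. 4 * pi * \<rho> (k + d))"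
  have \<rho>': "\<And>k. 0 < \<rho>' k" "mono \<rho>'" "\<not> summable (\<lambda>k. 1 / \<rho>' k)"
  proof -
    show "0 < \<rho>' k" for k using \<rho>(1)[of "k + d"] by (simp add: \<rho>'_def)
    show "mono \<rho>'" using \<rho>(2) by (auto simp: \<rho>'_def mono_def)
    show "\<not> summable (\<lambda>k. 1 / \<rho>' k)"
    proof
      assume "summable (\<lambda>k. 1 / \<rho>' k)"
      then have "summable (\<lambda>k. (4 * pi) * (1 / \<rho>' k))" by (rule summable_mult)
      then have "summable (\<lambda>k. 1 / \<rho> (k + d))" by (simp add: \<rho>'_def)
      then show False using \<rho>(3) summable_iff_shift[of "\<lambda>k. 1 / \<rho> k" d] by blast
    qed
  qed
  define Cs where "Cs = (1 + l) / l"
  have Cs: "Cs > 0" using pos by (simp add: Cs_def)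
  define S2 where "S2 = Cs ^ d * 2 ^ d * (\<Lambda> * CW\<^sup>2 * ((2 * pi) ^ d * P d)\<^sup>2)"
  have S2: "S2 > 0" using Cs \<Lambda> pos P0[of d] by (simp add: S2_def)
  have S: "sqrt S2 > 0" using S2 by simp
  have Pshift: "(2 * pi) ^ m * 2 ^ m * P (m + d) = P d * (\<Prod>k<m. \<rho>' k)" for m
  proof (induction m)
    case (Suc m)
    have "(2 * pi) ^ Suc m * 2 ^ Suc m * P (Suc m + d) = ((2 * pi) ^ m * 2 ^ m * P (m + d)) * \<rho>' m"
      by (simp add: P_def \<rho>'_def)
    also have "\<dots> = P d * (\<Prod>k<Suc m. \<rho>' k)" unfolding Suc.IH by (simp only: prod.lessThan_Suc mult.assoc)
    finally show ?case .
  qed (simp add: P_def)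
  have Sbound: "Cs ^ d * (2 ^ d * (1 / w m)) \<le> (sqrt S2 * (\<Prod>k<m. \<rho>' k))\<^sup>2" for m
  proof -
    have "1 / w m = \<Lambda> * CW\<^sup>2 * (2 ^ m * (T m)\<^sup>2)" by (simp add: w_def mult_ac)
    \<comment> \<open>One factor \<open>2 ^ m\<close> is enlarged to \<open>2 ^ m * 2 ^ m\<close> so
      that it fits under the square.\<close>
    also have "2 ^ m * (T m)\<^sup>2 \<le> (2 ^ m * T m)\<^sup>2"
    proof -
      have "(2::real) ^ m \<le> 2 ^ m * 2 ^ m" by simp
      then have "2 ^ m * (T m)\<^sup>2 \<le> (2 ^ m * 2 ^ m) * (T m)\<^sup>2" by (rule mult_right_mono) simp
      then show ?thesis by (simp add: power2_eq_square mult_ac)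
    qed
    also have "2 ^ m * T m = (2 * pi) ^ d * P d * (\<Prod>k<m. \<rho>' k)"
    proof -
      have "2 ^ m * T m = (2 * pi) ^ d * ((2 * pi) ^ m * 2 ^ m * P (m + d))"
        by (simp add: T_def power_add)
      also have "\<dots> = (2 * pi) ^ d * (P d * (\<Prod>k<m. \<rho>' k))" unfolding Pshift ..
      finally show ?thesis by (simp only: mult.assoc)
    qed
    finally have "1 / w m \<le> \<Lambda> * CW\<^sup>2 * ((2 * pi) ^ d * P d * (\<Prod>k<m. \<rho>' k))\<^sup>2"
      using \<Lambda> by (simp add: mult_left_mono)
    then have "Cs ^ d * (2 ^ d * (1 / w m)) \<le> Cs ^ d * (2 ^ d * (\<Lambda> * CW\<^sup>2 * ((2 * pi) ^ d * P d * (\<Prod>k<m. \<rho>' k))\<^sup>2))"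
      using Cs by (intro mult_left_mono) auto
    also have "\<dots> = S2 * (\<Prod>k<m. \<rho>' k)\<^sup>2" by (simp add: S2_def power_mult_distrib mult_ac)
    also have "\<dots> = (sqrt S2 * (\<Prod>k<m. \<rho>' k))\<^sup>2" using S2 by (simp add: power_mult_distrib)
    finally show ?thesis .
  qed
  obtain c where c: "c > 0" and comp: "\<And>a E u U. \<lbrakk>u \<in> borel_measurable (leb d); \<And>i. i < d \<Longrightarrow> U i 0 = u;
      \<And>i n x t. i < d \<Longrightarrow> x \<in> extensional {..<d} \<Longrightarrow>
        ((\<lambda>t. U i n (x(i := t))) has_vector_derivative U i (Suc n) (x(i := t))) (at t);
      \<And>i n x. i < d \<Longrightarrow> x \<in> cube d a l \<Longrightarrow> ennreal ((norm (U i n x))\<^sup>2)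
        \<le> ennreal ((sqrt S2 * (\<Prod>k<n. \<rho>' k))\<^sup>2) * (\<integral>\<^sup>+y. ennreal ((norm (u y))\<^sup>2) * indicator (cube d a l) y \<partial>leb d);
      E \<in> sets (leb d); ennreal \<gamma> \<le> emeasure (leb d) (E \<inter> cube d a l);
      (\<integral>\<^sup>+y. ennreal ((norm (u y))\<^sup>2) * indicator (cube d a l) y \<partial>leb d) < \<infinity>\<rbrakk> \<Longrightarrow>
    ennreal c * (\<integral>\<^sup>+y. ennreal ((norm (u y))\<^sup>2) * indicator (cube d a l) y \<partial>leb d)
      \<le> (\<integral>\<^sup>+y. ennreal ((norm (u y :: complex))\<^sup>2) * indicator (E \<inter> cube d a l) y \<partial>leb d)"
    by (rule cube_comparison[OF d \<rho>' S pos(2,1)]) blast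
  obtain Q :: "nat \<Rightarrow> (nat \<Rightarrow> real) set" where Q: "\<And>n. Q n = {} \<or> (\<exists>a. Q n = cube d a l)"
    and tile: "\<And>h. h \<in> borel_measurable (leb d) \<Longrightarrow>
      (\<integral>\<^sup>+x. h x \<partial>leb d) = (\<Sum>n. \<integral>\<^sup>+x. h x * indicator (Q n) x \<partial>leb d)"
    by (rule cube_tiling[OF pos(2), of d]) blast
  show ?thesis
  proof (rule that[of "sqrt (2 / c)"])
    show "sqrt (2 / c) > 0" using c by simp
    fix f g E
    assume ft: "is_fourier_transform d f g"
      and Wg: "(\<integral>\<^sup>+\<xi>. (ennreal (cmod (g \<xi>)) * W (L2_set \<xi> {..<d}))\<^sup>2 \<partial>leb d) \<le> ennreal (CW\<^sup>2 * (L2_norm (leb d) f)\<^sup>2)"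
      and dense: "relatively_dense d \<gamma> l E"
    have f2: "square_integrable (leb d) f" and g2: "square_integrable (leb d) g"
      using ft by (auto simp: is_fourier_transform_def)
    have fm [measurable]: "f \<in> borel_measurable (leb d)" and fint: "integrable (leb d) (\<lambda>x. (cmod (f x))\<^sup>2)"
      using f2 by (auto simp: square_integrable_def)
    have gm [measurable]: "g \<in> borel_measurable (leb d)" using g2 by (simp add: square_integrable_def)
    have E [measurable]: "E \<in> sets (leb d)" and Ed: "\<And>a. ennreal \<gamma> \<le> emeasure (leb d) (E \<inter> cube d a l)"
      using dense by (auto simp: relatively_dense_def)
    define N where "N = (\<integral>x. (cmod (f x))\<^sup>2 \<partial>leb d)"
    have N0: "N \<ge> 0" by (simp add: N_def)
    have L2N: "(L2_norm (leb d) f)\<^sup>2 = N" using N0 by (simp add: L2_norm_def N_def)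
    define K where "K = CW\<^sup>2 * N"
    have K0: "K \<ge> 0" using N0 by (simp add: K_def)
    have mom: "(\<integral>\<^sup>+\<xi>. ennreal ((L2_set \<xi> {..<d} ^ n * cmod (g \<xi>))\<^sup>2) \<partial>leb d) \<le> ennreal ((P n)\<^sup>2 * K)" for n
      using Wg W unfolding L2N K_def[symmetric] by (intro moment_bound[OF gm P0 _ _ K0]) (auto simp: P_def)
    have momint: "integrable (leb d) (\<lambda>\<xi>. (L2_set \<xi> {..<d} ^ n * norm (g \<xi>))\<^sup>2)" for n
      by (rule integrable_of_nn_bound[OF _ _ mom]) auto
    have int: "integrable (leb d) (\<lambda>\<xi>. symbol d \<alpha> \<xi> * g \<xi>)" for \<alpha>
      by (rule symbol_mult_integrable[OF gm momint])
    define U where "U = (\<lambda>\<alpha>. inverse_fourier_integral d (\<lambda>\<xi>. symbol d \<alpha> \<xi> * g \<xi>))"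
    have Um [measurable]: "U \<alpha> \<in> borel_measurable (leb d)" for \<alpha> unfolding U_def by measurable
    have Uder: "((\<lambda>t. U \<alpha> (x(i := t))) has_vector_derivative U (\<alpha>(i := Suc (\<alpha> i))) (x(i := t))) (at t)"
      if "i < d" for \<alpha> i x t unfolding U_def by (rule symbol_derivative[OF that int])
    define u where "u = U (\<lambda>_. 0)"
    have um [measurable]: "u \<in> borel_measurable (leb d)" by (simp add: u_def)
    have fu: "AE x in leb d. f x = u x"
      using fourier_inversion[OF ft] int[of "\<lambda>_. 0"] by (simp add: u_def U_def)
    let ?\<alpha> = partial_index
    have UL2: "(\<integral>\<^sup>+x. ennreal ((norm (U (?\<alpha> i m B) x))\<^sup>2) \<partial>leb d) \<le> ennreal ((T m)\<^sup>2 * K)" for i m B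
    proof -
      let ?k = "\<Sum>j<d. ?\<alpha> i m B j"
      have "((2 * pi) ^ ?k * P ?k)\<^sup>2 \<le> (T m)\<^sup>2"
        using P0[of ?k] by (intro power_mono Tge sum_partial_index_le) auto
      then have "ennreal (((2 * pi) ^ ?k * P ?k)\<^sup>2 * K) \<le> ennreal ((T m)\<^sup>2 * K)"
        using K0 by (intro ennreal_leI mult_right_mono)
      then show ?thesis
        unfolding U_def by (rule order.trans[OF symbol_L2_bound[OF gm mom K0 int]])
    qed
    have Nf: "ennreal N = (\<integral>\<^sup>+x. ennreal ((cmod (f x))\<^sup>2) \<partial>leb d)"
      unfolding N_def using fint by (intro nn_integral_eq_integral[symmetric]) auto
    also have "\<dots> = (\<integral>\<^sup>+x. ennreal ((cmod (u x))\<^sup>2) \<partial>leb d)"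
      using fu by (intro nn_integral_cong_AE) (auto elim: eventually_mono)
    finally have Nu: "ennreal N = (\<integral>\<^sup>+x. ennreal ((cmod (u x))\<^sup>2) \<partial>leb d)" .
    define v where "v = (\<lambda>m i B x. ennreal (w m) * ennreal ((norm (U (?\<alpha> i m B) x))\<^sup>2))"
    have vm [measurable]: "v m i B \<in> borel_measurable (leb d)" for m i B unfolding v_def by measurable
    define h where "h = (\<lambda>x. \<Sum>m. \<Sum>i<d. \<Sum>B\<in>Pow {..<d}. v m i B x)"
    have hm [measurable]: "h \<in> borel_measurable (leb d)" unfolding h_def by measurable
    have vh: "v m i B x \<le> h x" if "i < d" "B \<in> Pow {..<d}" for m i B x
    proof -
      have "v m i B x \<le> (\<Sum>B\<in>Pow {..<d}. v m i B x)" using that by (intro member_le_sum) auto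
      also have "\<dots> \<le> (\<Sum>i<d. \<Sum>B\<in>Pow {..<d}. v m i B x)"
        using that by (intro member_le_sum[of i "{..<d}" "\<lambda>i. \<Sum>B\<in>Pow {..<d}. v m i B x"]) auto
      also have "\<dots> = (\<Sum>m\<in>{m}. \<Sum>i<d. \<Sum>B\<in>Pow {..<d}. v m i B x)" by simp
      also have "\<dots> \<le> h x" unfolding h_def by (intro sum_le_suminf) auto
      finally show ?thesis .
    qed
    have hN: "(\<integral>\<^sup>+x. h x \<partial>leb d) \<le> ennreal (N / 2)"
    proof -
      have "(\<integral>\<^sup>+x. h x \<partial>leb d) = (\<Sum>m. \<Sum>i<d. \<Sum>B\<in>Pow {..<d}. \<integral>\<^sup>+x. v m i B x \<partial>leb d)"
        unfolding h_def by (simp add: nn_integral_suminf nn_integral_sum)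
      also have "\<dots> \<le> (\<Sum>m. ennreal (N / 4 * (1 / 2) ^ m))"
      proof (intro suminf_le)
        fix m
        have "(\<integral>\<^sup>+x. v m i B x \<partial>leb d) \<le> ennreal (N / (\<Lambda> * 2 ^ m))" for i B
        proof -
          have "(\<integral>\<^sup>+x. v m i B x \<partial>leb d) = ennreal (w m) * (\<integral>\<^sup>+x. ennreal ((norm (U (?\<alpha> i m B) x))\<^sup>2) \<partial>leb d)"
            unfolding v_def by (rule nn_integral_cmult) measurable
          also have "\<dots> \<le> ennreal (w m) * ennreal ((T m)\<^sup>2 * K)" by (rule mult_left_mono[OF UL2]) simp
          also have "\<dots> = ennreal (w m * ((T m)\<^sup>2 * K))"
            using w[of m] K0 by (intro ennreal_mult[symmetric]) auto
          also have "w m * ((T m)\<^sup>2 * K) = N / (\<Lambda> * 2 ^ m)"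
            using T0[of m] pos \<Lambda> by (simp add: w_def K_def)
          finally show ?thesis .
        qed
        then have "(\<Sum>i<d. \<Sum>B\<in>Pow {..<d}. \<integral>\<^sup>+x. v m i B x \<partial>leb d) \<le> (\<Sum>i<d. \<Sum>B\<in>Pow {..<d}. ennreal (N / (\<Lambda> * 2 ^ m)))"
          by (intro sum_mono)
        also have "\<dots> = ennreal (real d) * (ennreal (2 ^ d) * ennreal (N / (\<Lambda> * 2 ^ m)))"
          by (simp add: card_Pow ennreal_of_nat_eq_real_of_nat ennreal_power[symmetric])
        also have "\<dots> = ennreal (real d * (2 ^ d * (N / (\<Lambda> * 2 ^ m))))"
        proof -
          have "N / (\<Lambda> * 2 ^ m) \<ge> 0" using N0 \<Lambda> by simp
          then show ?thesis
            by (simp only: ennreal_mult[symmetric] zero_le_power of_nat_0_le_iff mult_nonneg_nonneg zero_le_numeral)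
        qed
        also have "real d * (2 ^ d * (N / (\<Lambda> * 2 ^ m))) = N / 4 * (1 / 2) ^ m"
          using d by (simp add: \<Lambda>_def power_divide)
        finally show "(\<Sum>i<d. \<Sum>B\<in>Pow {..<d}. \<integral>\<^sup>+x. v m i B x \<partial>leb d) \<le> ennreal (N / 4 * (1 / 2) ^ m)" .
      qed auto
      also have "\<dots> = ennreal (\<Sum>m. N / 4 * (1 / 2) ^ m)"
        using N0 by (intro suminf_ennreal2 summable_mult summable_geometric) auto
      also have "(\<Sum>m. N / 4 * (1 / 2) ^ m) = N / 4 * 2"
        using suminf_geometric[of "1 / 2 :: real"] by (subst suminf_mult) (auto intro: summable_geometric)
      finally show ?thesis by simp
    qed
    define H where "H = (\<lambda>x. ennreal (1 / c) * (ennreal ((cmod (u x))\<^sup>2) * indicator E x) + h x)"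
    have Hm [measurable]: "H \<in> borel_measurable (leb d)" unfolding H_def by measurable
    have per_cube: "(\<integral>\<^sup>+x. ennreal ((cmod (u x))\<^sup>2) * indicator (Q n) x \<partial>leb d) \<le> (\<integral>\<^sup>+x. H x * indicator (Q n) x \<partial>leb d)" for n
    proof (cases "Q n = {}")
      case False
      then obtain a where Qn: "Q n = cube d a l" using Q by blast
      define J where "J = (\<lambda>k. \<integral>\<^sup>+x. k x * indicator (cube d a l) x \<partial>leb d)"
      let ?u2 = "\<lambda>x. ennreal ((cmod (u x))\<^sup>2)"
      have "J ?u2 \<le> J H"
      \<comment> \<open>The distinction between good and bad cubes. One failing derivative is enough
        for \<open>h\<close> to dominate; if none fails, every derivative is bounded on the cube by
        the mass of \<open>u\<close> there.\<close>
      proof (cases "\<forall>i<d. \<forall>m. \<forall>B\<in>Pow {..<d}. J (v m i B) \<le> J ?u2")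
        case False
        then obtain i m B where b: "i < d" "B \<in> Pow {..<d}" "J ?u2 < J (v m i B)" by (auto simp: not_le)
        note b(3)
        also have "J (v m i B) \<le> J H" unfolding J_def
        proof (intro nn_integral_mono mult_right_mono)
          fix x
          have "v m i B x \<le> h x" by (rule vh[OF b(1,2)])
          also have "\<dots> \<le> H x" by (simp add: H_def)
          finally show "v m i B x \<le> H x" .
        qed simp
        finally show ?thesis by (rule less_imp_le)
      next
        case True
        have good: "J (\<lambda>x. ennreal ((norm (U (?\<alpha> i m B) x))\<^sup>2)) \<le> ennreal (1 / w m) * J ?u2"
          if "i < d" "B \<in> Pow {..<d}" for i m B
        proof -
          let ?k = "\<lambda>x. ennreal ((norm (U (?\<alpha> i m B) x))\<^sup>2)"
          have "J (v m i B) = ennreal (w m) * J ?k"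
            unfolding J_def v_def mult.assoc by (rule nn_integral_cmult) measurable
          moreover have "J (v m i B) \<le> J ?u2" using True that by blast
          ultimately have "ennreal (w m) * J ?k \<le> J ?u2" by (simp only:)
          then have "ennreal (1 / w m) * (ennreal (w m) * J ?k) \<le> ennreal (1 / w m) * J ?u2"
            by (rule mult_left_mono) simp
          moreover have "ennreal (1 / w m) * ennreal (w m) = 1"
            using w[of m] by (simp add: ennreal_mult[symmetric])
          ultimately show ?thesis by (simp only: mult.assoc[symmetric] mult_1)
        qed
        have "J ?u2 \<le> ennreal N" unfolding Nu J_def by (intro nn_integral_mono) (simp add: indicator_def)
        then have Jfin: "J ?u2 < \<infinity>" by (rule le_less_trans) simp
        have "ennreal c * J ?u2 \<le> (\<integral>\<^sup>+y. ?u2 y * indicator (E \<inter> cube d a l) y \<partial>leb d)"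
          unfolding J_def
        proof (rule comp[where U = "\<lambda>i m. U (?\<alpha> i m {})", OF um _ _ _ E Ed])
          show "U (?\<alpha> i 0 {}) = u" for i by (simp add: u_def partial_index_zero)
          show "((\<lambda>t. U (?\<alpha> i m {}) (x(i := t))) has_vector_derivative U (?\<alpha> i (Suc m) {}) (x(i := t))) (at t)"
            if "i < d" for i m x t unfolding partial_index_Suc by (rule Uder[OF that])
          show "(\<integral>\<^sup>+y. ?u2 y * indicator (cube d a l) y \<partial>leb d) < \<infinity>" using Jfin by (simp only: J_def)
          fix i m x assume i: "i < d" and x: "x \<in> cube d a l"
          have "ennreal ((norm (U (?\<alpha> i m {}) x))\<^sup>2) \<le> ennreal Cs ^ d * (\<Sum>B\<in>Pow {..<d}. J (\<lambda>y. ennreal ((norm (U (?\<alpha> i m B) y))\<^sup>2)))"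
            unfolding J_def Cs_def
          proof (rule sobolev_cube[where v = "\<lambda>B. U (?\<alpha> i m B)", OF pos(2) _ _ _ x])
            show "U (?\<alpha> i m B) \<in> borel_measurable (leb d)" for B by measurable
            show "((\<lambda>t. U (?\<alpha> i m B) (x(j := t))) has_vector_derivative U (?\<alpha> i m (insert j B)) (x(j := t))) (at t)"
              if "j < d" "j \<notin> B" for B j x t unfolding partial_index_insert[OF that(2)] by (rule Uder[OF that(1)])
            show "isCont (\<lambda>t. U (?\<alpha> i m B) (x(j := t))) t" if "j < d" for B j x t
              by (rule has_vector_derivative_continuous[OF Uder[OF that]])
          qed
          also have "\<dots> \<le> ennreal Cs ^ d * (\<Sum>B\<in>Pow {..<d}. ennreal (1 / w m) * J ?u2)"
            by (intro mult_left_mono sum_mono good i) auto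
          also have "\<dots> = (ennreal Cs ^ d * (ennreal (2 ^ d) * ennreal (1 / w m))) * J ?u2"
            by (simp add: card_Pow ennreal_power[symmetric] mult.assoc)
          also have "\<dots> = ennreal (Cs ^ d * (2 ^ d * (1 / w m))) * J ?u2"
            using Cs w[of m] by (simp only: ennreal_mult ennreal_power less_imp_le zero_le_power zero_le_numeral
                mult_nonneg_nonneg zero_le_divide_1_iff)
          also have "\<dots> \<le> ennreal ((sqrt S2 * (\<Prod>k<m. \<rho>' k))\<^sup>2) * J ?u2"
            by (intro mult_right_mono ennreal_leI Sbound) simp
          finally show "ennreal ((norm (U (?\<alpha> i m {}) x))\<^sup>2)
            \<le> ennreal ((sqrt S2 * (\<Prod>k<m. \<rho>' k))\<^sup>2) * (\<integral>\<^sup>+y. ?u2 y * indicator (cube d a l) y \<partial>leb d)"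
            by (simp only: J_def)
        qed
        then have "ennreal (1 / c) * (ennreal c * J ?u2) \<le> ennreal (1 / c) * (\<integral>\<^sup>+y. ?u2 y * indicator (E \<inter> cube d a l) y \<partial>leb d)"
          by (rule mult_left_mono) simp
        moreover have "ennreal (1 / c) * ennreal c = 1" using c by (simp add: ennreal_mult[symmetric])
        ultimately have "J ?u2 \<le> ennreal (1 / c) * (\<integral>\<^sup>+y. ?u2 y * indicator (E \<inter> cube d a l) y \<partial>leb d)"
          by (simp only: mult.assoc[symmetric] mult_1)
        also have "\<dots> = (\<integral>\<^sup>+y. ennreal (1 / c) * (?u2 y * indicator (E \<inter> cube d a l) y) \<partial>leb d)"
          by (rule nn_integral_cmult[symmetric]) measurable
        also have "\<dots> \<le> J H" unfolding J_def
          by (intro nn_integral_mono) (auto simp: H_def indicator_def)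
        finally show ?thesis .
      qed
      then show ?thesis by (simp only: J_def Qn)
    qed simp
    define NE where "NE = (\<integral>x. indicator E x * (cmod (f x))\<^sup>2 \<partial>leb d)"
    have "ennreal N = (\<Sum>n. \<integral>\<^sup>+x. ennreal ((cmod (u x))\<^sup>2) * indicator (Q n) x \<partial>leb d)"
      unfolding Nu by (rule tile) measurable
    also have "\<dots> \<le> (\<Sum>n. \<integral>\<^sup>+x. H x * indicator (Q n) x \<partial>leb d)" by (intro suminf_le per_cube) auto
    also have "\<dots> = (\<integral>\<^sup>+x. H x \<partial>leb d)" by (rule tile[OF Hm, symmetric])
    also have "\<dots> = ennreal (1 / c) * (\<integral>\<^sup>+x. ennreal ((cmod (u x))\<^sup>2) * indicator E x \<partial>leb d) + (\<integral>\<^sup>+x. h x \<partial>leb d)"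
      unfolding H_def by (simp add: nn_integral_add nn_integral_cmult)
    also have "(\<integral>\<^sup>+x. ennreal ((cmod (u x))\<^sup>2) * indicator E x \<partial>leb d) = (\<integral>\<^sup>+x. ennreal (indicator E x * (cmod (f x))\<^sup>2) \<partial>leb d)"
      using fu by (intro nn_integral_cong_AE) (auto elim!: eventually_mono simp: indicator_def)
    also have "\<dots> = ennreal NE"
      unfolding NE_def
    proof (rule nn_integral_eq_integral)
      show "integrable (leb d) (\<lambda>x. indicator E x * (cmod (f x))\<^sup>2)"
        by (rule Bochner_Integration.integrable_bound[OF fint]) (auto simp: indicator_def)
    qed simp
    finally have "ennreal N \<le> ennreal (1 / c) * ennreal NE + (\<integral>\<^sup>+x. h x \<partial>leb d)" .
    also have "\<dots> \<le> ennreal (1 / c) * ennreal NE + ennreal (N / 2)" using hN by (rule add_left_mono)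
    also have "\<dots> = ennreal (1 / c * NE + N / 2)"
    proof -
      have "NE \<ge> 0" unfolding NE_def by (intro integral_nonneg_AE) auto
      then show ?thesis using c N0 by (simp add: ennreal_mult[symmetric] ennreal_plus[symmetric] del: ennreal_plus)
    qed
    finally have "N \<le> 1 / c * NE + N / 2"
    proof (rule ennreal_le_iff[THEN iffD1, rotated])
      have "NE \<ge> 0" unfolding NE_def by (intro integral_nonneg_AE) auto
      then show "0 \<le> 1 / c * NE + N / 2" using c N0 by simp
    qed
    \<comment> \<open>The mass \<open>N\<close> is a real number, so \<open>N / 2\<close> may be
      subtracted.\<close>
    then have "N \<le> 2 / c * NE" by (simp add: field_simps)
    then have "sqrt N \<le> sqrt (2 / c * NE)" by (rule real_sqrt_le_mono)
    also have "\<dots> = sqrt (2 / c) * sqrt NE" by (rule real_sqrt_mult)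
    finally show "L2_norm (leb d) f \<le> sqrt (2 / c) * L2_norm (restrict_space (leb d) E) f"
      unfolding L2_norm_restrict_space[OF E] by (simp only: L2_norm_def N_def NE_def)
  qed
qed

lemma PLS_property_of_divergent_integral:
  fixes W :: "real \<Rightarrow> ennreal"
  assumes "W 0 = 1" "mono_on {0..} W" "ext_convex_on {0..} (\<lambda>s. ext_ln (W (exp s)))"
    and "(\<integral>\<^sup>+t\<in>{0..}. e2ennreal (ext_ln (W t) / ereal (1 + t\<^sup>2)) \<partial>lborel) = \<infinity>"
  shows "PLS_property W"
proof -
  obtain \<rho> :: "nat \<Rightarrow> real" where \<rho>: "\<And>k. 1 \<le> \<rho> k" "mono \<rho>" "\<not> summable (\<lambda>k. 1 / \<rho> k)"
    and W: "\<And>n t. 0 \<le> t \<Longrightarrow> ennreal (t ^ n) \<le> W t * ennreal (\<Prod>k<n. \<rho> k)"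
    by (rule weight_sequence[OF assms]) blast
  show ?thesis
    unfolding PLS_property_def
  proof (intro allI impI ballI)
    fix d :: nat and \<gamma> l CW :: real
    assume d: "1 \<le> d" and \<gamma>: "\<gamma> \<in> {0<..<1}" and "0 < l" "0 < CW"
    then have "\<gamma> > 0" by simp
    from PLS_estimate[OF d this \<open>0 < l\<close> \<open>0 < CW\<close> \<rho> W] obtain C where "C > 0"
      "\<And>f g E. \<lbrakk>is_fourier_transform d f g;
      (\<integral>\<^sup>+\<xi>. (ennreal (cmod (g \<xi>)) * W (L2_set \<xi> {..<d}))\<^sup>2 \<partial>leb d) \<le> ennreal (CW\<^sup>2 * (L2_norm (leb d) f)\<^sup>2);
      relatively_dense d \<gamma> l E\<rbrakk> \<Longrightarrow> L2_norm (leb d) f \<le> C * L2_norm (restrict_space (leb d) E) f"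
      by blast
    then show "\<exists>C>0. \<forall>f g E. square_integrable (leb d) f \<longrightarrow> is_fourier_transform d f g \<longrightarrow>
        (\<integral>\<^sup>+\<xi>. (ennreal (cmod (g \<xi>)) * W (L2_set \<xi> {..<d}))\<^sup>2 \<partial>leb d) \<le> ennreal (CW\<^sup>2 * (L2_norm (leb d) f)\<^sup>2) \<longrightarrow>
        relatively_dense d \<gamma> l E \<longrightarrow> L2_norm (leb d) f \<le> C * L2_norm (restrict_space (leb d) E) f"
      by blast
  qed
qed

section \<open>Compactly supported functions with fast Fourier decay\<close>

text \<open>Convolution with the normalised indicator of \<open>{-a..a}\<close>, rescaled to a fixed
  interval so that \<open>a\<close> occurs only in the argument of \<open>f\<close>.\<close>

definition average :: "real \<Rightarrow> (real \<Rightarrow> real) \<Rightarrow> real \<Rightarrow> real" where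
  "average a f x = (\<integral>t. indicator {-1..1} t * f (x + a * t) \<partial>lborel) / 2"

text \<open>A class stable under averaging and limits: \<open>L\<close> is preserved while
  \<open>s\<close> grows by the length \<open>a\<close>. The Lipschitz condition supplies continuity
  and bounds the change in one averaging by \<open>L * a\<close>.\<close>

definition bump :: "real \<Rightarrow> real \<Rightarrow> (real \<Rightarrow> real) \<Rightarrow> bool" where
  "bump L s f \<longleftrightarrow> (\<forall>x y. \<bar>f x - f y\<bar> \<le> L * \<bar>x - y\<bar>) \<and> (\<forall>x. s < \<bar>x\<bar> \<longrightarrow> f x = 0)"

lemma bumpD: "bump L s f \<Longrightarrow> \<bar>f x - f y\<bar> \<le> L * \<bar>x - y\<bar>" "bump L s f \<Longrightarrow> s < \<bar>x\<bar> \<Longrightarrow> f x = 0"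
  by (auto simp: bump_def)

lemma bump_mono: "bump L s f \<Longrightarrow> s \<le> s' \<Longrightarrow> bump L s' f"
  by (auto simp: bump_def)

lemma bump_continuous:
  assumes "bump L s f"
  shows "continuous_on A f"
proof (rule continuous_on_subset[OF _ subset_UNIV])
  have "(\<bar>L\<bar>)-lipschitz_on UNIV f"
  proof (rule lipschitz_onI)
    fix x y :: real
    have "\<bar>f x - f y\<bar> \<le> L * \<bar>x - y\<bar>" by (rule bumpD(1)[OF assms])
    also have "\<dots> \<le> \<bar>L\<bar> * \<bar>x - y\<bar>" by (rule mult_right_mono) auto
    finally show "dist (f x) (f y) \<le> \<bar>L\<bar> * dist x y" by (simp add: dist_real_def)
  qed simp
  then show "continuous_on UNIV f" by (rule lipschitz_on_continuous_on)
qed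

lemma bump_measurable: "bump L s f \<Longrightarrow> f \<in> borel_measurable borel"
  by (intro borel_measurable_continuous_onI bump_continuous)

lemma bump_integrable:
  assumes "bump L s f"
  shows "integrable lborel f"
proof -
  have "integrable lborel (\<lambda>x. indicator {-\<bar>s\<bar>..\<bar>s\<bar>} x *\<^sub>R f x)"
    by (rule borel_integrable_compact[OF compact_Icc bump_continuous[OF assms]])
  also have "(\<lambda>x. indicator {-\<bar>s\<bar>..\<bar>s\<bar>} x *\<^sub>R f x) = f"
    using bumpD(2)[OF assms] by (auto simp: fun_eq_iff indicator_def) (smt (verit))+
  finally show ?thesis .
qed

lemma average_integrable:
  assumes "bump L s f"
  shows "integrable lborel (\<lambda>t. indicator {-1..1::real} t * f (x + a * t))"
proof -
  have "continuous_on {-1..1} (\<lambda>t. f (x + a * t))"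
    by (rule continuous_on_compose2[OF bump_continuous[OF assms, of UNIV]]) (auto intro!: continuous_intros)
  from borel_integrable_compact[OF compact_Icc this] show ?thesis by simp
qed

text \<open>Pointwise differences are averaged. With a translate of \<open>f\<close> for
  \<open>c\<close> this gives the Lipschitz bound, with a constant it gives the distance to
  \<open>f\<close>.\<close>

lemma average_diff_bound:
  assumes "bump L s f" and "\<And>t. \<bar>t\<bar> \<le> 1 \<Longrightarrow> \<bar>f (x + a * t) - c t\<bar> \<le> B"
    and c: "integrable lborel (\<lambda>t. indicator {-1..1::real} t * c t)"
  shows "\<bar>average a f x - (\<integral>t. indicator {-1..1} t * c t \<partial>lborel) / 2\<bar> \<le> B"
proof -
  have "\<bar>(\<integral>t. indicator {-1..1} t * f (x + a * t) \<partial>lborel) - (\<integral>t. indicator {-1..1} t * c t \<partial>lborel)\<bar>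
    = \<bar>\<integral>t. indicator {-1..1} t * f (x + a * t) - indicator {-1..1} t * c t \<partial>lborel\<bar>"
    by (subst Bochner_Integration.integral_diff[OF average_integrable[OF assms(1)] c]) simp
  also have "\<dots> \<le> (\<integral>t. \<bar>indicator {-1..1} t * f (x + a * t) - indicator {-1..1} t * c t\<bar> \<partial>lborel)"
    by (rule integral_abs_bound)
  also have "\<dots> \<le> (\<integral>t. B * indicator {-1..1::real} t \<partial>lborel)"
  proof (rule integral_mono)
    show "integrable lborel (\<lambda>t. \<bar>indicator {-1..1} t * f (x + a * t) - indicator {-1..1} t * c t\<bar>)"
      by (intro integrable_abs Bochner_Integration.integrable_diff average_integrable[OF assms(1)] c)
    show "integrable lborel (\<lambda>t. B * indicator {-1..1::real} t)"
      by (intro integrable_mult_right) (simp add: integrable_indicator_iff emeasure_lborel_Icc_eq)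
    show "\<bar>indicator {-1..1} t * f (x + a * t) - indicator {-1..1} t * c t\<bar> \<le> B * indicator {-1..1} t" for t
      using assms(2)[of t] by (auto simp: indicator_def abs_le_iff)
  qed
  also have "\<dots> = 2 * B" by simp
  finally show ?thesis by (simp add: average_def field_simps abs_le_iff)
qed

lemma average_bump:
  assumes f: "bump L s f" and a: "a \<ge> 0" and L: "L \<ge> 0"
  shows "bump L (s + a) (average a f)" "\<bar>average a f x - f x\<bar> \<le> L * a"
proof -
  show "bump L (s + a) (average a f)"
    unfolding bump_def
  proof (intro conjI allI impI)
    fix x y
    show "\<bar>average a f x - average a f y\<bar> \<le> L * \<bar>x - y\<bar>"
      unfolding average_def[of a f y]
    proof (rule average_diff_bound[OF f _ average_integrable[OF f]])
      show "\<bar>f (x + a * t) - f (y + a * t)\<bar> \<le> L * \<bar>x - y\<bar>" for t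
        using bumpD(1)[OF f, of "x + a * t" "y + a * t"] by simp
    qed
  next
    fix x assume x: "s + a < \<bar>x\<bar>"
    have "f (x + a * t) = 0" if "t \<in> {-1..1}" for t
    proof (rule bumpD(2)[OF f])
      have "\<bar>a * t\<bar> \<le> a * 1" unfolding abs_mult using that a by (intro mult_mono) auto
      then show "s < \<bar>x + a * t\<bar>" using x by linarith
    qed
    then have "(\<lambda>t. indicator {-1..1} t * f (x + a * t)) = (\<lambda>_. 0)"
      by (auto simp: fun_eq_iff indicator_def)
    then show "average a f x = 0" by (simp add: average_def)
  qed
  have "\<bar>average a f x - (\<integral>t. indicator {-1..1::real} t * f x \<partial>lborel) / 2\<bar> \<le> L * a"
  proof (rule average_diff_bound[OF f])
    fix t :: real assume t: "\<bar>t\<bar> \<le> 1"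
    have "\<bar>f (x + a * t) - f x\<bar> \<le> L * \<bar>a * t\<bar>" using bumpD(1)[OF f, of "x + a * t" x] by simp
    also have "\<dots> \<le> L * (a * 1)" unfolding abs_mult using a L t by (intro mult_left_mono mult_mono) auto
    finally show "\<bar>f (x + a * t) - f x\<bar> \<le> L * a" by simp
  qed (intro integrable_mult_left, simp add: integrable_indicator_iff emeasure_lborel_Icc_eq)
  moreover have "(\<integral>t. indicator {-1..1::real} t * f x \<partial>lborel) / 2 = f x"
  proof -
    have "(\<integral>t. indicator {-1..1::real} t * f x \<partial>lborel) = (\<integral>t. indicator {-1..1::real} t \<partial>lborel) * f x"
      by (rule integral_mult_left_zero)
    also have "(\<integral>t. indicator {-1..1::real} t \<partial>lborel) = (2::real)" by simp
    finally show ?thesis by (simp only:)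
  qed
  ultimately show "\<bar>average a f x - f x\<bar> \<le> L * a" by linarith
qed

lemma average_power_bump:
  assumes f: "bump L s f" and a: "a \<ge> 0" and L: "L \<ge> 0"
  shows "bump L (s + real n * a) ((average a ^^ n) f) \<and> \<bar>(average a ^^ n) f x - f x\<bar> \<le> L * (real n * a)"
proof (induction n)
  case (Suc n)
  then have b: "bump L (s + real n * a) ((average a ^^ n) f)" by simp
  have "s + real (Suc n) * a = s + real n * a + a" by (simp add: algebra_simps)
  then have 1: "bump L (s + real (Suc n) * a) ((average a ^^ Suc n) f)"
    using average_bump(1)[OF b a L] by (simp only: funpow.simps o_apply)
  have "\<bar>(average a ^^ Suc n) f x - (average a ^^ n) f x\<bar> \<le> L * a"
    using average_bump(2)[OF b a L, of x] by simp
  then have "\<bar>(average a ^^ Suc n) f x - f x\<bar> \<le> L * a + L * (real n * a)" using Suc by linarith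
  then show ?case using 1 by (simp add: algebra_simps)
qed (use f in simp)

section \<open>Fourier transforms of averages\<close>

definition fourier1 :: "(real \<Rightarrow> real) \<Rightarrow> real \<Rightarrow> complex" where
  "fourier1 f \<xi> = (\<integral>x. complex_of_real (f x) * cis (- (2 * pi * \<xi> * x)) \<partial>lborel)"

text \<open>This is \<open>sin y / y\<close>; the integral form makes \<open>0\<close> no
  exception.\<close>

definition multiplier :: "real \<Rightarrow> complex" where
  "multiplier y = (\<integral>t. complex_of_real (indicator {-1..1} t / 2) * cis (y * t) \<partial>lborel)"

lemma cis_continuous [continuous_intros]: "continuous_on A h \<Longrightarrow> continuous_on A (\<lambda>x. cis (h x))"
  by (rule continuous_on_compose2[OF continuous_on_cis[OF continuous_on_id]]) auto

text \<open>The source of all decay: each averaging contributes one such factor to the Fourier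
  transform.\<close>

lemma norm_multiplier_le:
  assumes "y > 0"
  shows "norm (multiplier y) \<le> 1 / y"
proof -
  have "has_bochner_integral lborel (\<lambda>t. indicator {-1..1} t *\<^sub>R (cis (y * t)))
    (- \<i> / y * cis (y * 1) - (- \<i> / y * cis (y * (-1))))"
  proof (rule has_bochner_integral_FTC_Icc)
    show "((\<lambda>t. - \<i> / y * cis (y * t)) has_vector_derivative cis (y * t)) (at t within {-1..1})" for t
    proof -
      have "((\<lambda>t. - \<i> / y * cis (y * t)) has_vector_derivative (- \<i> / y * ((y * \<i>) * cis (y * t)))) (at t)"
        unfolding cis_conv_exp
        by (auto intro!: derivative_eq_intros has_vector_derivative_real_field simp: algebra_simps)
      then show ?thesis using assms by (simp add: has_vector_derivative_at_within)
    qed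
    show "continuous_on {-1..1} (\<lambda>t. cis (y * t))" by (intro continuous_intros)
  qed simp
  then have "(\<integral>t. indicator {-1..1} t *\<^sub>R (cis (y * t)) \<partial>lborel)
    = (- \<i> / y * cis (y * 1) - (- \<i> / y * cis (y * (-1))))" by (simp add: has_bochner_integral_iff)
  moreover have "norm (- \<i> / y * cis (y * 1) - (- \<i> / y * cis (y * (-1)))) \<le> 2 / y"
    using norm_triangle_ineq4[of "- \<i> / y * cis (y * 1)" "- \<i> / y * cis (y * (-1))"] assms
    by (simp add: norm_mult norm_divide)
  moreover have "multiplier y = (\<integral>t. indicator {-1..1} t *\<^sub>R (cis (y * t)) \<partial>lborel) / 2"
    unfolding multiplier_def by (subst integral_divide_zero[symmetric], intro Bochner_Integration.integral_cong)
      (auto simp: scaleR_conv_of_real)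
  ultimately have "norm (multiplier y) * 2 \<le> 2 / y" by (simp only: norm_divide norm_numeral)
  then show ?thesis by simp
qed

lemma fourier1_integrable:
  assumes "integrable lborel f"
  shows "integrable lborel (\<lambda>x. complex_of_real (f x) * cis (- (2 * pi * \<xi> * x)))"
  by (rule Bochner_Integration.integrable_bound[OF assms]) (use assms in \<open>auto simp: norm_mult\<close>)

lemma norm_fourier1_le:
  assumes "integrable lborel f"
  shows "norm (fourier1 f \<xi>) \<le> (\<integral>x. \<bar>f x\<bar> \<partial>lborel)"
proof -
  have "norm (fourier1 f \<xi>) \<le> (\<integral>x. norm (complex_of_real (f x) * cis (- (2 * pi * \<xi> * x))) \<partial>lborel)"
    unfolding fourier1_def by (rule integral_norm_bound)
  then show ?thesis by (simp add: norm_mult)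
qed

lemma norm_multiplier_le_1: "norm (multiplier y) \<le> 1"
proof -
  have "norm (multiplier y) \<le> (\<integral>t. norm (complex_of_real (indicator {-1..1} t / 2) * cis (y * t)) \<partial>lborel)"
    unfolding multiplier_def by (rule integral_norm_bound)
  then show ?thesis by (simp add: norm_mult)
qed

lemma multiplier_0: "multiplier 0 = 1"
  by (simp add: multiplier_def)

lemma multiplier_minus: "norm (multiplier (- y)) = norm (multiplier y)"
proof -
  have "multiplier (- y) = (\<integral>t. cnj (complex_of_real (indicator {-1..1} t / 2) * cis (y * t)) \<partial>lborel)"
    unfolding multiplier_def by (simp add: cis_cnj)
  also have "\<dots> = cnj (multiplier y)" unfolding multiplier_def by (rule Bochner_Integration.integral_cnj)
  finally show ?thesis by simp
qed

text \<open>The convolution theorem for this kernel: Fubini's theorem and a translation of the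
  variable by \<open>a * t\<close>.\<close>

lemma fourier1_average:
  assumes f: "bump L s f"
  shows "fourier1 (average a f) \<xi> = multiplier (2 * pi * a * \<xi>) * fourier1 f \<xi>"
proof -
  have [measurable]: "f \<in> borel_measurable borel" by (rule bump_measurable[OF f])
  have fi: "integrable lborel f" by (rule bump_integrable[OF f])
  let ?h = "\<lambda>t. complex_of_real (indicator {-1..1} t / 2)"
  let ?e = "\<lambda>x. cis (- (2 * pi * \<xi> * x))"
  have "integrable lborel (\<lambda>t::real. indicator {-1..1} t * (1 / 2) :: real)"
    by (intro integrable_mult_left) (simp add: integrable_indicator_iff emeasure_lborel_Icc_eq)
  then have hi: "integrable lborel (\<lambda>t::real. indicator {-1..1} t / 2 :: real)" by simp
  have shift: "integrable lborel (\<lambda>x. f (x + a * t))" for t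
    using lborel_integrable_real_affine[OF fi, of 1 "a * t"] by (simp add: add.commute)
  have int: "integrable (lborel \<Otimes>\<^sub>M lborel) (\<lambda>(t, x). ?h t * (complex_of_real (f (x + a * t)) * ?e x))"
  proof (rule lborel_pair.Fubini_integrable)
    show "(\<lambda>(t, x). ?h t * (complex_of_real (f (x + a * t)) * ?e x)) \<in> borel_measurable (lborel \<Otimes>\<^sub>M lborel)"
      by measurable
    have "(\<integral>x. norm (case (t, x) of (t, x) \<Rightarrow> ?h t * (complex_of_real (f (x + a * t)) * ?e x)) \<partial>lborel)
      = indicator {-1..1} t / 2 * (\<integral>x. \<bar>f x\<bar> \<partial>lborel)" for t
    proof -
      have "(\<integral>x. \<bar>f x\<bar> \<partial>lborel) = (\<integral>x. \<bar>f (x + a * t)\<bar> \<partial>lborel)"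
        using lborel_integral_real_affine[of 1 "\<lambda>x. \<bar>f x\<bar>" "a * t"] by (simp add: add.commute)
      then show ?thesis by (simp add: norm_mult)
    qed
    then show "integrable lborel (\<lambda>t. \<integral>x. norm (case (t, x) of (t, x) \<Rightarrow> ?h t * (complex_of_real (f (x + a * t)) * ?e x)) \<partial>lborel)"
      using hi by simp
    show "AE t in lborel. integrable lborel (\<lambda>x. case (t, x) of (t, x) \<Rightarrow> ?h t * (complex_of_real (f (x + a * t)) * ?e x))"
      using fourier1_integrable[OF shift] by (intro AE_I2) (simp only: prod.case integrable_mult_right)
  qed
  have "fourier1 (average a f) \<xi> = (\<integral>x. \<integral>t. ?h t * (complex_of_real (f (x + a * t)) * ?e x) \<partial>lborel \<partial>lborel)"
    unfolding fourier1_def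
  proof (intro Bochner_Integration.integral_cong refl)
    fix x
    have "complex_of_real (average a f x) = complex_of_real (\<integral>t. indicator {-1..1} t * f (x + a * t) / 2 \<partial>lborel)"
      by (simp add: average_def)
    also have "\<dots> = (\<integral>t. complex_of_real (indicator {-1..1} t * f (x + a * t) / 2) \<partial>lborel)"
      by (rule integral_complex_of_real[symmetric])
    finally have "complex_of_real (average a f x) * ?e x
      = (\<integral>t. complex_of_real (indicator {-1..1} t * f (x + a * t) / 2) \<partial>lborel) * ?e x" by simp
    also have "\<dots> = (\<integral>t. complex_of_real (indicator {-1..1} t * f (x + a * t) / 2) * ?e x \<partial>lborel)"
      by (rule integral_mult_left_zero[symmetric])
    finally show "complex_of_real (average a f x) * ?e x = (\<integral>t. ?h t * (complex_of_real (f (x + a * t)) * ?e x) \<partial>lborel)"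
      by (simp add: mult_ac)
  qed
  also have "\<dots> = (\<integral>t. \<integral>x. ?h t * (complex_of_real (f (x + a * t)) * ?e x) \<partial>lborel \<partial>lborel)"
    by (rule lborel_pair.Fubini_integral[OF int])
  also have "\<dots> = (\<integral>t. (?h t * cis (2 * pi * a * \<xi> * t)) * fourier1 f \<xi> \<partial>lborel)"
  proof (intro Bochner_Integration.integral_cong refl)
    fix t
    have "fourier1 f \<xi> = (\<integral>x. complex_of_real (f (a * t + 1 * x)) * ?e (a * t + 1 * x) \<partial>lborel)"
      unfolding fourier1_def by (subst lborel_integral_real_affine[of 1 _ "a * t"]) auto
    also have "\<dots> = (\<integral>x. cis (- (2 * pi * a * \<xi> * t)) * (complex_of_real (f (x + a * t)) * ?e x) \<partial>lborel)"
    proof (intro Bochner_Integration.integral_cong refl)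
      fix x
      have "?e (a * t + 1 * x) = cis (- (2 * pi * a * \<xi> * t)) * ?e x"
        by (simp add: cis_mult algebra_simps)
      then show "complex_of_real (f (a * t + 1 * x)) * ?e (a * t + 1 * x)
        = cis (- (2 * pi * a * \<xi> * t)) * (complex_of_real (f (x + a * t)) * ?e x)"
        by (simp add: add.commute mult_ac)
    qed
    also have "\<dots> = cis (- (2 * pi * a * \<xi> * t)) * (\<integral>x. complex_of_real (f (x + a * t)) * ?e x \<partial>lborel)"
      by (rule integral_mult_right_zero)
    finally have "cis (2 * pi * a * \<xi> * t) * fourier1 f \<xi>
      = (cis (2 * pi * a * \<xi> * t) * cis (- (2 * pi * a * \<xi> * t))) * (\<integral>x. complex_of_real (f (x + a * t)) * ?e x \<partial>lborel)"
      by (simp only: mult.assoc)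
    then have eq: "(\<integral>x. complex_of_real (f (x + a * t)) * ?e x \<partial>lborel) = cis (2 * pi * a * \<xi> * t) * fourier1 f \<xi>"
      by (simp add: cis_mult)
    have "(\<integral>x. ?h t * (complex_of_real (f (x + a * t)) * ?e x) \<partial>lborel)
      = ?h t * (\<integral>x. complex_of_real (f (x + a * t)) * ?e x \<partial>lborel)" by (rule integral_mult_right_zero)
    then show "(\<integral>x. ?h t * (complex_of_real (f (x + a * t)) * ?e x) \<partial>lborel) = (?h t * cis (2 * pi * a * \<xi> * t)) * fourier1 f \<xi>"
      unfolding eq by (simp only: mult.assoc)
  qed
  also have "\<dots> = (\<integral>t. ?h t * cis (2 * pi * a * \<xi> * t) \<partial>lborel) * fourier1 f \<xi>"
    by (rule integral_mult_left_zero)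
  finally show ?thesis by (simp only: multiplier_def)
qed

lemma fourier1_average_power:
  assumes f: "bump L s f" and a: "a \<ge> 0" and L: "L \<ge> 0"
  shows "fourier1 ((average a ^^ n) f) \<xi> = multiplier (2 * pi * a * \<xi>) ^ n * fourier1 f \<xi>"
proof (induction n)
  case (Suc n)
  have "bump L (s + real n * a) ((average a ^^ n) f)" using average_power_bump[OF f a L, of n] by blast
  from fourier1_average[OF this, of a \<xi>] Suc show ?case by (simp add: mult_ac)
qed simp

section \<open>Weights with convergent integral\<close>

text \<open>By monotonicity an infinite value at \<open>t0\<close> makes the integrand infinite on a
  whole interval of length \<open>1\<close>.\<close>

lemma weight_finite_of_integral:
  fixes W :: "real \<Rightarrow> ennreal"
  assumes mono: "mono_on {0..} W"
    and fin: "(\<integral>\<^sup>+t\<in>{0..}. e2ennreal (ext_ln (W t) / ereal (1 + t\<^sup>2)) \<partial>lborel) < \<infinity>"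
  shows "\<not> (\<exists>t\<ge>0. W t = \<infinity>)"
proof
  assume "\<exists>t\<ge>0. W t = \<infinity>"
  then obtain t0 where t0: "t0 \<ge> 0" "W t0 = \<infinity>" by blast
  have top: "e2ennreal (ext_ln (W t) / ereal (1 + t\<^sup>2)) = \<infinity>" if "t \<ge> t0" for t
  proof -
    have "W t0 \<le> W t" using that t0 by (intro mono_onD[OF mono]) auto
    then have "W t = \<infinity>" using t0 by (simp add: top_unique)
    moreover have "1 + t\<^sup>2 > 0" by (simp add: add_pos_nonneg)
    ultimately show ?thesis by (simp add: ext_ln_def)
  qed
  have "(\<infinity>::ennreal) = (\<integral>\<^sup>+t. \<infinity> * indicator {t0..t0 + 1} t \<partial>lborel)"
    by (subst nn_integral_cmult_indicator) (auto simp: ennreal_top_mult)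
  also have "\<dots> \<le> (\<integral>\<^sup>+t\<in>{0..}. e2ennreal (ext_ln (W t) / ereal (1 + t\<^sup>2)) \<partial>lborel)"
    using top t0 by (intro nn_integral_mono) (auto simp: indicator_def)
  finally show False using fin by (simp add: top_unique)
qed

text \<open>On the dyadic interval \<open>I k\<close>, \<open>ln W\<close> is at least its value at
  the left end, and the length divided by \<open>1 + t\<^sup>2\<close> is at least of order
  \<open>1 / 2 ^ k\<close>. The intervals are half-open and hence disjoint, so the lower bounds add
  up to at most the integral.\<close>

lemma convergent_dyadic_sum:
  fixes W :: "real \<Rightarrow> ennreal"
  assumes W0: "W 0 = 1" and mono: "mono_on {0..} W"
    and fin: "(\<integral>\<^sup>+t\<in>{0..}. e2ennreal (ext_ln (W t) / ereal (1 + t\<^sup>2)) \<partial>lborel) < \<infinity>"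
  shows "summable (\<lambda>k::nat. ln (enn2real (W (2 ^ Suc k))) / 2 ^ k)"
proof -
  define w where "w = (\<lambda>t. enn2real (W t))"
  note finW = weight_finite_of_integral[OF mono fin]
  have Ww: "W t = ennreal (w t)" if "t \<ge> 0" for t
    using ennreal_finite_weight[OF finW that] by (simp add: w_def)
  have wmono: "w s \<le> w t" if "0 \<le> s" "s \<le> t" for s t
    using mono that finW by (auto simp: w_def mono_on_def less_top intro!: enn2real_mono)
  have w1: "1 \<le> w t" if "0 \<le> t" for t
    using wmono[of 0 t] that W0 by (simp add: w_def)
  define b where "b = (\<lambda>k::nat. ln (w (2 ^ Suc k)) / (2 * 4 ^ (k + 2)))"
  have b0: "b k \<ge> 0" for k using w1[of "2 ^ Suc k"] by (simp add: b_def)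
  define I where "I = (\<lambda>k::nat. {2 ^ Suc k..<2 ^ Suc (Suc k) :: real})"
  let ?F = "\<lambda>t. e2ennreal (ext_ln (W t) / ereal (1 + t\<^sup>2)) * indicator {0..} t"
  have ptw: "ennreal (b k) \<le> ?F t" if t: "t \<in> I k" for k t
  proof -
    have t1: "2 ^ Suc k \<le> t" "t < 2 ^ (k + 2)" using t by (auto simp: I_def)
    have "(1::real) \<le> 2 ^ Suc k" by (rule one_le_power) simp
    then have t0: "t \<ge> 1" using t1 by linarith
    have "1 + t\<^sup>2 > 0" by (simp add: add_pos_nonneg)
    then have eq: "?F t = ennreal (ln (w t) / (1 + t\<^sup>2))"
      using Ww[of t] w1[of t] t0 by (simp add: ext_ln_def e2ennreal_ereal)
    have "t\<^sup>2 \<le> (2 ^ (k + 2))\<^sup>2" using t0 t1 by (intro power_mono) auto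
    also have "(2 ^ (k + 2) :: real)\<^sup>2 = 4 ^ (k + 2)" by (simp add: power2_eq_square power_mult_distrib[symmetric])
    finally have "1 + t\<^sup>2 \<le> 2 * 4 ^ (k + 2)" using one_le_power[of "4::real" "k + 2"] by linarith
    moreover have "ln (w (2 ^ Suc k)) \<le> ln (w t)" using wmono[OF _ t1(1)] w1[of "2 ^ Suc k"] by simp
    ultimately have "b k \<le> ln (w t) / (1 + t\<^sup>2)"
      unfolding b_def using w1[of t] t0 by (intro frac_le) (auto simp: add_pos_nonneg)
    then show ?thesis unfolding eq by (rule ennreal_leI)
  qed
  have disj: "k = j" if "t \<in> I k" "t \<in> I j" for k j t
  proof (rule ccontr)
    have *: False if "k < j" "t \<in> I k" "t \<in> I j" for k j
    proof -
      have "(2::real) ^ Suc (Suc k) \<le> 2 ^ Suc j" using that(1) by (intro power_increasing) auto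
      then show False using that by (auto simp: I_def)
    qed
    assume "k \<noteq> j"
    then show False using * that by (metis linorder_neq_iff)
  qed
  have part: "ennreal (\<Sum>k<n. b k * 2 ^ Suc k) \<le> (\<integral>\<^sup>+t. ?F t \<partial>lborel)" for n
  proof -
    have "ennreal (\<Sum>k<n. b k * 2 ^ Suc k) = (\<Sum>k<n. ennreal (b k) * emeasure lborel (I k))"
    proof -
      have meas: "emeasure lborel (I k) = ennreal (2 ^ Suc k)" for k
        unfolding I_def by (subst emeasure_lborel_Ico) simp_all
      have "ennreal (b k * 2 ^ Suc k) = ennreal (b k) * emeasure lborel (I k)" for k
        unfolding meas by (rule ennreal_mult[OF b0]) simp
      moreover have "ennreal (\<Sum>k<n. b k * 2 ^ Suc k) = (\<Sum>k<n. ennreal (b k * 2 ^ Suc k))"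
        by (intro sum_ennreal[symmetric] mult_nonneg_nonneg b0) simp
      ultimately show ?thesis by (simp only:)
    qed
    also have "\<dots> = (\<Sum>k<n. \<integral>\<^sup>+t. ennreal (b k) * indicator (I k) t \<partial>lborel)"
      by (intro sum.cong refl nn_integral_cmult_indicator[symmetric]) (simp add: I_def)
    also have "\<dots> = (\<integral>\<^sup>+t. (\<Sum>k<n. ennreal (b k) * indicator (I k) t) \<partial>lborel)"
      by (intro nn_integral_sum[symmetric]) (simp add: I_def)
    also have "\<dots> \<le> (\<integral>\<^sup>+t. ?F t \<partial>lborel)"
    proof (intro nn_integral_mono)
      fix t
      show "(\<Sum>k<n. ennreal (b k) * indicator (I k) t) \<le> ?F t"
      proof (cases "\<exists>j<n. t \<in> I j")
        case False
        then have "(\<Sum>k<n. ennreal (b k) * indicator (I k) t) = 0" by (intro sum.neutral) auto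
        then show ?thesis by simp
      next
        case True
        then obtain j where j: "j < n" "t \<in> I j" by blast
        have "(\<Sum>k<n. ennreal (b k) * indicator (I k) t) = (\<Sum>k<n. if k = j then ennreal (b j) else 0)"
        proof (intro sum.cong refl)
          fix k
          show "ennreal (b k) * indicator (I k) t = (if k = j then ennreal (b j) else 0)"
          proof (cases "t \<in> I k")
            case True
            then have "k = j" using disj j(2) by blast
            then show ?thesis using j(2) by simp
          next
            case False
            then have "k \<noteq> j" using j(2) by blast
            then show ?thesis using False by simp
          qed
        qed
        also have "\<dots> = ennreal (b j)" using j by simp
        finally show ?thesis using ptw[OF j(2)] by simp
      qed
    qed
    finally show ?thesis .
  qed
  have "summable (\<lambda>k. b k * 2 ^ Suc k)"
  proof (rule summableI_nonneg_bounded)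
    show "0 \<le> b k * 2 ^ Suc k" for k using b0 by simp
    fix n
    obtain R where R: "R \<ge> 0" "(\<integral>\<^sup>+t. ?F t \<partial>lborel) = ennreal R" using fin by (cases "\<integral>\<^sup>+t. ?F t \<partial>lborel") auto
    have "ennreal (\<Sum>k<n. b k * 2 ^ Suc k) \<le> ennreal R" using part[of n] unfolding R(2) .
    then have "(\<Sum>k<n. b k * 2 ^ Suc k) \<le> R" using R(1) by (simp add: ennreal_le_iff)
    also have "R = enn2real (\<integral>\<^sup>+t. ?F t \<partial>lborel)" unfolding R(2) using R(1) by simp
    finally show "(\<Sum>k<n. b k * 2 ^ Suc k) \<le> enn2real (\<integral>\<^sup>+t. ?F t \<partial>lborel)" .
  qed
  \<comment> \<open>The constant follows from
    \<open>b k * 2 ^ Suc k = ln (w (2 ^ Suc k)) / (16 * 2 ^ k)\<close>.\<close>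
  then have s16: "summable (\<lambda>k. 16 * (b k * 2 ^ Suc k))" by (rule summable_mult)
  have eq: "16 * (b k * 2 ^ Suc k) = ln (w (2 ^ Suc k)) / 2 ^ k" for k
  proof -
    have "(4::real) ^ k = 2 ^ k * 2 ^ k" by (simp add: power_mult_distrib[symmetric])
    then show ?thesis by (simp add: b_def field_simps)
  qed
  show ?thesis using s16 unfolding eq w_def .
qed

text \<open>
  The tent is smoothed at the dyadic scales \<open>2\<^sup>-\<^sup>k\<close>, \<open>k \<ge> K\<close>, with \<open>n k\<close> averagings at scale \<open>k\<close>;
  each of them contributes a factor at most \<open>1/e\<close> to the Fourier transform on \<open>\<bar>\<xi>\<bar> \<ge> 2\<^sup>k\<close>.
\<close>

definition tent :: "real \<Rightarrow> real" where
  "tent x = max 0 (1 / 16 - \<bar>x\<bar>)"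

lemma tent_bump: "bump 1 (1 / 16) tent"
  by (auto simp: bump_def tent_def)

lemma tent_integral_pos: "(\<integral>x. tent x \<partial>lborel) > 0"
proof -
  have "0 < (\<integral>x. 1 / 32 * indicator {- (1 / 32)..1 / 32 :: real} x \<partial>lborel :: real)" by simp
  also have "\<dots> \<le> (\<integral>x. tent x \<partial>lborel)"
  proof (rule integral_mono)
    show "integrable lborel (\<lambda>x. 1 / 32 * indicator {- (1 / 32)..1 / 32 :: real} x :: real)"
      by (intro integrable_mult_right) (simp add: integrable_indicator_iff emeasure_lborel_Icc_eq)
    show "integrable lborel tent" by (rule bump_integrable[OF tent_bump])
    show "1 / 32 * indicator {- (1 / 32)..1 / 32} x \<le> tent x" for x
      by (auto simp: tent_def indicator_def)
  qed
  finally show ?thesis .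
qed

fun smoothing :: "(nat \<Rightarrow> nat) \<Rightarrow> nat \<Rightarrow> nat \<Rightarrow> real \<Rightarrow> real" where
  "smoothing n K 0 = tent"
| "smoothing n K (Suc j) = (average (1 / 2 ^ (K + j)) ^^ n (K + j)) (smoothing n K j)"

lemma smoothing_bump:
  "bump 1 (1 / 16 + (\<Sum>i<j. real (n (K + i)) / 2 ^ (K + i))) (smoothing n K j)"
proof (induction j)
  case (Suc j)
  from average_power_bump[OF Suc, of "1 / 2 ^ (K + j)" "n (K + j)"] show ?case by (simp add: add.assoc)
qed (simp add: tent_bump)

text \<open>The Lipschitz constant stays \<open>1\<close>, so the change is at most the total length
  of the averagings at this scale. Summability of these lengths makes the construction
  converge.\<close>

lemma smoothing_step:
  "\<bar>smoothing n K (Suc j) x - smoothing n K j x\<bar> \<le> real (n (K + j)) / 2 ^ (K + j)"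
  using average_power_bump[OF smoothing_bump[of n K j], of "1 / 2 ^ (K + j)" "n (K + j)" x] by simp

lemma smoothing_fourier:
  "fourier1 (smoothing n K j) \<xi> = (\<Prod>i<j. multiplier (2 * pi * (1 / 2 ^ (K + i)) * \<xi>) ^ n (K + i)) * fourier1 tent \<xi>"
proof (induction j)
  case (Suc j)
  have "fourier1 (smoothing n K (Suc j)) \<xi> = multiplier (2 * pi * (1 / 2 ^ (K + j)) * \<xi>) ^ n (K + j) * fourier1 (smoothing n K j) \<xi>"
    using fourier1_average_power[OF smoothing_bump[of n K j], of "1 / 2 ^ (K + j)" "n (K + j)" \<xi>] by simp
  then show ?case using Suc by (simp add: mult_ac)
qed simp

text \<open>At such frequencies the argument is at least \<open>2 * pi\<close>, which exceeds
  \<open>exp 1\<close>, and the bound \<open>1 / y\<close> suffices.\<close>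

lemma multiplier_small:
  assumes "2 ^ k \<le> \<bar>\<xi>\<bar>"
  shows "norm (multiplier (2 * pi * (1 / 2 ^ k) * \<xi>)) \<le> exp (- 1)"
proof -
  define y where "y = 2 * pi * (1 / 2 ^ k) * \<bar>\<xi>\<bar>"
  have "1 \<le> \<bar>\<xi>\<bar> / 2 ^ k" using assms by simp
  then have "2 * pi * 1 \<le> 2 * pi * (\<bar>\<xi>\<bar> / 2 ^ k)" by (intro mult_left_mono) auto
  then have y: "y \<ge> 2 * pi" by (simp add: y_def)
  have y0: "y > 0" using y pi_gt3 by linarith
  have "norm (multiplier (2 * pi * (1 / 2 ^ k) * \<xi>)) = norm (multiplier y)"
  proof (cases "\<xi> \<ge> 0")
    case False
    then have "2 * pi * (1 / 2 ^ k) * \<xi> = - y" by (simp add: y_def)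
    then show ?thesis by (simp only: multiplier_minus)
  qed (simp add: y_def)
  also have "\<dots> \<le> 1 / y" by (rule norm_multiplier_le[OF y0])
  also have "\<dots> \<le> 1 / exp 1" using y pi_gt3 exp_le by (intro divide_left_mono) auto
  finally show ?thesis by (simp add: exp_minus field_simps)
qed

text \<open>The support stays bounded because the lengths have a finite sum. The limit is not zero
  because averaging preserves the integral (the multiplier is \<open>1\<close> at \<open>0\<close>).
  For the decay at \<open>2 ^ k \<le> \<bar>\<xi>\<bar>\<close> only the \<open>n k\<close> factors
  of scale \<open>k\<close> are used; all others have norm at most \<open>1\<close>.\<close>

lemma compactly_supported_with_fast_decay:
  assumes n: "summable (\<lambda>k. real (n k) / 2 ^ k)"
  obtains f K A where "bump 1 (1 / 4) f" "fourier1 f 0 \<noteq> 0" "A \<ge> 0"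
    "\<And>\<xi>. norm (fourier1 f \<xi>) \<le> A"
    "\<And>k \<xi>. K \<le> k \<Longrightarrow> 2 ^ k \<le> \<bar>\<xi>\<bar> \<Longrightarrow> norm (fourier1 f \<xi>) \<le> A * exp (- real (n k))"
proof -
  have "(\<lambda>K. \<Sum>i. real (n (i + K)) / 2 ^ (i + K)) \<longlonglongrightarrow> 0" by (rule suminf_exist_split2[OF n])
  then have "\<forall>\<^sub>F K in sequentially. (\<Sum>i. real (n (i + K)) / 2 ^ (i + K)) < 1 / 8"
    by (rule order_tendstoD) simp
  \<comment> \<open>The radius \<open>1 / 16\<close> of the tent and a total smoothing length below
    \<open>1 / 8\<close> leave the support inside \<open>{-1/4..1/4}\<close>.\<close>
  then obtain K where K: "(\<Sum>i. real (n (i + K)) / 2 ^ (i + K)) < 1 / 8"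
    by (auto simp: eventually_sequentially)
  define b where "b = (\<lambda>i. real (n (K + i)) / 2 ^ (K + i))"
  have b0: "b i \<ge> 0" for i by (simp add: b_def)
  have bsum: "summable b" using summable_ignore_initial_segment[OF n, of K] by (simp add: b_def add.commute)
  have b8: "suminf b < 1 / 8" using K by (simp add: b_def add.commute)
  let ?f = "smoothing n K"
  have fb: "bump 1 (1 / 4) (?f j)" for j
  proof (rule bump_mono[OF smoothing_bump])
    have "(\<Sum>i<j. b i) \<le> suminf b" using b0 by (intro sum_le_suminf bsum) auto
    then show "1 / 16 + (\<Sum>i<j. real (n (K + i)) / 2 ^ (K + i)) \<le> 1 / 4" using b8 by (simp add: b_def)
  qed
  have conv: "convergent (\<lambda>j. ?f j x)" for x
  proof -
    have "summable (\<lambda>j. ?f (Suc j) x - ?f j x)"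
      using smoothing_step[of n K _ x] by (intro summable_comparison_test'[OF bsum, of 0]) (simp add: b_def)
    then have "convergent (\<lambda>m. \<Sum>j<m. ?f (Suc j) x - ?f j x)" by (simp add: summable_iff_convergent)
    then have "convergent (\<lambda>m. ?f m x - ?f 0 x)" by (simp only: sum_lessThan_telescope[of "\<lambda>j. ?f j x"])
    then show ?thesis using convergent_diff_const_right_iff by blast
  qed
  define f where "f = (\<lambda>x. lim (\<lambda>j. ?f j x))"
  have lim: "(\<lambda>j. ?f j x) \<longlonglongrightarrow> f x" for x
    using conv[of x] by (simp add: f_def convergent_LIMSEQ_iff)
  have fbump: "bump 1 (1 / 4) f"
    unfolding bump_def
  proof (intro conjI allI impI)
    fix x y
    have "(\<lambda>j. \<bar>?f j x - ?f j y\<bar>) \<longlonglongrightarrow> \<bar>f x - f y\<bar>" by (intro tendsto_intros lim)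
    then show "\<bar>f x - f y\<bar> \<le> 1 * \<bar>x - y\<bar>" using bumpD(1)[OF fb] by (intro LIMSEQ_le_const2) auto
  next
    fix x :: real assume "1 / 4 < \<bar>x\<bar>"
    then have "(\<lambda>j. ?f j x) = (\<lambda>_. 0)" using bumpD(2)[OF fb] by auto
    then show "f x = 0" using lim[of x] by (simp add: LIMSEQ_const_iff)
  qed
  have flim: "(\<lambda>j. fourier1 (?f j) \<xi>) \<longlonglongrightarrow> fourier1 f \<xi>" for \<xi>
    unfolding fourier1_def
  proof (rule integral_dominated_convergence[where w = "\<lambda>x. indicator {-1..1} x"])
    show "(\<lambda>x. complex_of_real (f x) * cis (- (2 * pi * \<xi> * x))) \<in> borel_measurable lborel"
      using bump_measurable[OF fbump] by measurable
    show "(\<lambda>x. complex_of_real (?f j x) * cis (- (2 * pi * \<xi> * x))) \<in> borel_measurable lborel" for j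
      using bump_measurable[OF fb[of j]] by measurable
    show "integrable lborel (\<lambda>x::real. indicator {-1..1} x :: real)"
      by (simp add: integrable_indicator_iff emeasure_lborel_Icc_eq)
    show "AE x in lborel. (\<lambda>j. complex_of_real (?f j x) * cis (- (2 * pi * \<xi> * x))) \<longlonglongrightarrow> complex_of_real (f x) * cis (- (2 * pi * \<xi> * x))"
      by (intro AE_I2 tendsto_intros lim)
    fix j
    have "\<bar>?f j x\<bar> \<le> indicator {-1..1} x" for x
    proof (cases "\<bar>x\<bar> \<le> 1 / 4")
      case True
      \<comment> \<open>A bound independent of \<open>j\<close>: the function vanishes at
        \<open>1 / 2\<close> and has Lipschitz constant \<open>1\<close>.\<close>
      have "\<bar>?f j x - ?f j (1 / 2)\<bar> \<le> 1 * \<bar>x - 1 / 2\<bar>" by (rule bumpD(1)[OF fb])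
      moreover have "?f j (1 / 2) = 0" by (rule bumpD(2)[OF fb]) simp
      ultimately have "\<bar>?f j x\<bar> \<le> \<bar>x - 1 / 2\<bar>" by simp
      also have "\<dots> \<le> 1" using True by (simp add: abs_le_iff)
      finally have "\<bar>?f j x\<bar> \<le> 1" .
      moreover have "x \<in> {-1..1}" using True by auto
      ultimately show ?thesis by simp
    next
      case False
      then show ?thesis using bumpD(2)[OF fb[of j], of x] by simp
    qed
    then show "AE x in lborel. norm (complex_of_real (?f j x) * cis (- (2 * pi * \<xi> * x))) \<le> indicator {-1..1} x"
      by (intro AE_I2) (simp add: norm_mult)
  qed
  define A where "A = (\<integral>x. \<bar>tent x\<bar> \<partial>lborel)"
  have A0: "A \<ge> 0" unfolding A_def by (intro integral_nonneg_AE) auto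
  have tA: "norm (fourier1 tent \<xi>) \<le> A" for \<xi>
    unfolding A_def by (rule norm_fourier1_le[OF bump_integrable[OF tent_bump]])
  have le1: "norm (multiplier y ^ m) \<le> 1" for y m
    unfolding norm_power using norm_multiplier_le_1 by (intro power_le_one) auto
  have fA: "norm (fourier1 (?f j) \<xi>) \<le> A" for j \<xi>
  proof -
    have "norm (fourier1 (?f j) \<xi>) \<le> 1 * A"
      unfolding smoothing_fourier norm_mult prod_norm[symmetric]
      by (intro mult_mono tA prod_le_1) (use le1 in auto)
    then show ?thesis by simp
  qed
  show ?thesis
  proof (rule that[of f A K])
    show "bump 1 (1 / 4) f" by (rule fbump)
    show "A \<ge> 0" by (rule A0)
    have t0: "fourier1 tent 0 = complex_of_real (\<integral>x. tent x \<partial>lborel)" by (simp add: fourier1_def)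
    have "fourier1 (?f j) 0 = complex_of_real (\<integral>x. tent x \<partial>lborel)" for j
      unfolding smoothing_fourier t0 by (simp add: multiplier_0)
    then have "fourier1 f 0 = complex_of_real (\<integral>x. tent x \<partial>lborel)"
      using flim[of 0] by (simp add: LIMSEQ_const_iff)
    then show "fourier1 f 0 \<noteq> 0" using tent_integral_pos by simp
    show "norm (fourier1 f \<xi>) \<le> A" for \<xi>
      by (intro LIMSEQ_le_const2[OF tendsto_norm[OF flim[of \<xi>]]]) (simp add: fA)
    fix k and \<xi> :: real assume k: "K \<le> k" "2 ^ k \<le> \<bar>\<xi>\<bar>"
    have "norm (fourier1 (?f j) \<xi>) \<le> A * exp (- real (n k))" if j: "j \<ge> Suc (k - K)" for j
    proof -
      let ?m = "\<lambda>i. norm (multiplier (2 * pi * (1 / 2 ^ (K + i)) * \<xi>) ^ n (K + i))"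
      \<comment> \<open>The factor belonging to scale \<open>k\<close> stands at position
        \<open>k - K\<close> of the product.\<close>
      have "(\<Prod>i<j. ?m i) = ?m (k - K) * (\<Prod>i\<in>{..<j} - {k - K}. ?m i)"
        using j by (intro prod.remove) auto
      also have "\<dots> \<le> ?m (k - K) * 1" using le1 by (intro mult_left_mono prod_le_1) auto
      also have "?m (k - K) \<le> exp (- 1) ^ n k"
        using multiplier_small[OF k(2)] k(1) by (simp add: norm_power power_mono)
      also have "exp (- 1 :: real) ^ n k = exp (- real (n k))" by (simp add: exp_of_nat_mult[symmetric])
      finally have "(\<Prod>i<j. ?m i) \<le> exp (- real (n k))" by simp
      then have "norm (fourier1 (?f j) \<xi>) \<le> exp (- real (n k)) * A"
        unfolding smoothing_fourier norm_mult prod_norm[symmetric] using tA[of \<xi>] by (intro mult_mono) auto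
      then show ?thesis by (simp add: mult.commute)
    qed
    then show "norm (fourier1 f \<xi>) \<le> A * exp (- real (n k))"
      by (intro LIMSEQ_le_const2[OF tendsto_norm[OF flim[of \<xi>]]] exI[of _ "Suc (k - K)"]) simp
  qed
qed

section \<open>One real variable as the case \<open>d = 1\<close>\<close>

lemma lessThan_1: "{..<1::nat} = {0}" by auto

lemma nn_integral_leb_1:
  "f \<in> borel_measurable borel \<Longrightarrow> (\<integral>\<^sup>+x. f (x 0) \<partial>leb 1) = (\<integral>\<^sup>+t. f t \<partial>lborel)"
  unfolding lessThan_1 by (rule lebesgue_product.product_nn_integral_singleton) simp

lemma integral_leb_1:
  fixes f :: "real \<Rightarrow> 'a::{banach, second_countable_topology}"
  shows "f \<in> borel_measurable borel \<Longrightarrow> (\<integral>x. f (x 0) \<partial>leb 1) = (\<integral>t. f t \<partial>lborel)"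
  unfolding lessThan_1 by (rule lebesgue_product.product_integral_singleton) simp

lemma coordinate_0_measurable: "(\<lambda>x. x 0) \<in> borel_measurable (leb 1)"
  by (rule coordinate_measurable) simp

lemma integrable_leb_1:
  fixes f :: "real \<Rightarrow> 'a::{banach, second_countable_topology}"
  assumes "integrable lborel f"
  shows "integrable (leb 1) (\<lambda>x. f (x 0))"
proof -
  note [measurable] = coordinate_0_measurable
  have [measurable]: "f \<in> borel_measurable borel" using assms by simp
  show ?thesis
  proof (rule integrableI_bounded)
    have "(\<integral>\<^sup>+x. ennreal (norm (f (x 0))) \<partial>leb 1) = (\<integral>\<^sup>+t. ennreal (norm (f t)) \<partial>lborel)"
      by (rule nn_integral_leb_1) measurable
    then show "(\<integral>\<^sup>+x. ennreal (norm (f (x 0))) \<partial>leb 1) < \<infinity>"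
      using assms by (simp add: integrable_iff_bounded)
  qed measurable
qed

text \<open>An interval of length \<open>1\<close> loses at most the length \<open>1 / 2\<close> of
  \<open>{-1/4..1/4}\<close>, the interval in which the counterexample is supported.\<close>

lemma relatively_dense_complement:
  "relatively_dense 1 (1 / 2) 1 {x \<in> space (leb 1). x 0 \<notin> {-1/4..1/4}}"
  unfolding relatively_dense_def
proof (intro conjI allI)
  let ?E = "{x \<in> space (leb 1). x 0 \<notin> {-1/4..1/4}}"
  show E: "?E \<in> sets (leb 1)" using coordinate_0_measurable by measurable
  fix a :: "nat \<Rightarrow> real"
  have "ennreal (1 / 2) \<le> emeasure lborel ({a 0..a 0 + 1} - {-1/4..1/4})"
  proof -
    have "emeasure lborel {a 0..a 0 + 1} \<le> emeasure lborel (({a 0..a 0 + 1} - {-1/4..1/4}) \<union> {-1/4..1/4})"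
      by (intro emeasure_mono) auto
    also have "\<dots> \<le> emeasure lborel ({a 0..a 0 + 1} - {-1/4..1/4}) + emeasure lborel {-1/4..1/4::real}"
      by (intro emeasure_subadditive) auto
    also have "emeasure lborel {-1/4..1/4::real} = ennreal (1 / 2)" by (subst emeasure_lborel_Icc) auto
    finally have "ennreal 1 \<le> emeasure lborel ({a 0..a 0 + 1} - {-1/4..1/4}) + ennreal (1 / 2)" by simp
    then show ?thesis
    proof (cases "emeasure lborel ({a 0..a 0 + 1} - {-1/4..1/4})")
      case (real r)
      assume "ennreal 1 \<le> emeasure lborel ({a 0..a 0 + 1} - {-1/4..1/4}) + ennreal (1 / 2)"
      then have "ennreal 1 \<le> ennreal (r + 1 / 2)" using real by (simp add: ennreal_plus del: ennreal_1)
      then have "1 \<le> r + 1 / 2" using real by (subst (asm) ennreal_le_iff) auto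
      then show ?thesis unfolding real(2) by (intro ennreal_leI) simp
    qed simp
  qed
  also have "\<dots> = (\<integral>\<^sup>+t. indicator ({a 0..a 0 + 1} - {-1/4..1/4}) t \<partial>lborel)" by simp
  also have "\<dots> = (\<integral>\<^sup>+x. indicator ({a 0..a 0 + 1} - {-1/4..1/4}) (x 0) \<partial>leb 1)"
    by (rule nn_integral_leb_1[symmetric]) simp
  also have "\<dots> = (\<integral>\<^sup>+x. indicator (?E \<inter> cube 1 a 1) x \<partial>leb 1)"
    by (intro nn_integral_cong) (auto simp: indicator_def cube_def space_leb lessThan_1 PiE_iff)
  also have "\<dots> = emeasure (leb 1) (?E \<inter> cube 1 a 1)" using E by (intro nn_integral_indicator) simp
  finally show "ennreal (1 / 2) \<le> emeasure (leb 1) (?E \<inter> cube 1 a 1)" .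
qed

lemma fourier_integral_1:
  assumes f: "bump L s f"
  shows "fourier_integral 1 (\<lambda>x. complex_of_real (f (x 0))) \<xi> = fourier1 f (\<xi> 0)"
proof -
  have [measurable]: "f \<in> borel_measurable borel" by (rule bump_measurable[OF f])
  have "complex_of_real (f (t 0)) * exp (- 2 * complex_of_real pi * \<i> * complex_of_real (\<Sum>i<1. \<xi> i * t i))
    = complex_of_real (f (t 0)) * cis (- (2 * pi * \<xi> 0 * t 0))" for t
    by (simp add: cis_conv_exp lessThan_1 mult_ac)
  then have "fourier_integral 1 (\<lambda>x. complex_of_real (f (x 0))) \<xi>
    = (\<integral>t. complex_of_real (f (t 0)) * cis (- (2 * pi * \<xi> 0 * t 0)) \<partial>leb 1)"
    unfolding fourier_integral_def by (simp only:)
  also have "\<dots> = fourier1 f (\<xi> 0)"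
    unfolding fourier1_def by (rule integral_leb_1) measurable
  finally show ?thesis .
qed

lemma fourier1_measurable:
  assumes f: "bump L s f"
  shows "fourier1 f \<in> borel_measurable borel"
proof -
  have [measurable]: "f \<in> borel_measurable borel" by (rule bump_measurable[OF f])
  have "(\<lambda>\<xi>. fourier1 f \<xi>) \<in> borel_measurable lborel"
    unfolding fourier1_def by (rule lborel.borel_measurable_lebesgue_integral) measurable
  then show ?thesis by simp
qed

text \<open>A bump is integrable itself, so the constant sequence serves as approximation.\<close>

lemma fourier_transform_of_bump:
  assumes f: "bump L s f" and g2: "integrable lborel (\<lambda>\<xi>. (norm (fourier1 f \<xi>))\<^sup>2)"
  shows "square_integrable (leb 1) (\<lambda>x. complex_of_real (f (x 0)))"
    "is_fourier_transform 1 (\<lambda>x. complex_of_real (f (x 0))) (\<lambda>\<xi>. fourier1 f (\<xi> 0))"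
proof -
  let ?f = "\<lambda>x::nat \<Rightarrow> real. complex_of_real (f (x 0))"
  have [measurable]: "f \<in> borel_measurable borel" by (rule bump_measurable[OF f])
  have [measurable]: "fourier1 f \<in> borel_measurable borel" by (rule fourier1_measurable[OF f])
  have "continuous_on {-\<bar>s\<bar>..\<bar>s\<bar>} (\<lambda>x. (f x)\<^sup>2)" by (intro continuous_intros bump_continuous[OF f])
  from borel_integrable_compact[OF compact_Icc this]
  have "integrable lborel (\<lambda>x. indicator {-\<bar>s\<bar>..\<bar>s\<bar>} x *\<^sub>R (f x)\<^sup>2)" .
  also have "(\<lambda>x. indicator {-\<bar>s\<bar>..\<bar>s\<bar>} x *\<^sub>R (f x)\<^sup>2) = (\<lambda>x. (f x)\<^sup>2)"
  proof
    fix x show "indicator {-\<bar>s\<bar>..\<bar>s\<bar>} x *\<^sub>R (f x)\<^sup>2 = (f x)\<^sup>2"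
    proof (cases "\<bar>x\<bar> \<le> \<bar>s\<bar>")
      case True
      then show ?thesis by (simp add: abs_le_iff indicator_def)
    next
      case False
      then show ?thesis using bumpD(2)[OF f, of x] by simp
    qed
  qed
  finally have f2: "integrable (leb 1) (\<lambda>x. (f (x 0))\<^sup>2)" by (rule integrable_leb_1)
  have fm: "?f \<in> borel_measurable (leb 1)" and gm: "(\<lambda>\<xi>. fourier1 f (\<xi> 0)) \<in> borel_measurable (leb 1)"
    using coordinate_0_measurable by measurable
  show sq: "square_integrable (leb 1) ?f" using fm f2 by (simp add: square_integrable_def)
  have "integrable lborel (\<lambda>x. complex_of_real (f x))" using bump_integrable[OF f] by simp
  then have "integrable (leb 1) ?f" by (rule integrable_leb_1)
  moreover have "square_integrable (leb 1) (\<lambda>\<xi>. fourier1 f (\<xi> 0))"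
    using integrable_leb_1[OF g2] gm by (simp add: square_integrable_def)
  moreover have "fourier_integral 1 ?f = (\<lambda>\<xi>. fourier1 f (\<xi> 0))" using fourier_integral_1[OF f] by blast
  ultimately show "is_fourier_transform 1 ?f (\<lambda>\<xi>. fourier1 f (\<xi> 0))"
    unfolding is_fourier_transform_def using sq
    by (intro conjI exI[of _ "\<lambda>_. ?f"]) (simp_all add: L2_tendsto_def)
qed

section \<open>The counterexample\<close>

text \<open>The two summands below \<open>n k\<close> have separate tasks on
  \<open>2 ^ k \<le> \<bar>\<xi>\<bar> \<le> 2 ^ Suc k\<close>: the logarithm cancels the weight,
  which is at most \<open>w (2 ^ Suc k)\<close> there, and \<open>Suc k\<close> leaves a decay like
  \<open>1 / \<bar>\<xi>\<bar>\<close>, as \<open>2 < exp 1\<close>. Below \<open>2 ^ K\<close>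
  everything is bounded.\<close>

lemma weighted_decay:
  fixes w :: "real \<Rightarrow> real"
  assumes w: "\<And>s t. 0 \<le> s \<Longrightarrow> s \<le> t \<Longrightarrow> w s \<le> w t" "\<And>t. 0 \<le> t \<Longrightarrow> 1 \<le> w t"
    and A: "A \<ge> 0" "\<And>\<xi>. norm (F \<xi>) \<le> A"
    and n: "\<And>k. ln (w (2 ^ Suc k)) + real (Suc k) \<le> real (n k)"
    and dec: "\<And>k \<xi>. K \<le> k \<Longrightarrow> 2 ^ k \<le> \<bar>\<xi>\<bar> \<Longrightarrow> norm (F \<xi>) \<le> A * exp (- real (n k))"
  shows "\<exists>C. \<forall>\<xi>::real. (norm (F \<xi>) * w \<bar>\<xi>\<bar>)\<^sup>2 \<le> C * (1 / (1 + \<xi>\<^sup>2))"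
proof -
  define C where "C = (A * w (2 ^ K))\<^sup>2 * (1 + (2 ^ K)\<^sup>2) + 2 * A\<^sup>2"
  have wK: "w (2 ^ K) \<ge> 0" using w(2)[of "2 ^ K"] by simp
  have "(norm (F \<xi>) * w \<bar>\<xi>\<bar>)\<^sup>2 \<le> C * (1 / (1 + \<xi>\<^sup>2))" for \<xi>
  proof -
    have pos: "1 + \<xi>\<^sup>2 > 0" by (simp add: add_pos_nonneg)
    have w0: "w \<bar>\<xi>\<bar> \<ge> 0" using w(2)[of "\<bar>\<xi>\<bar>"] by simp
    have "(norm (F \<xi>) * w \<bar>\<xi>\<bar>)\<^sup>2 * (1 + \<xi>\<^sup>2) \<le> C"
    proof (cases "\<bar>\<xi>\<bar> \<le> 2 ^ K")
      case True
      have "norm (F \<xi>) * w \<bar>\<xi>\<bar> \<le> A * w (2 ^ K)" using True A w0 w(1) by (intro mult_mono) auto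
      then have "(norm (F \<xi>) * w \<bar>\<xi>\<bar>)\<^sup>2 \<le> (A * w (2 ^ K))\<^sup>2" using w0 by (intro power_mono) auto
      moreover have "\<bar>\<xi>\<bar>\<^sup>2 \<le> (2 ^ K)\<^sup>2" using True by (intro power_mono) auto
      ultimately have "(norm (F \<xi>) * w \<bar>\<xi>\<bar>)\<^sup>2 * (1 + \<xi>\<^sup>2) \<le> (A * w (2 ^ K))\<^sup>2 * (1 + (2 ^ K)\<^sup>2)"
        by (intro mult_mono) auto
      then show ?thesis by (simp add: C_def add_increasing2)
    next
      case False
      define k where "k = nat \<lfloor>log 2 \<bar>\<xi>\<bar>\<rfloor>"
      have x1: "\<bar>\<xi>\<bar> \<ge> 1" using False one_le_power[of "2::real" K] by linarith
      have lg: "log 2 \<bar>\<xi>\<bar> \<ge> 0" using x1 by simp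
      have k1: "real k \<le> log 2 \<bar>\<xi>\<bar>" "log 2 \<bar>\<xi>\<bar> < real (Suc k)" using lg by (auto simp: k_def) linarith
      have "2 powr real k \<le> \<bar>\<xi>\<bar>" "\<bar>\<xi>\<bar> < 2 powr real (Suc k)"
        using k1 x1 by (simp_all add: le_log_iff log_less_iff del: of_nat_Suc)
      then have k2: "2 ^ k \<le> \<bar>\<xi>\<bar>" "\<bar>\<xi>\<bar> \<le> 2 ^ Suc k" by (simp_all only: powr_realpow zero_less_numeral less_imp_le)
      have Kk: "K \<le> k"
      proof (rule ccontr)
        assume "\<not> K \<le> k"
        then have "(2::real) ^ Suc k \<le> 2 ^ K" by (intro power_increasing) auto
        then show False using k2 False by linarith
      qed
      have wk: "w (2 ^ Suc k) > 0" using w(2)[of "2 ^ Suc k"] by simp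
      have "norm (F \<xi>) * w \<bar>\<xi>\<bar> \<le> (A * exp (- real (n k))) * w (2 ^ Suc k)"
        using dec[OF Kk k2(1)] w(1)[OF _ k2(2)] w0 A by (intro mult_mono) auto
      also have "exp (- real (n k)) \<le> exp (- (ln (w (2 ^ Suc k)) + real (Suc k)))" using n[of k] by simp
      also have "exp (- (ln (w (2 ^ Suc k)) + real (Suc k))) = exp (- real (Suc k)) / w (2 ^ Suc k)"
        using wk by (simp add: exp_add exp_diff exp_minus field_simps)
      also have "A * (exp (- real (Suc k)) / w (2 ^ Suc k)) * w (2 ^ Suc k) = A * exp (- real (Suc k))"
        using wk by simp
      finally have le: "norm (F \<xi>) * w \<bar>\<xi>\<bar> \<le> A * exp (- real (Suc k))"
        using A wk by (simp add: mult_left_mono mult_right_mono)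
      have "(2::real) ^ Suc k \<le> exp 1 ^ Suc k" using exp_ge_add_one_self[of 1] by (intro power_mono) auto
      also have "exp 1 ^ Suc k = exp (real (Suc k))" by (simp only: exp_of_nat_mult[symmetric] mult_1_right)
      finally have "\<bar>\<xi>\<bar> \<le> exp (real (Suc k))" using k2 by linarith
      then have "\<bar>\<xi>\<bar> * exp (- real (Suc k)) \<le> 1"
        by (simp only: exp_minus) (simp add: field_simps)
      then have "A * (\<bar>\<xi>\<bar> * exp (- real (Suc k))) \<le> A * 1" using A by (intro mult_left_mono) auto
      moreover have "\<bar>\<xi>\<bar> * (norm (F \<xi>) * w \<bar>\<xi>\<bar>) \<le> \<bar>\<xi>\<bar> * (A * exp (- real (Suc k)))" using le by (intro mult_left_mono) auto
      ultimately have "\<bar>\<xi>\<bar> * (norm (F \<xi>) * w \<bar>\<xi>\<bar>) \<le> A" by (simp only: mult.left_commute mult_1_right)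
      then have "(\<bar>\<xi>\<bar> * (norm (F \<xi>) * w \<bar>\<xi>\<bar>))\<^sup>2 \<le> A\<^sup>2" using w0 by (intro power_mono) auto
      then have 1: "(norm (F \<xi>) * w \<bar>\<xi>\<bar>)\<^sup>2 * \<xi>\<^sup>2 \<le> A\<^sup>2" by (simp add: power_mult_distrib mult_ac)
      have "1 \<le> \<xi>\<^sup>2" using power_mono[OF x1, of 2] by simp
      then have "(norm (F \<xi>) * w \<bar>\<xi>\<bar>)\<^sup>2 * 1 \<le> (norm (F \<xi>) * w \<bar>\<xi>\<bar>)\<^sup>2 * \<xi>\<^sup>2" by (intro mult_left_mono) auto
      then have "(norm (F \<xi>) * w \<bar>\<xi>\<bar>)\<^sup>2 * (1 + \<xi>\<^sup>2) \<le> 2 * A\<^sup>2" using 1 by (simp add: distrib_left)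
      then show ?thesis by (simp add: C_def add_increasing)
    qed
    then show ?thesis using pos by (simp add: pos_le_divide_eq)
  qed
  then show ?thesis by blast
qed

text \<open>Already \<open>d = 1\<close>, \<open>\<gamma> = 1 / 2\<close> and \<open>l = 1\<close>
  violate the property, with \<open>CW\<close> fitted to a single function \<open>f\<close>. This
  function is not zero but vanishes on the relatively dense set, so no constant helps.\<close>

lemma not_PLS_property_of_convergent_integral:
  fixes W :: "real \<Rightarrow> ennreal"
  assumes W0: "W 0 = 1" and mono: "mono_on {0..} W"
    and fin: "(\<integral>\<^sup>+t\<in>{0..}. e2ennreal (ext_ln (W t) / ereal (1 + t\<^sup>2)) \<partial>lborel) < \<infinity>"
  shows "\<not> PLS_property W"
proof
  assume PLS: "PLS_property W"
  define w where "w = (\<lambda>t. enn2real (W t))"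
  note finW = weight_finite_of_integral[OF mono fin]
  have Ww: "W t = ennreal (w t)" if "t \<ge> 0" for t
    using ennreal_finite_weight[OF finW that] by (simp add: w_def)
  have wmono: "w s \<le> w t" if "0 \<le> s" "s \<le> t" for s t
    using mono that finW by (auto simp: w_def mono_on_def less_top intro!: enn2real_mono)
  have w1: "1 \<le> w t" if "0 \<le> t" for t
    using wmono[of 0 t] that W0 by (simp add: w_def)
  \<comment> \<open>Besides the logarithm, \<open>Suc k\<close> and the rounding are included;
    against \<open>1 / 2 ^ k\<close> they remain summable.\<close>
  define n where "n = (\<lambda>k. nat \<lceil>ln (w (2 ^ Suc k)) + real (Suc k)\<rceil>)"
  have lnw: "ln (w (2 ^ Suc k)) \<ge> 0" for k using w1[of "2 ^ Suc k"] by simp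
  have n: "ln (w (2 ^ Suc k)) + real (Suc k) \<le> real (n k)"
    "real (n k) \<le> ln (w (2 ^ Suc k)) + real (Suc k) + 1" for k
    using lnw[of k] unfolding n_def by linarith+
  have nsum: "summable (\<lambda>k. real (n k) / 2 ^ k)"
  proof -
    have 1: "summable (\<lambda>k. ln (w (2 ^ Suc k)) / 2 ^ k)" unfolding w_def by (rule convergent_dyadic_sum[OF W0 mono fin])
    have 2: "summable (\<lambda>k. (real k + 2) / 2 ^ k)"
    proof -
      have "summable (\<lambda>k. real k * (1 / 2) ^ k)"
      proof (rule summable_ratio_test[of "3/4" 4])
        fix k :: nat assume "4 \<le> k"
        then show "norm (real (Suc k) * (1 / 2) ^ Suc k) \<le> 3 / 4 * norm (real k * (1 / 2) ^ k)" by simp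
      qed simp
      moreover have "summable (\<lambda>k. 2 * (1 / 2 :: real) ^ k)" by (intro summable_mult summable_geometric) simp
      ultimately have "summable (\<lambda>k. real k * (1 / 2) ^ k + 2 * (1 / 2 :: real) ^ k)" by (rule summable_add)
      then show ?thesis by (simp add: power_divide add_divide_distrib)
    qed
    have "summable (\<lambda>k. ln (w (2 ^ Suc k)) / 2 ^ k + (real k + 2) / 2 ^ k)" by (rule summable_add[OF 1 2])
    then show ?thesis
    proof (rule summable_comparison_test'[where N = 0])
      fix k
      have "real (n k) / 2 ^ k \<le> (ln (w (2 ^ Suc k)) + (real k + 2)) / 2 ^ k" using n(2)[of k] by (intro divide_right_mono) auto
      then show "norm (real (n k) / 2 ^ k) \<le> ln (w (2 ^ Suc k)) / 2 ^ k + (real k + 2) / 2 ^ k"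
        by (simp add: add_divide_distrib)
    qed
  qed
  obtain f K A where f: "bump 1 (1 / 4) f" "fourier1 f 0 \<noteq> 0" and A: "A \<ge> 0" "\<And>\<xi>. norm (fourier1 f \<xi>) \<le> A"
    and dec: "\<And>k \<xi>. K \<le> k \<Longrightarrow> 2 ^ k \<le> \<bar>\<xi>\<bar> \<Longrightarrow> norm (fourier1 f \<xi>) \<le> A * exp (- real (n k))"
    by (rule compactly_supported_with_fast_decay[OF nsum]) (rule that)
  have [measurable]: "f \<in> borel_measurable borel" "fourier1 f \<in> borel_measurable borel"
    using bump_measurable[OF f(1)] fourier1_measurable[OF f(1)] .
  have "\<exists>C. \<forall>\<xi>::real. (norm (fourier1 f \<xi>) * w \<bar>\<xi>\<bar>)\<^sup>2 \<le> C * (1 / (1 + \<xi>\<^sup>2))"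
    by (rule weighted_decay[of w A "fourier1 f" n K])
      (erule (1) wmono, erule w1, rule A(1), rule A(2), rule n(1), erule (1) dec)
  then obtain C where C': "\<forall>\<xi>::real. (norm (fourier1 f \<xi>) * w \<bar>\<xi>\<bar>)\<^sup>2 \<le> C * (1 / (1 + \<xi>\<^sup>2))"
    by (rule exE)
  have C: "(norm (fourier1 f \<xi>) * w \<bar>\<xi>\<bar>)\<^sup>2 \<le> C * (1 / (1 + \<xi>\<^sup>2))" for \<xi>
    using C' by (rule spec)
  have Cint: "integrable lborel (\<lambda>\<xi>::real. C * (1 / (1 + \<xi>\<^sup>2)))"
    by (intro integrable_mult_right integrable_inverse_square_plus_one)
  have g2: "integrable lborel (\<lambda>\<xi>. (norm (fourier1 f \<xi>))\<^sup>2)"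
  proof (rule Bochner_Integration.integrable_bound[OF Cint])
    show "AE \<xi> in lborel. norm ((norm (fourier1 f \<xi>))\<^sup>2) \<le> norm (C * (1 / (1 + \<xi>\<^sup>2)))"
    proof (rule AE_I2)
      fix \<xi>
      have "norm (fourier1 f \<xi>) * 1 \<le> norm (fourier1 f \<xi>) * w \<bar>\<xi>\<bar>" using w1 by (intro mult_left_mono) auto
      then have "(norm (fourier1 f \<xi>))\<^sup>2 \<le> (norm (fourier1 f \<xi>) * w \<bar>\<xi>\<bar>)\<^sup>2" by (intro power_mono) auto
      then have "(norm (fourier1 f \<xi>))\<^sup>2 \<le> C * (1 / (1 + \<xi>\<^sup>2))" using C[of \<xi>] by (rule order.trans)
      then show "norm ((norm (fourier1 f \<xi>))\<^sup>2) \<le> norm (C * (1 / (1 + \<xi>\<^sup>2)))"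
        unfolding real_norm_def abs_power2 by (rule order.trans[OF _ abs_ge_self])
    qed
  qed measurable
  let ?f = "\<lambda>x::nat \<Rightarrow> real. complex_of_real (f (x 0))" and ?g = "\<lambda>\<xi>::nat \<Rightarrow> real. fourier1 f (\<xi> 0)"
  note ft = fourier_transform_of_bump[OF f(1) g2]
  define N where "N = (L2_norm (leb 1) ?f)\<^sup>2"
  \<comment> \<open>A function vanishing almost everywhere would have transform \<open>0\<close> at
    the origin.\<close>
  have "L2_norm (leb 1) ?f \<noteq> 0"
  proof
    assume "L2_norm (leb 1) ?f = 0"
    then have "(\<integral>x. (cmod (?f x))\<^sup>2 \<partial>leb 1) = 0" by (simp add: L2_norm_def)
    moreover have "integrable (leb 1) (\<lambda>x. (cmod (?f x))\<^sup>2)" using ft(1) by (simp only: square_integrable_def)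
    ultimately have "AE x in leb 1. (cmod (?f x))\<^sup>2 = 0" by (subst (asm) integral_nonneg_eq_0_iff_AE) auto
    then have "AE x in leb 1. complex_of_real (f (x 0)) = 0" by eventually_elim simp
    then have "(\<integral>x. complex_of_real (f (x 0)) \<partial>leb 1) = 0" by (rule integral_eq_zero_AE)
    moreover have "(\<integral>x. complex_of_real (f (x 0)) \<partial>leb 1) = (\<integral>x. complex_of_real (f x) \<partial>lborel)"
      by (rule integral_leb_1) measurable
    ultimately show False using f(2) by (simp add: fourier1_def)
  qed
  then have N: "N > 0" by (simp add: N_def)
  have Wg: "(\<integral>\<^sup>+\<xi>. (ennreal (cmod (?g \<xi>)) * W (L2_set \<xi> {..<1}))\<^sup>2 \<partial>leb 1) \<le> ennreal (\<integral>\<xi>. C * (1 / (1 + \<xi>\<^sup>2)) \<partial>lborel)"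
  proof -
    have "(\<integral>\<^sup>+\<xi>. (ennreal (cmod (?g \<xi>)) * W (L2_set \<xi> {..<1}))\<^sup>2 \<partial>leb 1)
      \<le> (\<integral>\<^sup>+\<xi>. ennreal (C * (1 / (1 + (\<xi> 0)\<^sup>2))) \<partial>leb 1)"
    proof (intro nn_integral_mono)
      fix \<xi> :: "nat \<Rightarrow> real"
      have r: "L2_set \<xi> {..<1} = \<bar>\<xi> 0\<bar>" by (simp add: L2_set_def lessThan_1)
      have "(ennreal (cmod (?g \<xi>)) * W (L2_set \<xi> {..<1}))\<^sup>2 = ennreal ((cmod (?g \<xi>) * w \<bar>\<xi> 0\<bar>)\<^sup>2)"
        unfolding r using w1[of "\<bar>\<xi> 0\<bar>"] by (simp add: Ww ennreal_mult[symmetric] ennreal_power)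
      also have "\<dots> \<le> ennreal (C * (1 / (1 + (\<xi> 0)\<^sup>2)))" by (intro ennreal_leI C)
      finally show "(ennreal (cmod (?g \<xi>)) * W (L2_set \<xi> {..<1}))\<^sup>2 \<le> ennreal (C * (1 / (1 + (\<xi> 0)\<^sup>2)))" .
    qed
    also have "\<dots> = (\<integral>\<^sup>+t. ennreal (C * (1 / (1 + t\<^sup>2))) \<partial>lborel)" by (rule nn_integral_leb_1) measurable
    also have "\<dots> = ennreal (\<integral>\<xi>. C * (1 / (1 + \<xi>\<^sup>2)) \<partial>lborel)"
    proof (rule nn_integral_eq_integral[OF Cint])
      have "0 \<le> C * (1 / (1 + \<xi>\<^sup>2))" for \<xi> :: real using C[of \<xi>] order.trans[OF zero_le_power2] by blast
      then show "AE \<xi>::real in lborel. 0 \<le> C * (1 / (1 + \<xi>\<^sup>2))" by simp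
    qed
    finally show ?thesis .
  qed
  \<comment> \<open>The summand \<open>1\<close> keeps \<open>R\<close>, and with it
    \<open>CW\<close>, positive.\<close>
  define R where "R = \<bar>\<integral>\<xi>. C * (1 / (1 + \<xi>\<^sup>2)) \<partial>(lborel :: real measure)\<bar> + 1"
  have R: "R > 0" by (simp add: R_def)
  define CW where "CW = sqrt (R / N)"
  have CW: "CW > 0" using R N by (simp add: CW_def)
  have CWN: "CW\<^sup>2 * (L2_norm (leb 1) ?f)\<^sup>2 = R" using R N unfolding N_def[symmetric] by (simp add: CW_def)
  have RC: "ennreal (\<integral>\<xi>. C * (1 / (1 + \<xi>\<^sup>2)) \<partial>(lborel :: real measure)) \<le> ennreal R"
    unfolding R_def by (intro ennreal_leI add_increasing2 abs_ge_self zero_le_one)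
  have bound: "(\<integral>\<^sup>+\<xi>. (ennreal (cmod (?g \<xi>)) * W (L2_set \<xi> {..<1}))\<^sup>2 \<partial>leb 1) \<le> ennreal (CW\<^sup>2 * (L2_norm (leb 1) ?f)\<^sup>2)"
    unfolding CWN by (rule order.trans[OF Wg RC])
  let ?E = "{x \<in> space (leb 1). x 0 \<notin> {-1/4..1/4}}"
  have "\<exists>C>0. \<forall>f g E. square_integrable (leb 1) f \<longrightarrow> is_fourier_transform 1 f g \<longrightarrow>
        (\<integral>\<^sup>+\<xi>. (ennreal (cmod (g \<xi>)) * W (L2_set \<xi> {..<1}))\<^sup>2 \<partial>leb 1) \<le> ennreal (CW\<^sup>2 * (L2_norm (leb 1) f)\<^sup>2) \<longrightarrow>
        relatively_dense 1 (1 / 2) 1 E \<longrightarrow> L2_norm (leb 1) f \<le> C * L2_norm (restrict_space (leb 1) E) f"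
    using PLS[unfolded PLS_property_def, THEN spec[of _ 1], THEN mp, THEN bspec[of _ _ "1 / 2"],
        THEN spec[of _ 1], THEN mp, THEN spec[of _ CW], THEN mp, OF order.refl _ zero_less_one CW] by simp
  then obtain D where D: "\<forall>f g E. square_integrable (leb 1) f \<longrightarrow> is_fourier_transform 1 f g \<longrightarrow>
        (\<integral>\<^sup>+\<xi>. (ennreal (cmod (g \<xi>)) * W (L2_set \<xi> {..<1}))\<^sup>2 \<partial>leb 1) \<le> ennreal (CW\<^sup>2 * (L2_norm (leb 1) f)\<^sup>2) \<longrightarrow>
        relatively_dense 1 (1 / 2) 1 E \<longrightarrow> L2_norm (leb 1) f \<le> D * L2_norm (restrict_space (leb 1) E) f"
    by (elim exE conjE)
  have "L2_norm (leb 1) ?f \<le> D * L2_norm (restrict_space (leb 1) ?E) ?f"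
    by (rule D[THEN spec[of _ ?f], THEN spec[of _ ?g], THEN spec[of _ ?E], THEN mp, THEN mp, THEN mp, THEN mp,
        OF ft(1) ft(2) bound relatively_dense_complement])
  also have "L2_norm (restrict_space (leb 1) ?E) ?f = 0"
  proof -
    have E: "?E \<in> sets (leb 1)" using relatively_dense_complement unfolding relatively_dense_def by blast
    have "(\<lambda>x. indicator ?E x * (cmod (?f x))\<^sup>2) = (\<lambda>_. 0)"
    proof
      fix x show "indicator ?E x * (cmod (?f x))\<^sup>2 = 0"
        using bumpD(2)[OF f(1), of "x 0"] by (auto simp: indicator_def abs_le_iff not_le)
    qed
    then show ?thesis unfolding L2_norm_restrict_space[OF E] by simp
  qed
  finally have "L2_norm (leb 1) ?f \<le> 0" by simp
  moreover have "L2_norm (leb 1) ?f \<ge> 0" by (simp add: L2_norm_def)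
  ultimately show False using N by (simp add: N_def)
qed

theorem theorem1p3:
  fixes W :: "real \<Rightarrow> ennreal"
  assumes "W 0 = 1"
    and "mono_on {0..} W"
    and "lower_semicontinuous_on {0..} W"
    and "(W \<longlongrightarrow> \<infinity>) at_top"
    and "ext_convex_on {0..} (\<lambda>s. ext_ln (W (exp s)))"
  shows "PLS_property W \<longleftrightarrow>
    (\<integral>\<^sup>+t\<in>{0..}. e2ennreal (ext_ln (W t) / ereal (1 + t\<^sup>2)) \<partial>lborel) = \<infinity>"
proof -
  let ?I = "\<integral>\<^sup>+t\<in>{0..}. e2ennreal (ext_ln (W t) / ereal (1 + t\<^sup>2)) \<partial>lborel"
  show ?thesis
  proof (cases "?I = \<infinity>")
    case True
    then show ?thesis using PLS_property_of_divergent_integral[OF assms(1,2,5)] by simp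
  next
    case False
    then have "?I < \<infinity>" unfolding infinity_ennreal_def by (rule less_top[THEN iffD1])
    from not_PLS_property_of_convergent_integral[OF assms(1,2) this] False show ?thesis by simp
  qed
qed

end
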